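(* Let $\Lambda\subset \mathbb{R}^{2d}$ be a lattice. For $(m,n)\in\Lambda$, with $m,n\in\mathbb{R}^d$, let $T_{m,n}$ be the associated translation-modulation transformation. For a function $g \in L^2(\mathbb{R}^d)$, assume that $\{ g_{m,n} = T_{m,n} (g): (m,n) \in \Lambda \}$ forms an exact frame for $L^2(\mathbb{R}^d)$, and let $\tilde g$ be the canonical dual to $g$. Then for any two vectors $v, w \in \mathbb{R}^{2d}$ for which $\Omega(v, w) \neq 0$, we have $$\| Q_v (g) \|_2 \, \| Q_w (g) \|_2 \, \| Q_v (\tilde g) \|_2 \, \| Q_w (\tilde g) \|_2 = \infty .$$
   Context: The translation-modulation transformation on $L^2(\mathbb{R}^d)$ associated with $(m,n)$ is $T_{m,n}(g)(x) = e^{2\pi i n\cdot x} g(x+m)$. A lattice in $\mathbb{R}^{2d}$ is the image of $\mathbb{Z}^{2d}$ under an invertible linear map. A collection $\{f_k\}\subset L^2(\mathbb{R}^d)$ is a frame for $L^2(\mathbb{R}^d)$ if there are constants $0<A\le B<\infty$ with $A\|f\|_2^2 \le \sum_k |\langle f,f_k\rangle|^2 \le B\|f\|_2^2$ for all $f\in L^2(\mathbb{R}^d)$; it is exact if it is no longer a frame after removal of any one of its elements. The frame operator is $S(f) = \sum_k \langle f,f_k\rangle f_k$, a bounded invertible operator on $L^2(\mathbb{R}^d)$. The canonical dual of $g$ is $\tilde g = S^{-1}(g)$, where $S$ is the frame operator of $\{g_{m,n}:(m,n)\in\Lambda\}$. The standard symplectic form on $\mathbb{R}^{2d}$ is $\Omega((x,y),(\xi,\eta))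 = x\cdot\eta - y\cdot\xi$ for $x,y,\xi,\eta\in\mathbb{R}^d$. For $v = (v^1,\ldots,v^{2d})\in\mathbb{R}^{2d}$ the differential operator $Q_v$ is $$Q_v(h)(x) = \frac{i}{2\pi}\sum_{k=1}^d v^{k+d}\frac{\partial h}{\partial x^k}(x) + \left(\sum_{k=1}^d v^k x^k\right) h(x),$$ with derivatives taken in the sense of (tempered) distributions. The norm $\|Q_v(h)\|_2$ is understood to be $\infty$ if the distribution $Q_v(h)$ is not in $L^2(\mathbb{R}^d)$. *)

theory Defs
  imports "HOL-Analysis.Analysis"
begin

section \<open>The space of square-integrable functions\<close>

text \<open>
  Elements of L2 are represented by functions, not by classes modulo null sets. Every class has
  a Borel representative, so Borel measurability loses nothing, and all notions below depend only
  on the class. The inner product is linear in the first argument.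
\<close>

definition L2 :: "(real ^ 'd::finite \<Rightarrow> complex) set" where
  "L2 = {f \<in> borel_measurable lborel. integrable lborel (\<lambda>x. (cmod (f x))\<^sup>2)}"

definition L2_norm :: "(real ^ 'd::finite \<Rightarrow> complex) \<Rightarrow> real" where
  "L2_norm f = sqrt (LINT x|lborel. (cmod (f x))\<^sup>2)"

definition L2_inner :: "(real ^ 'd::finite \<Rightarrow> complex) \<Rightarrow> (real ^ 'd \<Rightarrow> complex) \<Rightarrow> complex" where
  "L2_inner f h = (LINT x|lborel. f x * cnj (h x))"

text \<open>Unconditional convergence of a series of functions to \<open>s\<close> in the L2 norm.\<close>

definition L2_has_sum ::
    "('i \<Rightarrow> real ^ 'd::finite \<Rightarrow> complex) \<Rightarrow> 'i set \<Rightarrow> (real ^ 'd \<Rightarrow> complex) \<Rightarrow> bool" where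
  "L2_has_sum F I s \<longleftrightarrow> s \<in> L2 \<and>
     ((\<lambda>J. L2_norm (\<lambda>x. (\<Sum>k\<in>J. F k x) - s x)) \<longlongrightarrow> 0) (finite_subsets_at_top I)"


section \<open>Frames\<close>

definition is_frame :: "'i set \<Rightarrow> ('i \<Rightarrow> real ^ 'd::finite \<Rightarrow> complex) \<Rightarrow> bool" where
  "is_frame I f \<longleftrightarrow> (\<forall>k\<in>I. f k \<in> L2) \<and>
     (\<exists>A B. 0 < A \<and> A \<le> B \<and>
       (\<forall>h\<in>L2. (\<lambda>k. (cmod (L2_inner h (f k)))\<^sup>2) summable_on I \<and>
          A * (L2_norm h)\<^sup>2 \<le> (\<Sum>\<^sub>\<infinity>k\<in>I. (cmod (L2_inner h (f k)))\<^sup>2) \<and>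
          (\<Sum>\<^sub>\<infinity>k\<in>I. (cmod (L2_inner h (f k)))\<^sup>2) \<le> B * (L2_norm h)\<^sup>2))"

definition is_exact_frame :: "'i set \<Rightarrow> ('i \<Rightarrow> real ^ 'd::finite \<Rightarrow> complex) \<Rightarrow> bool" where
  "is_exact_frame I f \<longleftrightarrow> is_frame I f \<and> (\<forall>k\<in>I. \<not> is_frame (I - {k}) f)"

text \<open>
  The frame operator \<open>S\<close> of the family \<open>f\<close>, as a relation since functions represent classes:
  \<open>frame_operator I f h s\<close> means that \<open>S h = s\<close> almost everywhere.
\<close>

definition frame_operator ::
    "'i set \<Rightarrow> ('i \<Rightarrow> real ^ 'd::finite \<Rightarrow> complex) \<Rightarrow>
     (real ^ 'd \<Rightarrow> complex) \<Rightarrow> (real ^ 'd \<Rightarrow> complex) \<Rightarrow> bool" where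
  "frame_operator I f h s \<longleftrightarrow> h \<in> L2 \<and> L2_has_sum (\<lambda>k x. L2_inner h (f k) * f k x) I s"


section \<open>Time-frequency shifts and lattices\<close>

type_synonym 'd phase_space = "(real ^ 'd) \<times> (real ^ 'd)"

definition time_freq_shift ::
    "'d::finite phase_space \<Rightarrow> (real ^ 'd \<Rightarrow> complex) \<Rightarrow> real ^ 'd \<Rightarrow> complex" where
  "time_freq_shift = (\<lambda>(m, n) g x. exp (2 * complex_of_real pi * \<i> * complex_of_real (n \<bullet> x)) * g (x + m))"

text \<open>\<open>canonical_dual \<Lambda> g gd\<close> means that \<open>gd\<close> represents the inverse frame operator applied to \<open>g\<close>.\<close>

definition canonical_dual ::
    "'d::finite phase_space set \<Rightarrow> (real ^ 'd \<Rightarrow> complex) \<Rightarrow> (real ^ 'd \<Rightarrow> complex) \<Rightarrow> bool" where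
  "canonical_dual \<Lambda> g gd \<longleftrightarrow> frame_operator \<Lambda> (\<lambda>p. time_freq_shift p g) gd g"

definition integer_points :: "'d::finite phase_space set" where
  "integer_points = {(p, q). (\<forall>k. p $ k \<in> \<int>) \<and> (\<forall>k. q $ k \<in> \<int>)}"

definition is_lattice :: "'d::finite phase_space set \<Rightarrow> bool" where
  "is_lattice \<Lambda> \<longleftrightarrow>
     (\<exists>L :: 'd phase_space \<Rightarrow> 'd phase_space. linear L \<and> bij L \<and> \<Lambda> = L ` integer_points)"

definition symplectic_form :: "'d::finite phase_space \<Rightarrow> 'd phase_space \<Rightarrow> real" where
  "symplectic_form = (\<lambda>(x, y) (\<xi>, \<eta>). x \<bullet> \<eta> - y \<bullet> \<xi>)"


section \<open>Tempered distributions\<close>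

definition partial_deriv ::
    "'d::finite \<Rightarrow> (real ^ 'd \<Rightarrow> complex) \<Rightarrow> real ^ 'd \<Rightarrow> complex" where
  "partial_deriv k \<phi> x = frechet_derivative \<phi> (at x) (axis k 1)"

primrec partial_derivs ::
    "'d::finite list \<Rightarrow> (real ^ 'd \<Rightarrow> complex) \<Rightarrow> real ^ 'd \<Rightarrow> complex" where
  "partial_derivs [] \<phi> = \<phi>"
| "partial_derivs (k # ks) \<phi> = partial_deriv k (partial_derivs ks \<phi>)"

text \<open>
  Requiring every iterated partial derivative to be Frechet differentiable everywhere is the same
  as smoothness: differentiability at one order gives continuity of all derivatives of that order.
\<close>

definition schwartz :: "(real ^ 'd::finite \<Rightarrow> complex) set" where
  "schwartz = {\<phi>. (\<forall>ks x. partial_derivs ks \<phi> differentiable (at x)) \<and>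
     (\<forall>ks (N::nat). \<exists>C. \<forall>x. norm x ^ N * cmod (partial_derivs ks \<phi> x) \<le> C)}"

text \<open>
  Tempered distributions are functionals on Schwartz functions; only their values there matter.
  Functions act by the bilinear pairing (no conjugation). Every functional used below is
  built from an L2 function by differentiation and multiplication with linear polynomials, so
  linearity and continuity hold automatically and are not part of the type.
\<close>

type_synonym 'd distr = "(real ^ 'd \<Rightarrow> complex) \<Rightarrow> complex"

definition distr_of :: "(real ^ 'd::finite \<Rightarrow> complex) \<Rightarrow> 'd distr" where
  "distr_of h = (\<lambda>\<phi>. LINT x|lborel. h x * \<phi> x)"

definition distr_deriv :: "'d::finite \<Rightarrow> 'd distr \<Rightarrow> 'd distr" where
  "distr_deriv k T = (\<lambda>\<phi>. - T (partial_deriv k \<phi>))"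

definition distr_mult :: "(real ^ 'd::finite \<Rightarrow> complex) \<Rightarrow> 'd distr \<Rightarrow> 'd distr" where
  "distr_mult a T = (\<lambda>\<phi>. T (\<lambda>x. a x * \<phi> x))"

text \<open>
  A vector of the phase space is a pair \<open>v = (a, b)\<close>, where \<open>a\<close> holds the first \<open>d\<close>
  coordinates (the coefficients of multiplication by coordinates) and \<open>b\<close> the last \<open>d\<close>
  (the coefficients of the derivatives).
\<close>

definition Q_op :: "'d::finite phase_space \<Rightarrow> (real ^ 'd \<Rightarrow> complex) \<Rightarrow> 'd distr" where
  "Q_op v h = (\<lambda>\<phi>.
     \<i> / (2 * complex_of_real pi) *
       (\<Sum>k\<in>UNIV. complex_of_real (snd v $ k) * distr_deriv k (distr_of h) \<phi>) +
     distr_mult (\<lambda>x. complex_of_real (\<Sum>k\<in>UNIV. fst v $ k * x $ k)) (distr_of h) \<phi>)"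

text \<open>
  The L2 norm of a distribution. A representing L2 function is unique almost everywhere, so the
  infimum is its norm if one exists; otherwise it is the infimum of the empty set, which is \<open>\<infinity>\<close>.
\<close>

definition distr_L2_norm :: "'d::finite distr \<Rightarrow> ennreal" where
  "distr_L2_norm T =
     (INF u \<in> {u \<in> L2. \<forall>\<phi>\<in>schwartz. T \<phi> = distr_of u \<phi>}. ennreal (L2_norm u))"

end

theory Submission imports Defs
begin

text \<open>
  Put the Weyl operators into their symmetric normalisation, so that \<open>s \<mapsto> weyl (s z)\<close> is
  a one-parameter unitary group; up to the factor \<open>2 \<pi> \<i>\<close> its generator is \<open>Q_op v\<close> with
  \<open>z = (- snd v, fst v)\<close>. Exactness of the frame makes \<open>g\<close> biorthogonal to the translates of its
  dual, so \<open>\<langle>Q_v g, Q_w gd\<rangle> = \<Sum>l. \<langle>Q_v g, gd_l\<rangle> \<langle>g_l, Q_w gd\<rangle>\<close>. Moving the operators to the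
  other side of each factor costs nothing, because the commutator of \<open>Q_v\<close> with a translation is
  a multiple of that translation: it vanishes for \<open>l = 0\<close> and is killed by biorthogonality
  otherwise. After \<open>l \<mapsto> - l\<close> the sum is symmetric in \<open>v\<close> and \<open>w\<close>, whereas the canonical
  commutation relation gives \<open>\<langle>Q_v g, Q_w gd\<rangle> - \<langle>Q_w g, Q_v gd\<rangle> \<noteq> 0\<close>. All of this is carried out
  with difference quotients of the unitary groups, which converge strongly as soon as the
  distributional derivative is square integrable. Since \<open>0 \<cdot> \<infinity> = 0\<close>, it also has to be
  checked that no factor vanishes.
\<close>

section \<open>Square-integrable functions as a semi-inner product space\<close>

text \<open>Finite norms only place \<open>g\<close> and its dual in the domains of
  \<open>Q_v\<close> and \<open>Q_w\<close>; a product such as \<open>Q_v (Q_w g)\<close> need not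
  make sense, so the commutation relation is available only in weak, sesquilinear form. The Weyl
  operators are bounded and have no domain problems: each statement about generators is the limit of
  an exact identity between difference quotients. The price is the passage from a distributional
  derivative to an L2 derivative, which calls for a dense class of test functions preserved by all
  Weyl operators. The vector \<open>(- snd v, fst v)\<close> is \<open>v\<close> turned by the
  standard complex structure. This turn preserves the symplectic form, and it fits the convention of
  \<open>Q_op\<close> because i / (2 pi) = - 1 / (2 pi i). Functions are not identified modulo null
  sets, so everything is phrased with a seminorm; series are controlled by bounds that are uniform
  over finite partial sums, combined with density of finite combinations.\<close>

lemma L2I: "f \<in> borel_measurable borel \<Longrightarrow> integrable lborel (\<lambda>x. (cmod (f x))\<^sup>2) \<Longrightarrow> f \<in> L2"
  by (simp add: L2_def)

lemma L2D:
  assumes "f \<in> L2"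
  shows L2_measurable: "f \<in> borel_measurable borel"
    and L2_integrable: "integrable lborel (\<lambda>x. (cmod (f x))\<^sup>2)"
  using assms by (simp_all add: L2_def)

lemma L2_bounded_by:
  fixes f :: "real ^ 'd::finite \<Rightarrow> complex"
  assumes "f \<in> borel_measurable borel" "integrable lborel k"
    and "\<And>x. (cmod (f x))\<^sup>2 \<le> k x"
  shows "f \<in> L2"
  using assms(1)
proof (rule L2I)
  show "integrable lborel (\<lambda>x. (cmod (f x))\<^sup>2)"
    using assms by (intro Bochner_Integration.integrable_bound[OF assms(2)]) (auto intro: order_trans[OF _ abs_ge_self])
qed

lemma L2_add:
  assumes "f \<in> L2" "h \<in> L2"
  shows "(\<lambda>x. f x + h x) \<in> L2"
proof (rule L2_bounded_by)
  show "integrable lborel (\<lambda>x. 2 * (cmod (f x))\<^sup>2 + 2 * (cmod (h x))\<^sup>2)"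
    using assms by (simp add: L2_integrable)
  show "(cmod (f x + h x))\<^sup>2 \<le> 2 * (cmod (f x))\<^sup>2 + 2 * (cmod (h x))\<^sup>2" for x
  proof -
    have "(cmod (f x + h x))\<^sup>2 \<le> (cmod (f x) + cmod (h x))\<^sup>2"
      by (intro power_mono norm_triangle_ineq norm_ge_zero)
    also have "\<dots> \<le> 2 * (cmod (f x))\<^sup>2 + 2 * (cmod (h x))\<^sup>2"
      using zero_le_power2[of "cmod (f x) - cmod (h x)"] by (simp add: power2_sum power2_diff)
    finally show ?thesis .
  qed
qed (use assms[THEN L2_measurable] in simp)

lemma L2_scale:
  assumes "f \<in> L2"
  shows "(\<lambda>x. c * f x) \<in> L2"
  using assms L2_measurable[OF assms] by (intro L2I) (simp_all add: L2_integrable norm_mult power_mult_distrib)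

lemma L2_zero: "(\<lambda>x. 0) \<in> L2"
  by (rule L2I) simp_all

lemma L2_diff:
  assumes "f \<in> L2" "h \<in> L2"
  shows "(\<lambda>x. f x - h x) \<in> L2"
  using L2_add[OF assms(1) L2_scale[OF assms(2), of "-1"]] by simp

lemma L2_divide: "f \<in> L2 \<Longrightarrow> (\<lambda>x. f x / c) \<in> L2"
  using L2_scale[of f "1 / c"] by simp

lemma L2_sum:
  assumes "\<And>k. k \<in> J \<Longrightarrow> f k \<in> L2"
  shows "(\<lambda>x. \<Sum>k\<in>J. f k x) \<in> L2"
  using assms by (induction J rule: infinite_finite_induct) (simp_all add: L2_zero L2_add)

lemmas L2_intros = L2_add L2_diff L2_scale L2_zero L2_sum L2_divide

lemma L2_integrable_product:
  fixes f h :: "real ^ 'd::finite \<Rightarrow> complex"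
  assumes "f \<in> L2" "h \<in> L2"
  shows "integrable lborel (\<lambda>x. f x * h x)"
proof (rule Bochner_Integration.integrable_bound)
  show "integrable lborel (\<lambda>x. (cmod (f x))\<^sup>2 + (cmod (h x))\<^sup>2)"
    using assms by (simp add: L2_integrable)
  have "cmod (f x * h x) \<le> (cmod (f x))\<^sup>2 + (cmod (h x))\<^sup>2" for x
    using zero_le_power2[of "cmod (f x) - cmod (h x)"]
      mult_nonneg_nonneg[OF norm_ge_zero[of "f x"] norm_ge_zero[of "h x"]]
    unfolding norm_mult power2_diff by linarith
  then show "AE x in lborel. norm (f x * h x) \<le> norm ((cmod (f x))\<^sup>2 + (cmod (h x))\<^sup>2)"
    by simp
qed (use assms[THEN L2_measurable] in simp)

lemma L2_cnj: "f \<in> L2 \<Longrightarrow> (\<lambda>x. cnj (f x)) \<in> L2"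
  by (frule L2_measurable, intro L2I)
    (simp_all add: L2_integrable borel_measurable_continuous_on[OF continuous_on_cnj[OF continuous_on_id]])

lemma L2_integrable_inner:
  fixes f h :: "real ^ 'd::finite \<Rightarrow> complex"
  assumes "f \<in> L2" "h \<in> L2"
  shows "integrable lborel (\<lambda>x. f x * cnj (h x))"
  using L2_integrable_product[OF assms(1) L2_cnj[OF assms(2)]] .

lemma L2_inner_cnj: "cnj (L2_inner f h) = L2_inner h f"
  unfolding L2_inner_def by (simp add: Bochner_Integration.integral_cnj [symmetric] mult.commute)

lemma L2_inner_add_left:
  "f \<in> L2 \<Longrightarrow> h \<in> L2 \<Longrightarrow> p \<in> L2 \<Longrightarrow> L2_inner (\<lambda>x. f x + h x) p = L2_inner f p + L2_inner h p"
  by (simp add: L2_inner_def distrib_right L2_integrable_inner)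

lemma L2_inner_diff_left:
  "f \<in> L2 \<Longrightarrow> h \<in> L2 \<Longrightarrow> p \<in> L2 \<Longrightarrow> L2_inner (\<lambda>x. f x - h x) p = L2_inner f p - L2_inner h p"
  by (simp add: L2_inner_def left_diff_distrib L2_integrable_inner)

lemma L2_inner_scale_left: "L2_inner (\<lambda>x. c * f x) p = c * L2_inner f p"
  by (simp add: L2_inner_def mult.assoc)

lemma L2_inner_zero_left: "L2_inner (\<lambda>x. 0) p = 0"
  by (simp add: L2_inner_def)

lemma L2_inner_divide_left: "L2_inner (\<lambda>x. f x / c) p = L2_inner f p / c"
  using L2_inner_scale_left[of "1 / c" f p] by simp

lemma L2_inner_sum_left:
  "(\<And>k. k \<in> J \<Longrightarrow> f k \<in> L2) \<Longrightarrow> p \<in> L2 \<Longrightarrow>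
    L2_inner (\<lambda>x. \<Sum>k\<in>J. f k x) p = (\<Sum>k\<in>J. L2_inner (f k) p)"
  by (induction J rule: infinite_finite_induct)
    (simp_all add: L2_inner_zero_left L2_inner_add_left L2_sum)

lemma L2_inner_add_right:
  "f \<in> L2 \<Longrightarrow> h \<in> L2 \<Longrightarrow> p \<in> L2 \<Longrightarrow> L2_inner p (\<lambda>x. f x + h x) = L2_inner p f + L2_inner p h"
  by (simp add: L2_inner_add_left flip: L2_inner_cnj[of _ p])

lemma L2_inner_diff_right:
  "f \<in> L2 \<Longrightarrow> h \<in> L2 \<Longrightarrow> p \<in> L2 \<Longrightarrow> L2_inner p (\<lambda>x. f x - h x) = L2_inner p f - L2_inner p h"
  by (simp add: L2_inner_diff_left flip: L2_inner_cnj[of _ p])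

lemma L2_inner_scale_right: "L2_inner p (\<lambda>x. c * f x) = cnj c * L2_inner p f"
  by (simp add: L2_inner_scale_left flip: L2_inner_cnj[of _ p])

lemma L2_inner_zero_right: "L2_inner p (\<lambda>x. 0) = 0"
  by (simp add: L2_inner_def)

lemma L2_inner_sum_right:
  "(\<And>k. k \<in> J \<Longrightarrow> f k \<in> L2) \<Longrightarrow> p \<in> L2 \<Longrightarrow>
    L2_inner p (\<lambda>x. \<Sum>k\<in>J. f k x) = (\<Sum>k\<in>J. L2_inner p (f k))"
  by (induction J rule: infinite_finite_induct)
    (simp_all add: L2_inner_zero_right L2_inner_add_right L2_sum)

lemmas L2_inner_simps = L2_inner_add_left L2_inner_diff_left L2_inner_scale_left L2_inner_zero_left
  L2_inner_sum_left L2_inner_add_right L2_inner_diff_right L2_inner_scale_right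
  L2_inner_zero_right L2_inner_sum_right L2_inner_divide_left

lemma L2_norm_nonneg: "0 \<le> L2_norm f"
  by (simp add: L2_norm_def)

lemma L2_norm_power2: "(L2_norm f)\<^sup>2 = (LINT x|lborel. (cmod (f x))\<^sup>2)"
  by (simp add: L2_norm_def)

lemma L2_inner_self: "L2_inner f f = complex_of_real ((L2_norm f)\<^sup>2)"
  unfolding L2_inner_def L2_norm_power2 complex_norm_square[symmetric]
  by (rule integral_complex_of_real)

lemma L2_norm_scale: "L2_norm (\<lambda>x. c * f x) = cmod c * L2_norm f"
  by (simp add: L2_norm_def norm_mult power_mult_distrib real_sqrt_mult)

lemma L2_norm_divide: "L2_norm (\<lambda>x. f x / c) = L2_norm f / cmod c"
  using L2_norm_scale[of "1 / c" f] by (simp add: norm_divide)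

lemma L2_norm_diff_commute: "L2_norm (\<lambda>x. f x - h x) = L2_norm (\<lambda>x. h x - f x)"
  by (simp add: L2_norm_def norm_minus_commute)

lemma L2_norm_power2_diff:
  assumes "f \<in> L2" "h \<in> L2"
  shows "(L2_norm (\<lambda>x. f x - h x))\<^sup>2 = (L2_norm f)\<^sup>2 - 2 * Re (L2_inner f h) + (L2_norm h)\<^sup>2"
proof -
  have "complex_of_real ((L2_norm (\<lambda>x. f x - h x))\<^sup>2) = L2_inner f f - L2_inner f h - L2_inner h f + L2_inner h h"
    using assms unfolding L2_inner_self[symmetric] by (simp add: L2_inner_simps L2_intros)
  then have "(L2_norm (\<lambda>x. f x - h x))\<^sup>2 = Re (L2_inner f f - L2_inner f h - L2_inner h f + L2_inner h h)"
    by (metis Re_complex_of_real)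
  also have "Re (L2_inner h f) = Re (L2_inner f h)"
    by (subst L2_inner_cnj[symmetric]) simp
  ultimately show ?thesis by (simp add: L2_inner_self)
qed

text \<open>Expand the square of the seminorm of f - t c h for real t, with c the inner product. A
  seminorm may vanish on h \<noteq> 0, which makes the case n = 0 a genuine one.\<close>

lemma L2_Cauchy_Schwarz:
  assumes f: "f \<in> L2" and h: "h \<in> L2"
  shows "cmod (L2_inner f h) \<le> L2_norm f * L2_norm h"
proof -
  define c where "c = L2_inner f h"
  define n where "n = (L2_norm h)\<^sup>2"
  have nn: "n \<ge> 0" by (simp add: n_def)
  have *: "0 \<le> (L2_norm f)\<^sup>2 - 2 * t * (cmod c)\<^sup>2 + t\<^sup>2 * (cmod c)\<^sup>2 * n" for t
  proof -
    have "0 \<le> (L2_norm (\<lambda>x. f x - (of_real t * c) * h x))\<^sup>2" by simp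
    also have "\<dots> = (L2_norm f)\<^sup>2 - 2 * Re (cnj (of_real t * c) * c) + (L2_norm (\<lambda>x. (of_real t * c) * h x))\<^sup>2"
      using f h by (simp only: L2_norm_power2_diff L2_intros L2_inner_simps c_def)
    also have "cnj (of_real t * c) * c = complex_of_real (t * (cmod c)\<^sup>2)"
      by (simp add: complex_norm_square mult.commute mult.left_commute flip: of_real_power)
    finally show ?thesis
      by (simp add: L2_norm_scale power_mult_distrib norm_mult n_def)
  qed
  have "(cmod c)\<^sup>2 \<le> (L2_norm f)\<^sup>2 * n"
  proof (cases "n = 0")
    case True
    have "cmod c = 0"
    proof (rule ccontr)
      assume "cmod c \<noteq> 0"
      \<comment> \<open>For n = 0 the quadratic in t degenerates to a line, and at the chosen t it
        takes the value -1.\<close>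
      then show False
        using *[of "((L2_norm f)\<^sup>2 + 1) / (2 * (cmod c)\<^sup>2)"] True by (simp add: field_simps)
    qed
    then show ?thesis using nn by simp
  next
    case False
    then have "n > 0" using nn by simp
    then show ?thesis using *[of "1/n"] by (simp add: field_simps power2_eq_square)
  qed
  then have "(cmod c)\<^sup>2 \<le> (L2_norm f * L2_norm h)\<^sup>2"
    by (simp add: n_def power_mult_distrib)
  then show ?thesis
    unfolding c_def by (rule power2_le_imp_le) (simp add: L2_norm_nonneg)
qed

lemma L2_norm_triangle_diff:
  assumes "f \<in> L2" "h \<in> L2" "p \<in> L2"
  shows "L2_norm (\<lambda>x. f x - p x) \<le> L2_norm (\<lambda>x. f x - h x) + L2_norm (\<lambda>x. h x - p x)"
proof (rule power2_le_imp_le)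
  let ?u = "\<lambda>x. f x - h x" and ?w = "\<lambda>x. p x - h x"
  have L: "?u \<in> L2" "?w \<in> L2" using assms by (auto intro: L2_intros)
  have "(L2_norm (\<lambda>x. f x - p x))\<^sup>2 = (L2_norm (\<lambda>x. ?u x - ?w x))\<^sup>2" by simp
  also have "\<dots> = (L2_norm ?u)\<^sup>2 - 2 * Re (L2_inner ?u ?w) + (L2_norm ?w)\<^sup>2"
    by (rule L2_norm_power2_diff[OF L])
  also have "\<dots> \<le> (L2_norm ?u)\<^sup>2 + 2 * (L2_norm ?u * L2_norm ?w) + (L2_norm ?w)\<^sup>2"
    using L2_Cauchy_Schwarz[OF L] abs_Re_le_cmod[of "L2_inner ?u ?w"] by linarith
  also have "\<dots> = (L2_norm ?u + L2_norm ?w)\<^sup>2" by (simp add: power2_sum)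
  finally show "(L2_norm (\<lambda>x. f x - p x))\<^sup>2 \<le> (L2_norm ?u + L2_norm (\<lambda>x. h x - p x))\<^sup>2"
    by (simp add: L2_norm_diff_commute[of h p])
qed (simp add: L2_norm_nonneg)

lemma L2_norm_zero: "L2_norm (\<lambda>x. 0) = 0"
  by (simp add: L2_norm_def)

lemma L2_norm_triangle:
  assumes "f \<in> L2" "h \<in> L2"
  shows "L2_norm (\<lambda>x. f x + h x) \<le> L2_norm f + L2_norm h"
proof -
  have "L2_norm (\<lambda>x. 0 - (- 1) * h x) = L2_norm h" by (simp add: L2_norm_def)
  then show ?thesis
    using L2_norm_triangle_diff[OF assms(1) L2_zero L2_scale[OF assms(2), of "-1"]] by simp
qed

text \<open>The error is split so that every term contains a difference tending to 0 and otherwise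
  only the limits \<open>f0\<close> and \<open>h0\<close>.\<close>

lemma L2_inner_tendsto:
  assumes "\<And>t. f t \<in> L2" "\<And>t. h t \<in> L2" "f0 \<in> L2" "h0 \<in> L2"
    and f: "((\<lambda>t. L2_norm (\<lambda>x. f t x - f0 x)) \<longlongrightarrow> 0) F"
    and h: "((\<lambda>t. L2_norm (\<lambda>x. h t x - h0 x)) \<longlongrightarrow> 0) F"
  shows "((\<lambda>t. L2_inner (f t) (h t)) \<longlongrightarrow> L2_inner f0 h0) F"
proof -
  let ?a = "\<lambda>t. L2_norm (\<lambda>x. f t x - f0 x)" and ?b = "\<lambda>t. L2_norm (\<lambda>x. h t x - h0 x)"
  have "((\<lambda>t. ?a t * ?b t + ?a t * L2_norm h0 + L2_norm f0 * ?b t) \<longlongrightarrow> 0 * 0 + 0 * L2_norm h0 + L2_norm f0 * 0) F"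
    by (intro tendsto_intros f h)
  then have lim: "((\<lambda>t. ?a t * ?b t + ?a t * L2_norm h0 + L2_norm f0 * ?b t) \<longlongrightarrow> 0) F" by simp
  have L: "(\<lambda>x. f t x - f0 x) \<in> L2" "(\<lambda>x. h t x - h0 x) \<in> L2" for t
    using assms(1-4) by (simp_all add: L2_diff)
  have "cmod (L2_inner (f t) (h t) - L2_inner f0 h0) \<le> ?a t * ?b t + ?a t * L2_norm h0 + L2_norm f0 * ?b t" for t
  proof -
    have eq: "L2_inner (f t) (h t) - L2_inner f0 h0 =
        L2_inner (\<lambda>x. f t x - f0 x) (\<lambda>x. h t x - h0 x) + L2_inner (\<lambda>x. f t x - f0 x) h0
        + L2_inner f0 (\<lambda>x. h t x - h0 x)"
      using assms(1-4) by (simp add: L2_inner_simps L2_intros)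
    show ?thesis
      unfolding eq
      by (intro order_trans[OF norm_triangle_ineq] add_mono L2_Cauchy_Schwarz L assms(3,4))
  qed
  then have "((\<lambda>t. L2_inner (f t) (h t) - L2_inner f0 h0) \<longlongrightarrow> 0) F"
    by (intro Lim_null_comparison[OF _ lim]) simp
  then show ?thesis by (simp add: LIM_zero_iff)
qed

section \<open>Weyl operators\<close>

text \<open>The phase \<open>\<pi> m \<cdot> n\<close>, absent from \<^const>\<open>time_freq_shift\<close>, makes
  \<open>s \<mapsto> weyl (s z)\<close> a group.\<close>

definition weyl :: "'d::finite phase_space \<Rightarrow> (real ^ 'd \<Rightarrow> complex) \<Rightarrow> real ^ 'd \<Rightarrow> complex" where
  "weyl z f x = cis (2 * pi * (snd z \<bullet> x) + pi * (fst z \<bullet> snd z)) * f (x + fst z)"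

text \<open>The extra phase depends on \<open>z\<close> alone, so the two families share their frame
  bounds and their frame operator.\<close>

lemma time_freq_shift_weyl:
  "time_freq_shift z f x = cis (- (pi * (fst z \<bullet> snd z))) * weyl z f x"
proof -
  have "exp (2 * complex_of_real pi * \<i> * complex_of_real (snd z \<bullet> x)) = cis (2 * pi * (snd z \<bullet> x))"
    unfolding cis_conv_exp by (rule arg_cong[where f = exp]) (simp add: mult_ac)
  moreover have "cis (2 * pi * (snd z \<bullet> x)) =
      cis (- (pi * (fst z \<bullet> snd z))) * cis (2 * pi * (snd z \<bullet> x) + pi * (fst z \<bullet> snd z))"
    by (simp add: cis_mult)
  ultimately show ?thesis
    by (simp add: time_freq_shift_def weyl_def case_prod_beta)
qed

lemma weyl_zero: "weyl 0 f = f"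
  by (rule ext) (simp add: weyl_def)

text \<open>A projective representation of phase space. With the symmetric phase the cocycle is a
  function of the symplectic form, hence trivial on every line through 0.\<close>

lemma weyl_comp:
  "weyl z (weyl z' f) x = cis (pi * symplectic_form z z') * weyl (z + z') f x"
proof -
  \<comment> \<open>An identity between abstract reals: the two premises isolate the only places
    where the inner product has to be commuted.\<close>
  have *: "2 * p * s + p * t + (2 * p * (u + v) + p * w) = p * (v' - y) + (2 * p * (s + u) + p * (t + y' + (v' + w)))"
    if "v' = v" "y' = y" for p s t u v w v' y y' :: real
    unfolding that by (simp add: distrib_left right_diff_distrib)
  have "2 * pi * (snd z \<bullet> x) + pi * (fst z \<bullet> snd z) + (2 * pi * (snd z' \<bullet> (x + fst z)) + pi * (fst z' \<bullet> snd z')) =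
    pi * symplectic_form z z' + (2 * pi * (snd (z + z') \<bullet> x) + pi * (fst (z + z') \<bullet> snd (z + z')))"
    unfolding symplectic_form_def case_prod_beta fst_add snd_add inner_add_left inner_add_right
    by (rule *) (rule inner_commute)+
  then have "cis (2 * pi * (snd z \<bullet> x) + pi * (fst z \<bullet> snd z))
      * cis (2 * pi * (snd z' \<bullet> (x + fst z)) + pi * (fst z' \<bullet> snd z')) =
    cis (pi * symplectic_form z z') * cis (2 * pi * (snd (z + z') \<bullet> x) + pi * (fst (z + z') \<bullet> snd (z + z')))"
    unfolding cis_mult by (rule arg_cong)
  then show ?thesis by (simp only: weyl_def add.assoc mult.assoc[symmetric] fst_add)
qed

lemma weyl_add: "weyl z (\<lambda>x. f x + h x) x = weyl z f x + weyl z h x"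
  and weyl_diff: "weyl z (\<lambda>x. f x - h x) x = weyl z f x - weyl z h x"
  and weyl_scale: "weyl z (\<lambda>x. c * f x) x = c * weyl z f x"
  by (simp_all add: weyl_def algebra_simps)

lemma symplectic_form_bilinear:
  "symplectic_form (s *\<^sub>R z) z' = s * symplectic_form z z'"
  "symplectic_form z (s *\<^sub>R z') = s * symplectic_form z z'"
  "symplectic_form (- z) z' = - symplectic_form z z'"
  "symplectic_form z (- z') = - symplectic_form z z'"
  by (simp_all add: symplectic_form_def case_prod_beta algebra_simps)

lemma symplectic_form_skew: "symplectic_form z' z = - symplectic_form z z'"
  by (simp add: symplectic_form_def case_prod_beta inner_commute)

lemma symplectic_form_self: "symplectic_form z z = 0"
  by (simp add: symplectic_form_def case_prod_beta inner_commute)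

lemma weyl_add_collinear: "weyl ((s + t) *\<^sub>R z) f = weyl (s *\<^sub>R z) (weyl (t *\<^sub>R z) f)"
  by (rule ext) (simp add: weyl_comp symplectic_form_bilinear symplectic_form_self scaleR_left_distrib)

lemma weyl_minus_cancel: "weyl (- z) (weyl z f) = f" "weyl z (weyl (- z) f) = f"
  by (rule ext, simp add: weyl_comp symplectic_form_bilinear symplectic_form_self weyl_zero)+

text \<open>Weyl form of the canonical commutation relations: the two orders carry opposite
  cocycles, so the phase doubles.\<close>

lemma weyl_swap: "weyl z (weyl z' f) x = cis (2 * pi * symplectic_form z z') * weyl z' (weyl z f) x"
proof -
  have "cis (pi * symplectic_form z z') = cis (2 * pi * symplectic_form z z') * cis (pi * symplectic_form z' z)"
    by (simp add: cis_mult symplectic_form_skew[of z' z])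
  then show ?thesis by (simp add: weyl_comp add.commute)
qed

section \<open>Translation invariance and unitarity\<close>

lemma lborel_integral_shift:
  fixes f :: "'a::euclidean_space \<Rightarrow> 'b::{banach, second_countable_topology}"
  assumes "f \<in> borel_measurable borel"
  shows "(LINT x|lborel. f (x + m)) = (LINT x|lborel. f x)"
proof -
  have "(LINT x|lborel. f x) = (LINT x|distr lborel borel ((+) m). f x)" by (simp add: lborel_distr_plus)
  also have "\<dots> = (LINT x|lborel. f (x + m))"
    using assms by (subst integral_distr) (simp_all add: add.commute)
  finally show ?thesis by simp
qed

lemma lborel_integrable_shift:
  fixes f :: "'a::euclidean_space \<Rightarrow> 'b::{banach, second_countable_topology}"
  assumes "integrable lborel f"
  shows "integrable lborel (\<lambda>x. f (x + m))"
proof -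
  have "integrable (distr lborel borel ((+) m)) f" using assms by (simp add: lborel_distr_plus)
  then show ?thesis
    using borel_measurable_integrable[OF assms] by (subst (asm) integrable_distr_eq) (simp_all add: add.commute)
qed

lemma borel_measurable_cis [measurable]: "cis \<in> borel_measurable borel"
  by (intro borel_measurable_continuous_onI continuous_intros)

lemma weyl_L2:
  assumes "f \<in> L2"
  shows "weyl z f \<in> L2"
proof (rule L2I)
  have [measurable]: "f \<in> borel_measurable borel" using assms by (rule L2_measurable)
  show "weyl z f \<in> borel_measurable borel"
    unfolding weyl_def [abs_def] by measurable
  have "integrable lborel (\<lambda>x. (cmod (f (x + fst z)))\<^sup>2)"
    by (rule lborel_integrable_shift[OF L2_integrable[OF assms]])
  then show "integrable lborel (\<lambda>x. (cmod (weyl z f x))\<^sup>2)"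
    by (simp add: weyl_def norm_mult)
qed

lemma weyl_isometry:
  assumes "f \<in> L2" "h \<in> L2"
  shows "L2_inner (weyl z f) (weyl z h) = L2_inner f h"
proof -
  have "weyl z f x * cnj (weyl z h x) = f (x + fst z) * cnj (h (x + fst z))" for x
    by (simp add: weyl_def cis_cnj cis_mult)
  then show ?thesis
    unfolding L2_inner_def
    using lborel_integral_shift[of "\<lambda>x. f x * cnj (h x)" "fst z"]
      borel_measurable_integrable[OF L2_integrable_inner[OF assms]] by simp
qed

lemma weyl_norm: "f \<in> L2 \<Longrightarrow> L2_norm (weyl z f) = L2_norm f"
  using weyl_isometry[of f f z] by (simp add: L2_inner_self L2_norm_nonneg flip: of_real_power)

lemma weyl_adjoint:
  assumes "f \<in> L2" "h \<in> L2"
  shows "L2_inner (weyl z f) h = L2_inner f (weyl (- z) h)"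
  using weyl_isometry[OF assms(1) weyl_L2[OF assms(2)], of z "- z"] by (simp add: weyl_minus_cancel)

section \<open>Gaussian test functions\<close>

text \<open>An \<open>L2\<close>-dense class of Schwartz functions that is invariant under differentiation and
  Weyl operators.\<close>

inductive_set gaussian_fun :: "(real ^ 'd::finite \<Rightarrow> complex) set" where
  base: "0 < k \<Longrightarrow> (\<lambda>x. exp (- complex_of_real (k * (x \<bullet> x)) + (\<Sum>i\<in>UNIV. c $ i * complex_of_real (x $ i)))) \<in> gaussian_fun"
| coord: "\<phi> \<in> gaussian_fun \<Longrightarrow> (\<lambda>x. complex_of_real (x $ i) * \<phi> x) \<in> gaussian_fun"
| scale: "\<phi> \<in> gaussian_fun \<Longrightarrow> (\<lambda>x. a * \<phi> x) \<in> gaussian_fun"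
| add: "\<phi> \<in> gaussian_fun \<Longrightarrow> \<psi> \<in> gaussian_fun \<Longrightarrow> (\<lambda>x. \<phi> x + \<psi> x) \<in> gaussian_fun"

lemma gaussian_fun_zero: "(\<lambda>x. 0) \<in> gaussian_fun"
  using gaussian_fun.scale[OF gaussian_fun.base[of 1 0], of 0] by simp

lemma gaussian_fun_sum: "(\<And>k. k \<in> J \<Longrightarrow> \<phi> k \<in> gaussian_fun) \<Longrightarrow> (\<lambda>x. \<Sum>k\<in>J. \<phi> k x) \<in> gaussian_fun"
  by (induction J rule: infinite_finite_induct) (simp_all add: gaussian_fun_zero gaussian_fun.add)

lemma gaussian_fun_inner:
  assumes "\<phi> \<in> gaussian_fun"
  shows "(\<lambda>x. complex_of_real (n \<bullet> x) * \<phi> x) \<in> gaussian_fun"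
proof -
  have "(\<lambda>x. \<Sum>i\<in>UNIV. complex_of_real (n $ i) * (complex_of_real (x $ i) * \<phi> x)) \<in> gaussian_fun"
    using assms by (intro gaussian_fun_sum gaussian_fun.scale gaussian_fun.coord)
  then show ?thesis by (simp add: inner_vec_def sum_distrib_right mult.assoc)
qed

text \<open>The gradient is existentially quantified because \<open>partial_deriv\<close> reads off
  a Frechet derivative, whose value is known only after differentiability has been established.
  Uniqueness of derivatives identifies the two afterwards.\<close>

lemma gaussian_fun_has_gradient:
  fixes \<phi> :: "real ^ 'd::finite \<Rightarrow> complex"
  assumes "\<phi> \<in> gaussian_fun"
  shows "\<exists>D. (\<forall>k. D k \<in> gaussian_fun) \<and>
    (\<forall>x. (\<phi> has_derivative (\<lambda>h. \<Sum>k\<in>UNIV. complex_of_real (h $ k) * D k x)) (at x))"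
  using assms
proof induction
  case (base k c)
  let ?e = "\<lambda>x. exp (- complex_of_real (k * (x \<bullet> x)) + (\<Sum>i\<in>UNIV. c $ i * complex_of_real (x $ i)))"
  have e: "?e \<in> gaussian_fun" using base by (rule gaussian_fun.base)
  show ?case
  proof (rule exI[of _ "\<lambda>i x. complex_of_real (- 2 * k) * (complex_of_real (x $ i) * ?e x) + c $ i * ?e x"],
      intro conjI allI)
    show "(\<lambda>x. complex_of_real (- 2 * k) * (complex_of_real (x $ i) * ?e x) + c $ i * ?e x) \<in> gaussian_fun" for i
      using e by (intro gaussian_fun.add gaussian_fun.scale gaussian_fun.coord)
    fix x
    have inner: "(x :: real ^ 'd) \<bullet> h = (\<Sum>i\<in>UNIV. x $ i * h $ i)" for h by (simp add: inner_vec_def)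
    have "(?e has_derivative (\<lambda>h. (- complex_of_real (k * (2 * (x \<bullet> h))) + (\<Sum>i\<in>UNIV. c $ i * complex_of_real (h $ i))) * ?e x)) (at x)"
    proof -
      let ?p = "\<lambda>x. - complex_of_real (k * (x \<bullet> x)) + (\<Sum>i\<in>UNIV. c $ i * complex_of_real (x $ i))"
      have "(?p has_derivative (\<lambda>h. - complex_of_real (k * (2 * (x \<bullet> h))) + (\<Sum>i\<in>UNIV. c $ i * complex_of_real (h $ i)))) (at x)"
        by (auto intro!: derivative_eq_intros bounded_linear.has_derivative[OF bounded_linear_vec_nth]
          simp: inner_commute)
      from diff_chain_at[OF this DERIV_exp[unfolded has_field_derivative_def]]
      show ?thesis by (simp add: o_def mult.commute)
    qed
    moreover have "(- complex_of_real (k * (2 * (x \<bullet> h))) + (\<Sum>i\<in>UNIV. c $ i * complex_of_real (h $ i))) * ?e x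
       = (\<Sum>i\<in>UNIV. complex_of_real (h $ i) * (complex_of_real (- 2 * k) * (complex_of_real (x $ i) * ?e x) + c $ i * ?e x))" for h
    proof -
      have "- complex_of_real (k * (2 * (x \<bullet> h))) + (\<Sum>i\<in>UNIV. c $ i * complex_of_real (h $ i)) =
          (\<Sum>i\<in>UNIV. complex_of_real (h $ i) * (complex_of_real (- 2 * k) * complex_of_real (x $ i) + c $ i))"
        unfolding inner by (simp add: sum_distrib_left sum.distrib sum_negf distrib_left right_diff_distrib sum_subtractf mult_ac)
      then show ?thesis
        by (simp only: sum_distrib_right distrib_right mult.assoc)
    qed
    ultimately show "(?e has_derivative (\<lambda>h. \<Sum>i\<in>UNIV. complex_of_real (h $ i) *
        (complex_of_real (- 2 * k) * (complex_of_real (x $ i) * ?e x) + c $ i * ?e x))) (at x)"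
      by simp
  qed
next
  case (coord \<phi> i)
  then obtain D where D: "\<And>k. D k \<in> gaussian_fun"
    "\<And>x. (\<phi> has_derivative (\<lambda>h. \<Sum>k\<in>UNIV. complex_of_real (h $ k) * D k x)) (at x)" by blast
  show ?case
  proof (rule exI[of _ "\<lambda>k x. complex_of_real (x $ i) * D k x + of_bool (k = i) * \<phi> x"], intro conjI allI)
    show "(\<lambda>x. complex_of_real (x $ i) * D k x + of_bool (k = i) * \<phi> x) \<in> gaussian_fun" for k
      using D coord.hyps by (intro gaussian_fun.add gaussian_fun.scale gaussian_fun.coord)
    fix x
    have "((\<lambda>x. complex_of_real (x $ i) * \<phi> x) has_derivative
      (\<lambda>h. complex_of_real (x $ i) * (\<Sum>k\<in>UNIV. complex_of_real (h $ k) * D k x) + complex_of_real (h $ i) * \<phi> x)) (at x)"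
      by (intro has_derivative_mult has_derivative_of_real D bounded_linear.has_derivative[OF bounded_linear_vec_nth] has_derivative_ident)
    moreover have "(\<Sum>k\<in>UNIV. complex_of_real (h $ k) * (complex_of_real (x $ i) * D k x + of_bool (k = i) * \<phi> x))
      = complex_of_real (x $ i) * (\<Sum>k\<in>UNIV. complex_of_real (h $ k) * D k x) + complex_of_real (h $ i) * \<phi> x" for h
      by (simp add: distrib_left sum.distrib sum_distrib_left mult_ac of_bool_def if_distrib[of "\<lambda>t. t * _"]
          if_distrib[of "\<lambda>t. _ * t"] cong: if_cong)
    ultimately show "((\<lambda>x. complex_of_real (x $ i) * \<phi> x) has_derivative
      (\<lambda>h. \<Sum>k\<in>UNIV. complex_of_real (h $ k) * (complex_of_real (x $ i) * D k x + of_bool (k = i) * \<phi> x))) (at x)"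
      by simp
  qed
next
  case (scale \<phi> a)
  then obtain D where D: "\<And>k. D k \<in> gaussian_fun"
    "\<And>x. (\<phi> has_derivative (\<lambda>h. \<Sum>k\<in>UNIV. complex_of_real (h $ k) * D k x)) (at x)" by blast
  show ?case
  proof (rule exI[of _ "\<lambda>k x. a * D k x"], intro conjI allI)
    show "(\<lambda>x. a * D k x) \<in> gaussian_fun" for k using D by (intro gaussian_fun.scale)
    show "((\<lambda>x. a * \<phi> x) has_derivative (\<lambda>h. \<Sum>k\<in>UNIV. complex_of_real (h $ k) * (a * D k x))) (at x)" for x
      using has_derivative_mult_right[OF D(2)[of x], of a] by (simp add: sum_distrib_left mult_ac)
  qed
next
  case (add \<phi> \<psi>)
  then obtain D E where D: "\<And>k. D k \<in> gaussian_fun"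
    "\<And>x. (\<phi> has_derivative (\<lambda>h. \<Sum>k\<in>UNIV. complex_of_real (h $ k) * D k x)) (at x)"
    and E: "\<And>k. E k \<in> gaussian_fun"
    "\<And>x. (\<psi> has_derivative (\<lambda>h. \<Sum>k\<in>UNIV. complex_of_real (h $ k) * E k x)) (at x)" by blast
  show ?case
  proof (rule exI[of _ "\<lambda>k x. D k x + E k x"], intro conjI allI)
    show "(\<lambda>x. D k x + E k x) \<in> gaussian_fun" for k using D E by (intro gaussian_fun.add)
    show "((\<lambda>x. \<phi> x + \<psi> x) has_derivative (\<lambda>h. \<Sum>k\<in>UNIV. complex_of_real (h $ k) * (D k x + E k x))) (at x)" for x
      using has_derivative_add[OF D(2)[of x] E(2)[of x]] by (simp add: sum.distrib distrib_left)
  qed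
qed

lemma
  assumes "\<phi> \<in> gaussian_fun"
  shows gaussian_fun_partial_deriv: "partial_deriv k \<phi> \<in> gaussian_fun"
    and gaussian_fun_has_derivative:
      "(\<phi> has_derivative (\<lambda>h. \<Sum>k\<in>UNIV. complex_of_real (h $ k) * partial_deriv k \<phi> x)) (at x)"
proof -
  obtain D where D: "\<And>k. D k \<in> gaussian_fun"
    "\<And>x. (\<phi> has_derivative (\<lambda>h. \<Sum>k\<in>UNIV. complex_of_real (h $ k) * D k x)) (at x)"
    using gaussian_fun_has_gradient[OF assms] by blast
  have eq: "partial_deriv k \<phi> = D k" for k
  proof
    fix x
    have "partial_deriv k \<phi> x = (\<Sum>j\<in>UNIV. complex_of_real (axis k 1 $ j) * D j x)"
      using frechet_derivative_at[OF D(2)[of x]] by (simp add: partial_deriv_def fun_eq_iff)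
    also have "\<dots> = (\<Sum>j\<in>UNIV. if j = k then D j x else 0)"
      by (intro sum.cong) (auto simp: axis_def)
    finally show "partial_deriv k \<phi> x = D k x" by simp
  qed
  show "partial_deriv k \<phi> \<in> gaussian_fun" unfolding eq by (rule D)
  show "(\<phi> has_derivative (\<lambda>h. \<Sum>k\<in>UNIV. complex_of_real (h $ k) * partial_deriv k \<phi> x)) (at x)"
    unfolding eq by (rule D)
qed

lemma gaussian_fun_continuous: "\<phi> \<in> gaussian_fun \<Longrightarrow> continuous_on A \<phi>"
  by (intro continuous_at_imp_continuous_on ballI)
     (auto intro: has_derivative_continuous gaussian_fun_has_derivative)

section \<open>Decay and stability of the Gaussian class\<close>

text \<open>The rate \<alpha> must be arbitrary in the induction: multiplication by a coordinate
  costs one unit of it.\<close>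

lemma gaussian_fun_bound:
  fixes \<phi> :: "real ^ 'd::finite \<Rightarrow> complex"
  assumes "\<phi> \<in> gaussian_fun"
  shows "\<exists>C\<ge>0. \<forall>x. cmod (\<phi> x) \<le> C * exp (- (\<alpha> * norm x))"
  using assms
proof (induction arbitrary: \<alpha>)
  case (base k c)
  \<comment> \<open>The exponent plus \<alpha> |x| is at most b |x| - k |x|^2, and b^2 / (4 k) is
    the maximum of b r - k r^2.\<close>
  define b where "b = (\<Sum>i\<in>UNIV. cmod (c $ i)) + \<alpha>"
  show ?case
  proof (rule exI[of _ "exp (b\<^sup>2 / (4 * k))"], intro conjI allI)
    fix x :: "real ^ 'd"
    have "Re (\<Sum>i\<in>UNIV. c $ i * complex_of_real (x $ i)) \<le> (\<Sum>i\<in>UNIV. cmod (c $ i) * norm x)"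
      unfolding Re_sum
    proof (rule sum_mono)
      fix i
      have "Re (c $ i * complex_of_real (x $ i)) \<le> cmod (c $ i) * \<bar>x $ i\<bar>"
        using complex_Re_le_cmod[of "c $ i * complex_of_real (x $ i)"] by (simp add: norm_mult)
      also have "\<dots> \<le> cmod (c $ i) * norm x"
        by (intro mult_left_mono component_le_norm_cart norm_ge_zero)
      finally show "Re (c $ i * complex_of_real (x $ i)) \<le> cmod (c $ i) * norm x" .
    qed
    moreover have "- (k * (norm x)\<^sup>2) + b * norm x \<le> b\<^sup>2 / (4 * k)"
    proof -
      have "0 \<le> (2 * k * norm x - b)\<^sup>2 / (4 * k)" using base by simp
      also have "\<dots> = k * (norm x)\<^sup>2 - b * norm x + b\<^sup>2 / (4 * k)"
        using base by (simp add: power2_eq_square field_simps)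
      finally show ?thesis by simp
    qed
    ultimately have "- (k * (x \<bullet> x)) + Re (\<Sum>i\<in>UNIV. c $ i * complex_of_real (x $ i)) \<le> b\<^sup>2 / (4 * k) + - (\<alpha> * norm x)"
      by (simp add: b_def power2_norm_eq_inner distrib_right sum_distrib_right)
    then show "cmod (exp (- complex_of_real (k * (x \<bullet> x)) + (\<Sum>i\<in>UNIV. c $ i * complex_of_real (x $ i))))
        \<le> exp (b\<^sup>2 / (4 * k)) * exp (- (\<alpha> * norm x))"
      unfolding exp_add[symmetric] norm_exp_eq_Re by simp
  qed simp
next
  case (coord \<phi> i)
  obtain C where C: "0 \<le> C" "\<And>x. cmod (\<phi> x) \<le> C * exp (- ((\<alpha> + 1) * norm x))" using coord.IH by blast
  show ?case
  proof (rule exI[of _ C], intro conjI allI)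
    fix x
    have "\<bar>x $ i\<bar> \<le> exp (norm x)"
      using component_le_norm_cart[of x i] exp_ge_add_one_self[of "norm x"] by linarith
    then have "\<bar>x $ i\<bar> * cmod (\<phi> x) \<le> exp (norm x) * (C * exp (- ((\<alpha> + 1) * norm x)))"
      by (intro mult_mono C) auto
    also have "\<dots> = C * exp (- (\<alpha> * norm x))"
      by (simp add: exp_add[symmetric] algebra_simps)
    finally show "cmod (complex_of_real (x $ i) * \<phi> x) \<le> C * exp (- (\<alpha> * norm x))"
      by (simp add: norm_mult)
  qed (rule C)
next
  case (scale \<phi> a)
  obtain C where C: "0 \<le> C" "\<And>x. cmod (\<phi> x) \<le> C * exp (- (\<alpha> * norm x))" using scale.IH by blast
  show ?case
    by (rule exI[of _ "cmod a * C"]) (auto simp: norm_mult mult.assoc intro!: mult_left_mono C mult_nonneg_nonneg)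
next
  case (add \<phi> \<psi>)
  obtain C where C: "0 \<le> C" "\<And>x. cmod (\<phi> x) \<le> C * exp (- (\<alpha> * norm x))" using add.IH(1) by blast
  obtain D where D: "0 \<le> D" "\<And>x. cmod (\<psi> x) \<le> D * exp (- (\<alpha> * norm x))" using add.IH(2) by blast
  show ?case
    by (rule exI[of _ "C + D"]) (auto simp: distrib_right intro!: norm_triangle_le add_mono add_nonneg_nonneg C D)
qed

text \<open>Decay at rate N absorbs the weight |x|^N, since r \<le> exp r.\<close>

lemma gaussian_fun_schwartz:
  assumes "\<phi> \<in> gaussian_fun"
  shows "\<phi> \<in> schwartz"
proof -
  have *: "partial_derivs ks \<phi> \<in> gaussian_fun" for ks
    by (induction ks) (simp_all add: assms gaussian_fun_partial_deriv)
  show ?thesis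
    unfolding schwartz_def
  proof (intro CollectI conjI allI)
    show "partial_derivs ks \<phi> differentiable at x" for ks x
      using gaussian_fun_has_derivative[OF *] by (auto simp: differentiable_def)
    fix ks and N :: nat
    obtain C where C: "0 \<le> C" "\<And>x. cmod (partial_derivs ks \<phi> x) \<le> C * exp (- (real N * norm x))"
      using gaussian_fun_bound[OF *] by blast
    show "\<exists>C. \<forall>x. norm x ^ N * cmod (partial_derivs ks \<phi> x) \<le> C"
    proof (intro exI[of _ C] allI)
      fix x :: "real ^ 'a"
      have "norm x \<le> exp (norm x)" using exp_ge_add_one_self[of "norm x"] by linarith
      then have "norm x ^ N \<le> exp (real N * norm x)"
        using power_mono[of "norm x" "exp (norm x)" N] by (simp add: exp_of_nat_mult)
      then have "norm x ^ N * cmod (partial_derivs ks \<phi> x) \<le> exp (real N * norm x) * (C * exp (- (real N * norm x)))"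
        by (intro mult_mono C) auto
      also have "\<dots> = C" by (simp add: exp_minus)
      finally show "norm x ^ N * cmod (partial_derivs ks \<phi> x) \<le> C" .
    qed
  qed
qed

lemma gaussian_fun_cnj: "\<phi> \<in> gaussian_fun \<Longrightarrow> (\<lambda>x. cnj (\<phi> x)) \<in> gaussian_fun"
proof (induction rule: gaussian_fun.induct)
  case (base k c)
  show ?case using gaussian_fun.base[OF base, of "\<chi> i. cnj (c $ i)"] by (simp add: exp_cnj)
qed (simp_all add: gaussian_fun.intros)

text \<open>The factor raises k by 1. This closure is what allows polynomials in exp (- |x|^2) as
  multipliers in the density argument.\<close>

lemma gaussian_fun_times_gaussian:
  "\<phi> \<in> gaussian_fun \<Longrightarrow> (\<lambda>x. complex_of_real (exp (- (x \<bullet> x))) * \<phi> x) \<in> gaussian_fun"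
proof (induction rule: gaussian_fun.induct)
  case (base k c)
  have "complex_of_real (exp (- (x \<bullet> x))) * exp (- complex_of_real (k * (x \<bullet> x)) + (\<Sum>i\<in>UNIV. c $ i * complex_of_real (x $ i)))
    = exp (- complex_of_real ((k + 1) * (x \<bullet> x)) + (\<Sum>i\<in>UNIV. c $ i * complex_of_real (x $ i)))" for x
    unfolding exp_of_real[symmetric] exp_add[symmetric] by (rule arg_cong[where f = exp]) (simp add: algebra_simps)
  then show ?case using gaussian_fun.base[of "k + 1" c] base by simp
next
  case (coord \<phi> i)
  then show ?case using gaussian_fun.coord[OF coord.IH, of i] by (simp add: mult.left_commute)
next
  case (scale \<phi> a)
  then show ?case using gaussian_fun.scale[OF scale.IH, of a] by (simp add: mult.left_commute)
next
  case (add \<phi> \<psi>)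
  then show ?case using gaussian_fun.add[OF add.IH] by (simp add: distrib_left)
qed

text \<open>Translation by m adds -2 k m to the linear coefficient and modulation adds 2 pi i n;
  complex coefficients in the exponent make room for both. All that does not depend on x is
  collected in the scalar \<open>a\<close>.\<close>

lemma gaussian_fun_weyl: "\<phi> \<in> gaussian_fun \<Longrightarrow> weyl z \<phi> \<in> gaussian_fun"
proof (induction rule: gaussian_fun.induct)
  case (base k c)
  obtain m n where z: "z = (m, n)" by (cases z)
  define c' where "c' = (\<chi> i. c $ i - complex_of_real (2 * k * m $ i) + \<i> * complex_of_real (2 * pi * n $ i))"
  define a where "a = cis (pi * (m \<bullet> n)) * exp (- complex_of_real (k * (m \<bullet> m)) + (\<Sum>i\<in>UNIV. c $ i * complex_of_real (m $ i)))"
  have "weyl z (\<lambda>x. exp (- complex_of_real (k * (x \<bullet> x)) + (\<Sum>i\<in>UNIV. c $ i * complex_of_real (x $ i)))) =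
      (\<lambda>x. a * exp (- complex_of_real (k * (x \<bullet> x)) + (\<Sum>i\<in>UNIV. c' $ i * complex_of_real (x $ i))))"
  proof
    fix x
    have c': "(\<Sum>i\<in>UNIV. c' $ i * complex_of_real (x $ i)) =
        (\<Sum>i\<in>UNIV. c $ i * complex_of_real (x $ i)) - complex_of_real (2 * k * (m \<bullet> x)) + \<i> * complex_of_real (2 * pi * (n \<bullet> x))"
      by (simp add: c'_def inner_vec_def sum_distrib_left sum_subtractf sum.distrib distrib_right left_diff_distrib mult.assoc)
    have split: "(\<Sum>i\<in>UNIV. c $ i * complex_of_real ((x + m) $ i)) =
        (\<Sum>i\<in>UNIV. c $ i * complex_of_real (x $ i)) + (\<Sum>i\<in>UNIV. c $ i * complex_of_real (m $ i))"
      by (simp add: distrib_left sum.distrib)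
    have sq: "(x + m) \<bullet> (x + m) = x \<bullet> x + 2 * (m \<bullet> x) + m \<bullet> m"
      by (simp add: inner_add_left inner_add_right inner_commute)
    show "weyl z (\<lambda>x. exp (- complex_of_real (k * (x \<bullet> x)) + (\<Sum>i\<in>UNIV. c $ i * complex_of_real (x $ i)))) x =
      a * exp (- complex_of_real (k * (x \<bullet> x)) + (\<Sum>i\<in>UNIV. c' $ i * complex_of_real (x $ i)))"
      unfolding weyl_def a_def z fst_conv snd_conv c' split sq cis_conv_exp exp_add[symmetric]
      by (rule arg_cong[where f = exp]) (simp add: algebra_simps)
  qed
  then show ?case using gaussian_fun.scale[OF gaussian_fun.base[OF base, of c'], of a] by simp
next
  case (coord \<phi> i)
  have "weyl z (\<lambda>x. complex_of_real (x $ i) * \<phi> x) = (\<lambda>x. complex_of_real (x $ i) * weyl z \<phi> x + complex_of_real (fst z $ i) * weyl z \<phi> x)"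
    by (simp add: fun_eq_iff weyl_def algebra_simps)
  then show ?case using coord.IH by (simp add: gaussian_fun.add gaussian_fun.coord gaussian_fun.scale)
next
  case (scale \<phi> a)
  have "weyl z (\<lambda>x. a * \<phi> x) = (\<lambda>x. a * weyl z \<phi> x)" by (simp add: fun_eq_iff weyl_scale)
  then show ?case using scale.IH by (simp add: gaussian_fun.scale)
next
  case (add \<phi> \<psi>)
  have "weyl z (\<lambda>x. \<phi> x + \<psi> x) = (\<lambda>x. weyl z \<phi> x + weyl z \<psi> x)" by (simp add: fun_eq_iff weyl_add)
  then show ?case using add.IH by (simp add: gaussian_fun.add)
qed

section \<open>Square integrability from exponential decay\<close>

lemma nn_integral_exp_abs_finite:
  fixes a :: real
  assumes "0 < a"
  shows "(\<integral>\<^sup>+t. ennreal (exp (- (a * \<bar>t\<bar>))) \<partial>lborel) < \<infinity>"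
proof -
  let ?h = "\<lambda>t::real. ennreal (exp (- (a * t))) * indicator {0..} t"
  have "((\<lambda>t. - exp (- (a * t)) / a) \<longlongrightarrow> - 0 / a) at_top"
    using assms by (intro tendsto_intros filterlim_compose[OF exp_at_bot]
        filterlim_compose[OF filterlim_uminus_at_bot_at_top] filterlim_tendsto_pos_mult_at_top[OF tendsto_const]
        filterlim_ident) auto
  then have "integral\<^sup>N lborel ?h = ennreal (- 0 / a - - exp (- (a * 0)) / a)"
    using assms by (intro nn_integral_FTC_atLeast[where F = "\<lambda>t. - exp (- (a * t)) / a"])
      (auto intro!: derivative_eq_intros)
  then have fin: "integral\<^sup>N lborel ?h < \<infinity>" by simp
  have refl: "(\<integral>\<^sup>+t. ?h (- t) \<partial>lborel) = integral\<^sup>N lborel ?h"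
    using nn_integral_real_affine[of ?h "-1" 0] by simp
  have "(\<integral>\<^sup>+t. ennreal (exp (- (a * \<bar>t\<bar>))) \<partial>lborel) \<le> (\<integral>\<^sup>+t. ?h t + ?h (- t) \<partial>lborel)"
    by (intro nn_integral_mono) (auto simp: indicator_def)
  also have "\<dots> = integral\<^sup>N lborel ?h + (\<integral>\<^sup>+t. ?h (- t) \<partial>lborel)"
    by (rule nn_integral_add) auto
  also have "\<dots> < \<infinity>" using fin refl by simp
  finally show ?thesis .
qed

text \<open>The sum of the |x_i| is at most the dimension times |x|, so with b = a / dimension the
  function is dominated by a product of one-dimensional exponentials, and the integral of the
  product factorises.\<close>

lemma integrable_exp_norm:
  fixes a :: real
  assumes "0 < a"
  shows "integrable lborel (\<lambda>x::'a::euclidean_space. exp (- (a * norm x)))"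
proof (rule integrableI_bounded)
  define b where "b = a / DIM('a)"
  have b: "0 < b" using assms by (simp add: b_def)
  have "integral\<^sup>N lborel (\<lambda>x::'a. ennreal (norm (exp (- (a * norm x)))))
    \<le> integral\<^sup>N lborel (\<lambda>x::'a. \<Prod>i\<in>Basis. ennreal (exp (- (b * \<bar>x \<bullet> i\<bar>))))"
  proof (rule nn_integral_mono)
    fix x :: 'a
    have "(\<Sum>i\<in>Basis. \<bar>x \<bullet> i\<bar>) \<le> (\<Sum>i\<in>(Basis::'a set). norm x)"
      by (intro sum_mono Basis_le_norm)
    then have "b * (\<Sum>i\<in>Basis. \<bar>x \<bullet> i\<bar>) \<le> b * (DIM('a) * norm x)"
      using b by (intro mult_left_mono) auto
    then have "exp (- (a * norm x)) \<le> exp (\<Sum>i\<in>Basis. - (b * \<bar>x \<bullet> i\<bar>))"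
      by (simp add: b_def sum_negf sum_distrib_left)
    also have "\<dots> = (\<Prod>i\<in>Basis. exp (- (b * \<bar>x \<bullet> i\<bar>)))" by (rule exp_sum) simp
    finally show "ennreal (norm (exp (- (a * norm x)))) \<le> (\<Prod>i\<in>Basis. ennreal (exp (- (b * \<bar>x \<bullet> i\<bar>))))"
      by (simp add: prod_ennreal ennreal_leI)
  qed
  also have "\<dots> = (\<Prod>i\<in>(Basis::'a set). (\<integral>\<^sup>+t. ennreal (exp (- (b * \<bar>t\<bar>))) \<partial>lborel))"
    by (rule nn_integral_lborel_prod) auto
  also have "\<dots> < \<infinity>" using nn_integral_exp_abs_finite[OF b] by (simp add: less_top power_less_top_ennreal)
  finally show "integral\<^sup>N lborel (\<lambda>x::'a. ennreal (norm (exp (- (a * norm x))))) < \<infinity>" .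
qed simp

lemma exp_norm_L2: "(\<lambda>x::real ^ 'd::finite. complex_of_real (exp (- norm x))) \<in> L2"
proof (rule L2I)
  have "(\<lambda>x::real ^ 'd. (cmod (complex_of_real (exp (- norm x))))\<^sup>2) = (\<lambda>x. exp (- (2 * norm x)))"
    by (simp add: fun_eq_iff exp_double[symmetric])
  then show "integrable lborel (\<lambda>x::real ^ 'd. (cmod (complex_of_real (exp (- norm x))))\<^sup>2)"
    using integrable_exp_norm[of 2, where 'a = "real ^ 'd"] by simp
qed simp

lemma gaussian_fun_L2:
  assumes "\<phi> \<in> gaussian_fun"
  shows "\<phi> \<in> L2"
proof -
  obtain C where C: "0 \<le> C" "\<And>x. cmod (\<phi> x) \<le> C * exp (- (1 * norm x))"
    using gaussian_fun_bound[OF assms] by blast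
  show ?thesis
  proof (rule L2_bounded_by)
    show "\<phi> \<in> borel_measurable borel"
      using gaussian_fun_continuous[OF assms] by (rule borel_measurable_continuous_onI)
    show "integrable lborel (\<lambda>x::real ^ 'a. C\<^sup>2 * (cmod (complex_of_real (exp (- norm x))))\<^sup>2)"
      by (intro integrable_mult_right L2_integrable exp_norm_L2)
    show "(cmod (\<phi> x))\<^sup>2 \<le> C\<^sup>2 * (cmod (complex_of_real (exp (- norm x))))\<^sup>2" for x
      using C(2)[of x] by (simp add: power_mult_distrib[symmetric] power_mono)
  qed
qed

section \<open>The generator on test functions\<close>

text \<open>The derivative of \<open>weyl (s z) \<psi>\<close> at s = 0; the normalising phase is
  quadratic in s and does not contribute there.\<close>

definition weyl_deriv :: "'d::finite phase_space \<Rightarrow> (real ^ 'd \<Rightarrow> complex) \<Rightarrow> real ^ 'd \<Rightarrow> complex" where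
  "weyl_deriv z \<psi> x = 2 * complex_of_real pi * \<i> * (complex_of_real (snd z \<bullet> x) * \<psi> x)
    + (\<Sum>k\<in>UNIV. complex_of_real (fst z $ k) * partial_deriv k \<psi> x)"

lemma gaussian_fun_weyl_deriv:
  assumes "\<psi> \<in> gaussian_fun"
  shows "weyl_deriv z \<psi> \<in> gaussian_fun"
  unfolding weyl_deriv_def [abs_def] using assms
  by (intro gaussian_fun.add gaussian_fun.scale gaussian_fun_inner gaussian_fun_sum gaussian_fun_partial_deriv)

text \<open>At s \<noteq> 0 the quadratic phase contributes 2 pi s (m \<bullet> n), which is exactly
  the change of n \<bullet> x in \<open>weyl_deriv\<close> when its argument is shifted by s
  m.\<close>

lemma weyl_has_vector_derivative:
  assumes "\<psi> \<in> gaussian_fun"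
  shows "((\<lambda>s. weyl (s *\<^sub>R z) \<psi> x) has_vector_derivative weyl (s *\<^sub>R z) (weyl_deriv z \<psi>) x) (at s)"
proof -
  obtain m n where z: "z = (m, n)" by (cases z)
  let ?\<theta> = "\<lambda>s. 2 * pi * s * (n \<bullet> x) + pi * s\<^sup>2 * (m \<bullet> n)"
  have "((\<lambda>s. x + s *\<^sub>R m) has_derivative (\<lambda>h. h *\<^sub>R m)) (at s)"
    by (auto intro!: derivative_eq_intros)
  from diff_chain_at[OF this gaussian_fun_has_derivative[OF assms]]
  have "((\<lambda>s. \<psi> (x + s *\<^sub>R m)) has_derivative (\<lambda>h. h *\<^sub>R (\<Sum>k\<in>UNIV. complex_of_real (m $ k) * partial_deriv k \<psi> (x + s *\<^sub>R m)))) (at s)"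
    by (simp add: o_def scaleR_sum_right scaleR_conv_of_real[where 'a = complex] sum_distrib_left mult.assoc)
  then have 1: "((\<lambda>s. \<psi> (x + s *\<^sub>R m)) has_vector_derivative (\<Sum>k\<in>UNIV. complex_of_real (m $ k) * partial_deriv k \<psi> (x + s *\<^sub>R m))) (at s)"
    by (simp add: has_vector_derivative_def)
  have "(?\<theta> has_vector_derivative (2 * pi * (n \<bullet> x) + pi * (2 * s) * (m \<bullet> n))) (at s)"
    by (auto intro!: derivative_eq_intros simp: has_real_derivative_iff_has_vector_derivative[symmetric])
  moreover have "(cis has_vector_derivative \<i> * cis t) (at t)" for t
  proof -
    have "((\<lambda>w. exp (\<i> * w)) has_field_derivative \<i> * exp (\<i> * complex_of_real t)) (at (complex_of_real t))"
      by (auto intro!: derivative_eq_intros simp: mult_ac)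
    from has_vector_derivative_real_field[OF this] show ?thesis
      by (simp add: cis_conv_exp [abs_def])
  qed
  ultimately have 2: "((\<lambda>s. cis (?\<theta> s)) has_vector_derivative
      (2 * pi * (n \<bullet> x) + pi * (2 * s) * (m \<bullet> n)) *\<^sub>R (\<i> * cis (?\<theta> s))) (at s)"
    using vector_diff_chain_at[of ?\<theta> _ s cis] by (simp add: o_def)
  have "(\<lambda>s. weyl (s *\<^sub>R z) f x) = (\<lambda>s. cis (?\<theta> s) * f (x + s *\<^sub>R m))" for f
    by (simp add: fun_eq_iff weyl_def z power2_eq_square mult_ac)
  note w = fun_cong[OF this]
  show ?thesis
    unfolding w
    by (rule has_vector_derivative_eq_rhs[OF has_vector_derivative_mult[OF 2 1]])
      (simp add: weyl_deriv_def z inner_add_right inner_commute[of n m] scaleR_conv_of_real[where 'a = complex]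
        distrib_left distrib_right mult_ac)
qed

lemma has_vector_derivative_quotient:
  fixes f :: "real \<Rightarrow> complex"
  assumes "(f has_vector_derivative v) (at a)"
  shows "((\<lambda>h. (f (a + h) - f a) / complex_of_real h) \<longlongrightarrow> v) (at 0)"
proof -
  have lim: "(\<lambda>h. norm (f (a + h) - f a - h *\<^sub>R v) / norm h) \<midarrow>0\<rightarrow> 0"
    using assms unfolding has_vector_derivative_def has_derivative_at by blast
  have "((\<lambda>h. (f (a + h) - f a) / complex_of_real h - v) \<longlongrightarrow> 0) (at 0)"
  proof (rule Lim_null_comparison[OF _ lim])
    show "\<forall>\<^sub>F h in at 0. norm ((f (a + h) - f a) / complex_of_real h - v)
        \<le> norm (f (a + h) - f a - h *\<^sub>R v) / norm h"
      unfolding eventually_at_filter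
    proof (intro always_eventually allI impI)
      fix h :: real assume "h \<noteq> 0"
      then have "(f (a + h) - f a) / complex_of_real h - v = (f (a + h) - f a - h *\<^sub>R v) / complex_of_real h"
        by (simp add: scaleR_conv_of_real field_simps)
      then show "norm ((f (a + h) - f a) / complex_of_real h - v)
        \<le> norm (f (a + h) - f a - h *\<^sub>R v) / norm h"
        by (simp add: norm_divide)
    qed
  qed
  then show ?thesis by (simp add: LIM_zero_iff)
qed

text \<open>Dominated convergence: the mean value inequality bounds the quotients by a multiple of
  exp (- |x|), uniformly in s, and \<open>g\<close> times this majorant is integrable because both
  are square integrable.\<close>

lemma weyl_difference_quotient_tendsto:
  assumes g: "g \<in> L2" and \<psi>: "\<psi> \<in> gaussian_fun"
  shows "((\<lambda>s. L2_inner g (\<lambda>x. (weyl (s *\<^sub>R z) \<psi> x - \<psi> x) / complex_of_real s))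
    \<longlongrightarrow> L2_inner g (weyl_deriv z \<psi>)) (at 0)"
proof -
  let ?q = "\<lambda>s x. (weyl (s *\<^sub>R z) \<psi> x - \<psi> x) / complex_of_real s"
  obtain C where C: "0 \<le> C" "\<And>x. cmod (weyl_deriv z \<psi> x) \<le> C * exp (- (1 * norm x))"
    using gaussian_fun_bound[OF gaussian_fun_weyl_deriv[OF \<psi>]] by blast
  \<comment> \<open>For |s| \<le> 1 the argument moves by at most |fst z|, which costs the factor
    exp |fst z| in the decay estimate.\<close>
  define K where "K = C * exp (norm (fst z))"
  have bd: "cmod (weyl (s *\<^sub>R z) (weyl_deriv z \<psi>) x) \<le> K * exp (- norm x)" if "\<bar>s\<bar> \<le> 1" for s x
  proof -
    have "norm x \<le> norm (x + s *\<^sub>R fst z) + norm (s *\<^sub>R fst z)"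
      by (metis add_diff_cancel_right' norm_triangle_ineq4)
    moreover have "norm (s *\<^sub>R fst z) \<le> norm (fst z)"
      using that by (simp add: mult_left_le_one_le)
    ultimately have *: "- norm (x + s *\<^sub>R fst z) \<le> norm (fst z) + - norm x" by linarith
    have "cmod (weyl (s *\<^sub>R z) (weyl_deriv z \<psi>) x) = cmod (weyl_deriv z \<psi> (x + s *\<^sub>R fst z))"
      by (simp add: weyl_def norm_mult)
    also have "\<dots> \<le> C * exp (- norm (x + s *\<^sub>R fst z))" using C(2)[of "x + s *\<^sub>R fst z"] by simp
    also have "\<dots> \<le> C * exp (norm (fst z) + - norm x)" using * C(1) by (intro mult_left_mono) auto
    finally show ?thesis by (simp only: K_def exp_add mult.assoc)
  qed
  have quot: "cmod (?q s x) \<le> K * exp (- norm x)" if "\<bar>s\<bar> \<le> 1" "s \<noteq> 0" for s x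
  proof -
    have "norm (weyl (s *\<^sub>R z) \<psi> x - weyl (0 *\<^sub>R z) \<psi> x) \<le> (K * exp (- norm x)) * norm (s - 0)"
    proof (rule differentiable_bound[where S = "{-1..1}"
          and f' = "\<lambda>s h. h *\<^sub>R weyl (s *\<^sub>R z) (weyl_deriv z \<psi>) x"])
      fix r :: real assume r: "r \<in> {-1..1}"
      show "((\<lambda>s. weyl (s *\<^sub>R z) \<psi> x) has_derivative (\<lambda>h. h *\<^sub>R weyl (r *\<^sub>R z) (weyl_deriv z \<psi>) x)) (at r within {-1..1})"
        using weyl_has_vector_derivative[OF \<psi>] unfolding has_vector_derivative_def by (rule has_derivative_at_withinI)
      show "onorm (\<lambda>h. h *\<^sub>R weyl (r *\<^sub>R z) (weyl_deriv z \<psi>) x) \<le> K * exp (- norm x)"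
        using bd[of r x] r by (intro onorm_le) (auto simp: mult.commute intro!: mult_left_mono)
    qed (use that in auto)
    then show ?thesis using that by (simp add: weyl_zero norm_divide field_simps)
  qed
  have gm [measurable]: "g \<in> borel_measurable borel" by (rule L2_measurable[OF g])
  have qL2: "?q s \<in> L2" for s
    using \<psi> by (intro L2_divide L2_diff gaussian_fun_L2 gaussian_fun_weyl)
  have meas: "(\<lambda>x. g x * cnj (u x)) \<in> borel_measurable lborel" if "u \<in> L2" for u
    using borel_measurable_integrable[OF L2_integrable_inner[OF g that]] by simp
  \<comment> \<open>Restricting to [-1, 1] makes the majorant valid for every member of a test
    sequence; since 0 is an interior point, the limit is unaffected.\<close>
  have "((\<lambda>s. L2_inner g (?q s)) \<longlongrightarrow> L2_inner g (weyl_deriv z \<psi>)) (at 0 within {-1..1})"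
    unfolding tendsto_at_iff_sequentially o_def
  proof (intro allI impI)
    fix X :: "nat \<Rightarrow> real" assume X: "\<forall>i. X i \<in> {-1..1} - {0}" "X \<longlonglongrightarrow> 0"
    show "(\<lambda>i. L2_inner g (?q (X i))) \<longlonglongrightarrow> L2_inner g (weyl_deriv z \<psi>)"
      unfolding L2_inner_def
    proof (rule integral_dominated_convergence)
      show "(\<lambda>x. g x * cnj (weyl_deriv z \<psi> x)) \<in> borel_measurable lborel"
        using \<psi> by (intro meas gaussian_fun_L2 gaussian_fun_weyl_deriv)
      show "(\<lambda>x. g x * cnj (?q (X i) x)) \<in> borel_measurable lborel" for i by (rule meas[OF qL2])
      have "integrable lborel (\<lambda>x. norm (g x * complex_of_real (exp (- norm x))))"
        by (intro integrable_norm L2_integrable_product g exp_norm_L2)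
      then show "integrable lborel (\<lambda>x. K * (cmod (g x) * exp (- norm x)))"
        by (simp add: norm_mult)
      show "AE x in lborel. norm (g x * cnj (?q (X i) x)) \<le> K * (cmod (g x) * exp (- norm x))" for i
      proof (rule AE_I2)
        fix x
        have "\<bar>X i\<bar> \<le> 1" "X i \<noteq> 0" using X(1)[rule_format, of i] by auto
        from quot[OF this, of x] have "cmod (g x) * cmod (?q (X i) x) \<le> cmod (g x) * (K * exp (- norm x))"
          by (rule mult_left_mono) simp
        then show "norm (g x * cnj (?q (X i) x)) \<le> K * (cmod (g x) * exp (- norm x))"
          by (simp only: norm_mult complex_mod_cnj mult_ac)
      qed
      show "AE x in lborel. (\<lambda>i. g x * cnj (?q (X i) x)) \<longlonglongrightarrow> g x * cnj (weyl_deriv z \<psi> x)"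
      proof (rule AE_I2, intro tendsto_intros)
        fix x
        have "((\<lambda>s. ?q s x) \<longlongrightarrow> weyl_deriv z \<psi> x) (at 0)"
          using has_vector_derivative_quotient[OF weyl_has_vector_derivative[OF \<psi>, of z x 0]]
          by (simp add: weyl_zero)
        moreover have "filterlim X (at 0) sequentially"
          using X by (auto simp: filterlim_at)
        ultimately show "(\<lambda>i. ?q (X i) x) \<longlonglongrightarrow> weyl_deriv z \<psi> x"
          by (rule filterlim_compose)
      qed
    qed
  qed
  then show ?thesis by (simp add: at_within_Icc_at)
qed

section \<open>Density of the test functions\<close>

lemma L2_norm_mono:
  assumes "h \<in> L2" "\<And>x. cmod (f x) \<le> cmod (h x)"
  shows "L2_norm f \<le> L2_norm h"
  unfolding L2_norm_def
proof (rule real_sqrt_le_mono)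
  show "(LINT x|lborel. (cmod (f x))\<^sup>2) \<le> (LINT x|lborel. (cmod (h x))\<^sup>2)"
    using L2_integrable[OF assms(1)] assms(2) by (intro integral_mono') (auto intro: power_mono)
qed

lemma L2_norm_dominated_convergence:
  fixes u :: "nat \<Rightarrow> real ^ 'd::finite \<Rightarrow> complex"
  assumes "\<And>n. u n \<in> borel_measurable borel" "f \<in> borel_measurable borel" "integrable lborel w"
    and "AE x in lborel. (\<lambda>n. u n x) \<longlonglongrightarrow> f x"
    and "\<And>n x. (cmod (u n x - f x))\<^sup>2 \<le> w x"
  shows "(\<lambda>n. L2_norm (\<lambda>x. u n x - f x)) \<longlonglongrightarrow> 0"
proof -
  note [measurable] = assms(1,2)
  have "(\<lambda>n. LINT x|lborel. (cmod (u n x - f x))\<^sup>2) \<longlonglongrightarrow> (LINT x::real ^ 'd|lborel. 0)"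
  proof (rule integral_dominated_convergence[OF _ _ assms(3)])
    show "AE x in lborel. (\<lambda>n. (cmod (u n x - f x))\<^sup>2) \<longlonglongrightarrow> 0"
      using assms(4)
    proof eventually_elim
      case (elim x)
      have "(\<lambda>n. (cmod (u n x - f x))\<^sup>2) \<longlonglongrightarrow> (cmod (f x - f x))\<^sup>2"
        by (intro tendsto_intros elim)
      then show ?case by simp
    qed
    show "AE x in lborel. norm ((cmod (u n x - f x))\<^sup>2) \<le> w x" for n
      using assms(5) by simp
  qed (simp_all, measurable)
  then have "(\<lambda>n. sqrt (LINT x|lborel. (cmod (u n x - f x))\<^sup>2)) \<longlonglongrightarrow> sqrt 0"
    by (intro tendsto_real_sqrt) simp
  then show ?thesis by (simp add: L2_norm_def)
qed

text \<open>The map \<open>x \<mapsto> (exp (- |x|\<^sup>2) x, exp (- |x|\<^sup>2))\<close> embeds the space into a compact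
  set, where the Weierstrass approximation theorem is available.\<close>

lemma gaussian_fun_times_polynomial:
  fixes P :: "(real ^ 'd::finite) \<times> real \<Rightarrow> real"
  assumes "real_polynomial_function P" "\<phi> \<in> gaussian_fun"
  shows "(\<lambda>x. complex_of_real (P (exp (- (x \<bullet> x)) *\<^sub>R x, exp (- (x \<bullet> x)))) * \<phi> x) \<in> gaussian_fun"
  using assms
proof (induction arbitrary: \<phi> rule: real_polynomial_function.induct)
  case (linear f)
  \<comment> \<open>A linear functional on the product is x \<mapsto> n \<bullet> x plus a multiple
    of the last coordinate. At an embedded point both parts share the factor exp (- |x|^2).\<close>
  define n where "n = (\<chi> i. f (axis i 1, 0))"
  have lin: "linear f" using linear.hyps by (rule bounded_linear.linear)
  have n: "f (x, 0) = n \<bullet> x" for x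
  proof -
    have "f (x, 0) = f (\<Sum>i\<in>UNIV. (x $ i) *\<^sub>R (axis i 1, 0))"
      using basis_expansion[of x] by (simp add: sum_prod scalar_mult_eq_scaleR)
    also have "\<dots> = (\<Sum>i\<in>UNIV. x $ i * f (axis i 1, 0))"
      unfolding linear_sum[OF lin] linear_scale[OF lin] by simp
    also have "\<dots> = n \<bullet> x"
      by (simp add: n_def inner_vec_def mult.commute)
    finally show ?thesis .
  qed
  have "f (exp (- (x \<bullet> x)) *\<^sub>R x, exp (- (x \<bullet> x))) = exp (- (x \<bullet> x)) * (n \<bullet> x + f (0, 1))" for x
  proof -
    have "(exp (- (x \<bullet> x)) *\<^sub>R x, exp (- (x \<bullet> x))) = exp (- (x \<bullet> x)) *\<^sub>R ((x, 0) + (0, 1))" by simp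
    then show ?thesis by (simp only: linear_scale[OF lin] linear_add[OF lin] n real_scaleR_def)
  qed
  then have "(\<lambda>x. complex_of_real (f (exp (- (x \<bullet> x)) *\<^sub>R x, exp (- (x \<bullet> x)))) * \<phi> x) =
      (\<lambda>x. complex_of_real (exp (- (x \<bullet> x))) * (complex_of_real (n \<bullet> x) * \<phi> x + complex_of_real (f (0, 1)) * \<phi> x))"
    by (simp add: fun_eq_iff algebra_simps)
  then show ?case
    using linear.prems
    by (simp add: gaussian_fun_times_gaussian gaussian_fun.add gaussian_fun_inner gaussian_fun.scale)
next
  case (const c)
  then show ?case by (simp add: gaussian_fun.scale)
next
  case (add f g)
  then show ?case using gaussian_fun.add[OF add.IH[OF add.prems]] by (simp add: distrib_right)
next
  case (mult f g)
  then show ?case using mult.IH(1)[OF mult.IH(2)[OF mult.prems]] by (simp add: mult.assoc)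
qed

text \<open>One Gaussian factor is kept in reserve: u = v G with v continuous, v is read as a
  function F of the embedded point, and a polynomial approximates F uniformly on a compact ball.
  Multiplying back by G turns the uniform error into an L2 error of at most \<delta> times the norm
  of G.\<close>

lemma gaussian_fun_dense_continuous:
  fixes u :: "real ^ 'd::finite \<Rightarrow> real"
  assumes cont: "continuous_on UNIV u" and supp: "\<And>x. R \<le> norm x \<Longrightarrow> u x = 0" and "0 < e"
  shows "\<exists>\<phi>\<in>gaussian_fun. L2_norm (\<lambda>x. complex_of_real (u x) - \<phi> x) < e"
proof -
  let ?E = "\<lambda>x::real ^ 'd. exp (- (x \<bullet> x))"
  \<comment> \<open>Half of the smallest value of exp (- |x|^2) on the ball of radius R, so the
    support of u lies where the last coordinate is at least 2 \<tau>.\<close>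
  define \<tau> where "\<tau> = exp (- R\<^sup>2) / 2"
  have \<tau>: "0 < \<tau>" by (simp add: \<tau>_def)
  define v where "v x = u x * exp (x \<bullet> x)" for x
  \<comment> \<open>The point x is recovered as y / t; the maximum with \<tau> prevents division by
    0. The last factor is 0 for t \<le> \<tau> and 1 for t \<ge> 2 \<tau>, so F is continuous
    everywhere and agrees with v on embedded points.\<close>
  define F where "F = (\<lambda>(y, t). v ((1 / max t \<tau>) *\<^sub>R y) * min 1 (max 0 ((t - \<tau>) / \<tau>)))"
  have v: "continuous_on UNIV v"
    unfolding v_def by (intro continuous_intros cont)
  have F: "continuous_on A F" for A
    unfolding F_def case_prod_unfold using \<tau>
    by (intro continuous_intros continuous_on_compose2[OF v]) auto
  have FE: "F (?E x *\<^sub>R x, ?E x) = v x" for x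
  proof (cases "norm x < R")
    case True
    then have "x \<bullet> x \<le> R\<^sup>2" by (simp add: power2_norm_eq_inner[symmetric] power_mono)
    then have "2 * \<tau> \<le> ?E x" by (simp add: \<tau>_def)
    moreover from this have "1 \<le> (?E x - \<tau>) / \<tau>" using \<tau> by (simp add: field_simps)
    ultimately show ?thesis using \<tau> by (simp add: F_def max_def min_def)
  next
    case False
    then have "v x = 0" using supp by (simp add: v_def)
    then show ?thesis using \<tau> by (cases "\<tau> \<le> ?E x") (auto simp: F_def max_def zero_le_divide_iff)
  qed
  define G where "G = (\<lambda>x::real ^ 'd. complex_of_real (?E x))"
  have G: "G \<in> gaussian_fun"
  proof -
    have "(\<lambda>x::real ^ 'd. exp (- complex_of_real (1 * (x \<bullet> x)) + (\<Sum>i\<in>UNIV. 0 $ i * complex_of_real (x $ i)))) \<in> gaussian_fun"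
      by (rule gaussian_fun.base) simp
    then show ?thesis by (simp add: G_def exp_of_real[symmetric])
  qed
  define \<delta> where "\<delta> = e / (L2_norm G + 1)"
  have \<delta>: "0 < \<delta>" using \<open>0 < e\<close> L2_norm_nonneg[of G] by (simp add: \<delta>_def)
  obtain P where P: "real_polynomial_function P" "\<And>y. y \<in> cball 0 2 \<Longrightarrow> \<bar>F y - P y\<bar> < \<delta>"
    using Stone_Weierstrass_real_polynomial_function[OF compact_cball F \<delta>] by metis
  have ball: "(?E x *\<^sub>R x, ?E x) \<in> cball 0 2" for x
  proof -
    have "norm x \<le> 1 + (norm x)\<^sup>2" using zero_le_power2[of "norm x - 1"] zero_le_power2[of "norm x"]
      unfolding power2_diff by (simp add: power2_eq_square) (use norm_ge_zero[of x] in linarith)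
    also have "\<dots> \<le> exp (x \<bullet> x)" using exp_ge_add_one_self[of "x \<bullet> x"] by (simp add: power2_norm_eq_inner)
    finally have "?E x * norm x \<le> ?E x * exp (x \<bullet> x)" by (intro mult_left_mono) auto
    then have "norm (?E x *\<^sub>R x) \<le> 1" by (simp add: exp_minus)
    moreover have "norm (?E x) \<le> 1" by simp
    ultimately have "norm (?E x *\<^sub>R x, ?E x) \<le> 1 + 1"
      by (intro order_trans[OF norm_Pair_le] add_mono)
    then show ?thesis by simp
  qed
  let ?\<phi> = "\<lambda>x. complex_of_real (P (?E x *\<^sub>R x, ?E x)) * G x"
  have "L2_norm (\<lambda>x. complex_of_real (u x) - ?\<phi> x) \<le> L2_norm (\<lambda>x. complex_of_real \<delta> * G x)"
  proof (rule L2_norm_mono)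
    show "(\<lambda>x. complex_of_real \<delta> * G x) \<in> L2" by (intro L2_scale gaussian_fun_L2 G)
    fix x
    have "complex_of_real (u x) - ?\<phi> x = complex_of_real ((F (?E x *\<^sub>R x, ?E x) - P (?E x *\<^sub>R x, ?E x)) * ?E x)"
      unfolding FE by (simp add: v_def G_def algebra_simps exp_minus)
    then show "cmod (complex_of_real (u x) - ?\<phi> x) \<le> cmod (complex_of_real \<delta> * G x)"
      using P(2)[OF ball, of x] \<delta> by (simp add: G_def norm_mult abs_mult mult_right_mono del: of_real_mult of_real_diff)
  qed
  also have "\<dots> = \<delta> * L2_norm G" using \<delta> by (simp add: L2_norm_scale)
  also have "\<dots> < e" using \<open>0 < e\<close> L2_norm_nonneg[of G] by (simp add: \<delta>_def field_simps)
  finally show ?thesis by (rule bexI[OF _ gaussian_fun_times_polynomial[OF P(1) G]])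
qed

text \<open>Three approximations, each at cost e / 3: cut f off in range and in space, replace the
  result by a continuous function of compact support, and approximate that one by test
  functions.\<close>

lemma gaussian_fun_dense_real:
  fixes f :: "real ^ 'd::finite \<Rightarrow> real"
  assumes f: "(\<lambda>x. complex_of_real (f x)) \<in> L2" and "0 < e"
  shows "\<exists>\<phi>\<in>gaussian_fun. L2_norm (\<lambda>x. complex_of_real (f x) - \<phi> x) < e"
proof -
  have fm [measurable]: "f \<in> borel_measurable borel"
    using measurable_compose[OF L2_measurable[OF f] borel_measurable_Re] by simp
  define T where "T N y = max (- real N) (min (real N) y)" for N :: nat and y
  define cut where "cut N x = max 0 (min 1 (real N + 1 - norm x))" for N :: nat and x :: "real ^ 'd"
  define F where "F N x = cut N x * T N (f x)" for N x
  have T: "\<bar>T N y\<bar> \<le> N" "continuous_on A (T N)" for N y A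
    unfolding T_def by (auto intro!: continuous_intros)
  have cut: "0 \<le> cut N x" "cut N x \<le> 1" for N x
    unfolding cut_def by auto
  have cut_cont: "continuous_on A (cut N)" for N A
    unfolding cut_def by (auto intro!: continuous_intros)
  have cut0: "cut N x = 0" if "real N + 1 \<le> norm x" for N x using that by (simp add: cut_def)
  have [measurable]: "cut N \<in> borel_measurable borel" "T N \<in> borel_measurable borel" for N
    by (intro borel_measurable_continuous_onI T cut_cont)+
  have Fm [measurable]: "F N \<in> borel_measurable borel" for N unfolding F_def [abs_def] by measurable
  have "(\<lambda>N. L2_norm (\<lambda>x. complex_of_real (F N x) - complex_of_real (f x))) \<longlonglongrightarrow> 0"
  proof (rule L2_norm_dominated_convergence[OF _ L2_measurable[OF f] L2_integrable[OF f]])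
    show "AE x in lborel. (\<lambda>N. complex_of_real (F N x)) \<longlonglongrightarrow> complex_of_real (f x)"
    proof (rule AE_I2, rule tendsto_eventually)
      fix x
      obtain M :: nat where M: "norm x + \<bar>f x\<bar> \<le> M" using real_arch_simple by blast
      show "\<forall>\<^sub>F N in sequentially. complex_of_real (F N x) = complex_of_real (f x)"
        using eventually_ge_at_top[of M]
      proof eventually_elim
        case (elim N)
        have "real M \<le> real N" using elim by simp
        then have "norm x \<le> N" "\<bar>f x\<bar> \<le> N" using M norm_ge_zero[of x] by linarith+
        then show ?case by (simp add: F_def cut_def T_def)
      qed
    qed
    fix N x
    have "\<bar>F N x - f x\<bar> \<le> \<bar>f x\<bar>"
    proof (cases "0 \<le> f x")
      case True
      then have "0 \<le> T N (f x)" "T N (f x) \<le> f x" by (auto simp: T_def)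
      then have "0 \<le> F N x" "F N x \<le> f x"
        unfolding F_def using cut[of N x] by (auto intro: order_trans[OF mult_left_le_one_le])
      then show ?thesis by simp
    next
      case False
      then have "T N (f x) \<le> 0" "f x \<le> T N (f x)" by (auto simp: T_def)
      then have "F N x \<le> 0" "f x \<le> F N x"
        unfolding F_def using cut[of N x] mult_left_le_one_le[of "- T N (f x)" "cut N x"]
        by (auto simp: mult_le_0_iff)
      then show ?thesis by simp
    qed
    then show "(cmod (complex_of_real (F N x) - complex_of_real (f x)))\<^sup>2 \<le> (cmod (complex_of_real (f x)))\<^sup>2"
      by (simp add: abs_le_square_iff flip: of_real_diff)
  qed simp
  then have "\<forall>\<^sub>F N in sequentially. L2_norm (\<lambda>x. complex_of_real (F N x) - complex_of_real (f x)) < e / 3"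
    using \<open>0 < e\<close> by (intro order_tendstoD(2)) auto
  then obtain N where N: "L2_norm (\<lambda>x. complex_of_real (F N x) - complex_of_real (f x)) < e / 3"
    by (auto simp: eventually_sequentially)
  \<comment> \<open>Two values truncated at N differ by at most 2 N, and the spatial cutoff vanishes
    outside this ball.\<close>
  let ?w = "\<lambda>x::real ^ 'd. (2 * real N)\<^sup>2 * indicator (cball 0 (real N + 1)) x"
  have w: "integrable lborel ?w"
    by (intro integrable_mult_right integrable_real_indicator emeasure_lborel_cball_finite) simp
  have cutw: "(cmod (complex_of_real (cut N x * a)))\<^sup>2 \<le> ?w x" if "\<bar>a\<bar> \<le> 2 * real N" for x a
  proof (cases "norm x \<le> real N + 1")
    case True
    have "\<bar>cut N x * a\<bar> \<le> 1 * (2 * real N)"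
      unfolding abs_mult using cut[of N x] that by (intro mult_mono) auto
    then have "\<bar>cut N x * a\<bar>\<^sup>2 \<le> (2 * real N)\<^sup>2" by (intro power_mono) auto
    then show ?thesis using True by (simp only: norm_of_real) (simp add: indicator_def)
  next
    case False
    then show ?thesis using cut0[of N x] by (simp add: indicator_def)
  qed
  \<comment> \<open>This notion of measurability supplies continuous functions converging to f off a
    negligible set. Truncating them like f gives a common integrable majorant.\<close>
  have "f measurable_on UNIV"
    by (rule lebesgue_measurable_imp_measurable_on_real) (auto intro: measurable_completion)
  then obtain Z g where Z: "negligible Z" and g: "\<And>n. continuous_on UNIV (g n)"
    and lim: "\<And>x. x \<notin> Z \<Longrightarrow> (\<lambda>n::nat. g n x) \<longlonglongrightarrow> f x"
    unfolding measurable_on_def by auto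
  define u where "u n x = cut N x * T N (g n x)" for n x
  have u: "continuous_on A (u n)" for A n
    unfolding u_def by (intro continuous_intros cut_cont continuous_on_compose2[OF T(2)[of UNIV] continuous_on_subset[OF g]]) auto
  have "(\<lambda>n. L2_norm (\<lambda>x. complex_of_real (u n x) - complex_of_real (F N x))) \<longlonglongrightarrow> 0"
  proof (rule L2_norm_dominated_convergence[OF _ _ w])
    show "(\<lambda>x. complex_of_real (u n x)) \<in> borel_measurable borel" for n
      by (intro borel_measurable_continuous_onI continuous_intros u)
    have "AE x in lebesgue. x \<notin> Z" using Z by (intro AE_not_in) (simp add: negligible_iff_null_sets)
    then have "AE x in lborel. x \<notin> Z" by (simp add: AE_completion_iff)
    then show "AE x in lborel. (\<lambda>n. complex_of_real (u n x)) \<longlonglongrightarrow> complex_of_real (F N x)"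
    proof eventually_elim
      case (elim x)
      have "(\<lambda>n. T N (g n x)) \<longlonglongrightarrow> T N (f x)"
        unfolding T_def by (intro tendsto_intros lim elim)
      then show ?case unfolding u_def F_def by (intro tendsto_intros)
    qed
    fix n x
    have "\<bar>T N (g n x) - T N (f x)\<bar> \<le> 2 * real N" using T(1)[of N "g n x"] T(1)[of N "f x"] by linarith
    from cutw[OF this, of x] show "(cmod (complex_of_real (u n x) - complex_of_real (F N x)))\<^sup>2 \<le> ?w x"
      by (simp only: u_def F_def right_diff_distrib of_real_diff)
  qed simp
  then have "\<forall>\<^sub>F n in sequentially. L2_norm (\<lambda>x. complex_of_real (u n x) - complex_of_real (F N x)) < e / 3"
    using \<open>0 < e\<close> by (intro order_tendstoD(2)) auto
  then obtain n where n: "L2_norm (\<lambda>x. complex_of_real (u n x) - complex_of_real (F N x)) < e / 3"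
    by (auto simp: eventually_sequentially)
  obtain \<phi> where \<phi>: "\<phi> \<in> gaussian_fun" "L2_norm (\<lambda>x. complex_of_real (u n x) - \<phi> x) < e / 3"
    using gaussian_fun_dense_continuous[OF u[of UNIV n], of "real N + 1" "e / 3"] cut0 \<open>0 < e\<close>
    by (auto simp: u_def)
  have uL2: "(\<lambda>x. complex_of_real (u n x)) \<in> L2" and FL2: "(\<lambda>x. complex_of_real (F N x)) \<in> L2"
  proof -
    have T2: "\<bar>T N y\<bar> \<le> 2 * real N" for y using T(1)[of N y] by linarith
    show "(\<lambda>x. complex_of_real (u n x)) \<in> L2"
    proof (rule L2_bounded_by[OF _ w])
      show "(\<lambda>x. complex_of_real (u n x)) \<in> borel_measurable borel"
        by (intro borel_measurable_continuous_onI continuous_intros u)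
      show "(cmod (complex_of_real (u n x)))\<^sup>2 \<le> ?w x" for x
        unfolding u_def by (rule cutw[OF T2])
    qed
    show "(\<lambda>x. complex_of_real (F N x)) \<in> L2"
    proof (rule L2_bounded_by[OF _ w])
      show "(\<lambda>x. complex_of_real (F N x)) \<in> borel_measurable borel" by measurable
      show "(cmod (complex_of_real (F N x)))\<^sup>2 \<le> ?w x" for x
        unfolding F_def by (rule cutw[OF T2])
    qed
  qed
  have "L2_norm (\<lambda>x. complex_of_real (f x) - \<phi> x)
    \<le> L2_norm (\<lambda>x. complex_of_real (f x) - complex_of_real (F N x)) + L2_norm (\<lambda>x. complex_of_real (F N x) - \<phi> x)"
    by (rule L2_norm_triangle_diff[OF f FL2 gaussian_fun_L2[OF \<phi>(1)]])
  also have "L2_norm (\<lambda>x. complex_of_real (F N x) - \<phi> x)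
    \<le> L2_norm (\<lambda>x. complex_of_real (F N x) - complex_of_real (u n x)) + L2_norm (\<lambda>x. complex_of_real (u n x) - \<phi> x)"
    by (rule L2_norm_triangle_diff[OF FL2 uL2 gaussian_fun_L2[OF \<phi>(1)]])
  finally have "L2_norm (\<lambda>x. complex_of_real (f x) - \<phi> x) < e"
    using N n \<phi>(2) unfolding L2_norm_diff_commute[of "\<lambda>x. complex_of_real (f x)" "\<lambda>x. complex_of_real (F N x)"]
      L2_norm_diff_commute[of "\<lambda>x. complex_of_real (F N x)" "\<lambda>x. complex_of_real (u n x)"] by linarith
  then show ?thesis using \<phi>(1) by blast
qed

lemma gaussian_fun_dense:
  fixes f :: "real ^ 'd::finite \<Rightarrow> complex"
  assumes f: "f \<in> L2" and "0 < e"
  obtains \<phi> where "\<phi> \<in> gaussian_fun" "L2_norm (\<lambda>x. f x - \<phi> x) < e"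
proof -
  have fm [measurable]: "f \<in> borel_measurable borel" by (rule L2_measurable[OF f])
  have re: "(\<lambda>x. complex_of_real (Re (f x))) \<in> L2" and im: "(\<lambda>x. complex_of_real (Im (f x))) \<in> L2"
    by (rule L2_bounded_by[OF _ L2_integrable[OF f]];
        simp add: abs_Re_le_cmod abs_Im_le_cmod power2_le_iff_abs_le cmod_power2)+
  obtain \<phi> where \<phi>: "\<phi> \<in> gaussian_fun" "L2_norm (\<lambda>x. complex_of_real (Re (f x)) - \<phi> x) < e / 2"
    using gaussian_fun_dense_real[OF re, of "e / 2"] \<open>0 < e\<close> by auto
  obtain \<psi> where \<psi>: "\<psi> \<in> gaussian_fun" "L2_norm (\<lambda>x. complex_of_real (Im (f x)) - \<psi> x) < e / 2"
    using gaussian_fun_dense_real[OF im, of "e / 2"] \<open>0 < e\<close> by auto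
  let ?a = "\<lambda>x. complex_of_real (Re (f x)) - \<phi> x" and ?b = "\<lambda>x. complex_of_real (Im (f x)) - \<psi> x"
  have ab: "?a \<in> L2" "(\<lambda>x. \<i> * ?b x) \<in> L2"
    by (intro L2_diff L2_scale re im gaussian_fun_L2 \<phi> \<psi>)+
  have "(\<lambda>x. f x - (\<phi> x + \<i> * \<psi> x)) = (\<lambda>x. ?a x + \<i> * ?b x)"
  proof
    fix x
    show "f x - (\<phi> x + \<i> * \<psi> x) = ?a x + \<i> * ?b x"
      using complex_eq[of "f x"] by (simp add: right_diff_distrib)
  qed
  then have "L2_norm (\<lambda>x. f x - (\<phi> x + \<i> * \<psi> x)) \<le> L2_norm ?a + L2_norm (\<lambda>x. \<i> * ?b x)"
    using L2_norm_triangle[OF ab] by simp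
  also have "L2_norm (\<lambda>x. \<i> * ?b x) = L2_norm ?b" by (simp only: L2_norm_scale norm_ii mult_1)
  also have "L2_norm ?a + L2_norm ?b < e" using \<phi>(2) \<psi>(2) by linarith
  finally show ?thesis
    using that[of "\<lambda>x. \<phi> x + \<i> * \<psi> x"] \<phi>(1) \<psi>(1) by (simp add: gaussian_fun.add gaussian_fun.scale)
qed

section \<open>Generators of the Weyl groups\<close>

lemma square_le_of_le_self:
  fixes s r C :: real
  assumes "s\<^sup>2 \<le> C * s" "0 \<le> s" "0 \<le> C"
  shows "s \<le> C"
proof (cases "s = 0")
  case False
  then show ?thesis using assms by (simp add: power2_eq_square)
qed (use assms in simp)

text \<open>Testing with p itself would finish at once, but p is not a test function. Testing with
  an approximation of p leaves an error proportional to its distance from p.\<close>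

lemma L2_norm_le_by_duality:
  assumes p: "p \<in> L2" and "0 \<le> C"
    and C: "\<And>\<psi>. \<psi> \<in> gaussian_fun \<Longrightarrow> cmod (L2_inner p \<psi>) \<le> C * L2_norm \<psi>"
  shows "L2_norm p \<le> C"
proof (rule square_le_of_le_self)
  let ?n = "L2_norm p"
  show "?n\<^sup>2 \<le> C * ?n"
  proof (rule field_le_epsilon)
    fix \<delta> :: real assume "0 < \<delta>"
    \<comment> \<open>The total error below is at most (C + |p|) e; the extra 1 keeps the
      denominator positive.\<close>
    define e where "e = \<delta> / (C + ?n + 1)"
    have pos: "0 < C + ?n + 1" using \<open>0 \<le> C\<close> L2_norm_nonneg[of p] by linarith
    then have "0 < e" using \<open>0 < \<delta>\<close> by (simp add: e_def)
    then obtain \<psi> where \<psi>: "\<psi> \<in> gaussian_fun" "L2_norm (\<lambda>x. p x - \<psi> x) < e"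
      using gaussian_fun_dense[OF p] by blast
    have \<psi>L: "\<psi> \<in> L2" by (rule gaussian_fun_L2[OF \<psi>(1)])
    have d: "(\<lambda>x. p x - \<psi> x) \<in> L2" using p \<psi>L by (rule L2_diff)
    have n\<psi>: "L2_norm \<psi> \<le> ?n + e"
      using L2_norm_triangle_diff[OF \<psi>L p L2_zero] \<psi>(2) by (simp add: L2_norm_diff_commute[of \<psi> p])
    have "complex_of_real (?n\<^sup>2) = L2_inner p \<psi> + L2_inner p (\<lambda>x. p x - \<psi> x)"
      using p \<psi>L by (simp add: L2_inner_diff_right L2_inner_self)
    then have "?n\<^sup>2 = cmod (L2_inner p \<psi> + L2_inner p (\<lambda>x. p x - \<psi> x))"
      by (metis norm_of_real abs_power2)
    also have "\<dots> \<le> C * L2_norm \<psi> + ?n * L2_norm (\<lambda>x. p x - \<psi> x)"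
      using C[OF \<psi>(1)] L2_Cauchy_Schwarz[OF p d] by (intro order_trans[OF norm_triangle_ineq] add_mono)
    also have "\<dots> \<le> C * (?n + e) + ?n * e"
      using n\<psi> \<psi>(2) \<open>0 \<le> C\<close> by (intro add_mono mult_left_mono) (auto simp: L2_norm_nonneg)
    also have "\<dots> \<le> C * ?n + (C + ?n + 1) * e" using \<open>0 < e\<close> by (simp add: algebra_simps)
    also have "\<dots> = C * ?n + \<delta>" using pos by (simp add: e_def)
    finally show "?n\<^sup>2 \<le> C * ?n + \<delta>" .
  qed
qed (use assms in \<open>simp_all add: L2_norm_nonneg\<close>)

text \<open>\<open>u\<close> is the image of \<open>g\<close> under the infinitesimal generator of the unitary group
  \<open>s \<mapsto> weyl (s z)\<close>, first in the weak sense, tested against Gaussians.\<close>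

definition weak_weyl_derivative ::
    "'d::finite phase_space \<Rightarrow> (real ^ 'd \<Rightarrow> complex) \<Rightarrow> (real ^ 'd \<Rightarrow> complex) \<Rightarrow> bool" where
  "weak_weyl_derivative z g u \<longleftrightarrow> g \<in> L2 \<and> u \<in> L2 \<and>
    (\<forall>\<psi>\<in>gaussian_fun. L2_inner g (weyl_deriv z \<psi>) = - L2_inner u \<psi>)"

definition weyl_quotient ::
    "'d::finite phase_space \<Rightarrow> (real ^ 'd \<Rightarrow> complex) \<Rightarrow> real \<Rightarrow> real ^ 'd \<Rightarrow> complex" where
  "weyl_quotient z g s x = (weyl (s *\<^sub>R z) g x - g x) / complex_of_real s"

definition strong_weyl_derivative ::
    "'d::finite phase_space \<Rightarrow> (real ^ 'd \<Rightarrow> complex) \<Rightarrow> (real ^ 'd \<Rightarrow> complex) \<Rightarrow> bool" where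
  "strong_weyl_derivative z g u \<longleftrightarrow> g \<in> L2 \<and> u \<in> L2 \<and>
    ((\<lambda>s. L2_norm (\<lambda>x. weyl_quotient z g s x - u x)) \<longlongrightarrow> 0) (at 0)"

lemma weyl_quotient_L2: "g \<in> L2 \<Longrightarrow> weyl_quotient z g s \<in> L2"
  unfolding weyl_quotient_def [abs_def] by (intro L2_divide L2_diff weyl_L2)

text \<open>Skew-adjointness of the generator at finite step: the adjoint of
  \<open>weyl (s z)\<close> is \<open>weyl (- s z)\<close>, and the sign comes from dividing by -s
  instead of s.\<close>

lemma weyl_quotient_adjoint:
  assumes "g \<in> L2" "h \<in> L2"
  shows "L2_inner (weyl_quotient z g s) h = - L2_inner g (weyl_quotient z h (- s))"
proof -
  have "L2_inner (weyl_quotient z g s) h = (L2_inner (weyl (s *\<^sub>R z) g) h - L2_inner g h) / complex_of_real s"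
    unfolding weyl_quotient_def [abs_def] L2_inner_divide_left
    using assms by (simp add: L2_inner_diff_left weyl_L2)
  also have "\<dots> = (L2_inner g (weyl (- (s *\<^sub>R z)) h) - L2_inner g h) / complex_of_real s"
    using assms by (simp add: weyl_adjoint)
  also have "\<dots> = - L2_inner g (weyl_quotient z h (- s))"
  proof -
    have "weyl_quotient z h (- s) = (\<lambda>x. (- 1 / complex_of_real s) * (weyl (- (s *\<^sub>R z)) h x - h x))"
      by (simp add: fun_eq_iff weyl_quotient_def)
    then have "L2_inner g (weyl_quotient z h (- s)) =
        cnj (- 1 / complex_of_real s) * L2_inner g (\<lambda>x. weyl (- (s *\<^sub>R z)) h x - h x)"
      by (simp only: L2_inner_scale_right)
    then show ?thesis using assms by (simp add: L2_inner_diff_right weyl_L2)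
  qed
  finally show ?thesis .
qed

lemma filterlim_uminus_at_0: "filterlim (\<lambda>s::real. - s) (at 0) (at 0)"
  unfolding filterlim_at by (auto simp: eventually_at_filter intro!: tendsto_eq_intros)

lemma weak_weyl_derivative_quotient:
  assumes "weak_weyl_derivative z g u" "\<psi> \<in> gaussian_fun"
  shows "((\<lambda>s. L2_inner (weyl_quotient z g s) \<psi>) \<longlongrightarrow> L2_inner u \<psi>) (at 0)"
proof -
  have g: "g \<in> L2" and eq: "L2_inner g (weyl_deriv z \<psi>) = - L2_inner u \<psi>"
    using assms by (auto simp: weak_weyl_derivative_def)
  have "((\<lambda>s. - L2_inner g (weyl_quotient z \<psi> (- s))) \<longlongrightarrow> - L2_inner g (weyl_deriv z \<psi>)) (at 0)"
    unfolding weyl_quotient_def [abs_def]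
    by (intro tendsto_minus filterlim_compose[OF weyl_difference_quotient_tendsto[OF g assms(2)] filterlim_uminus_at_0])
  then show ?thesis
    by (simp add: weyl_quotient_adjoint[OF g gaussian_fun_L2[OF assms(2)]] eq)
qed

lemma has_vector_derivative_from_quotient:
  fixes f :: "real \<Rightarrow> complex"
  assumes "((\<lambda>h. (f (a + h) - f a) / complex_of_real h) \<longlongrightarrow> v) (at 0)"
  shows "(f has_vector_derivative v) (at a)"
  unfolding has_vector_derivative_def has_derivative_at
proof
  show "bounded_linear (\<lambda>h. h *\<^sub>R v)" by (rule bounded_linear_scaleR_left)
  have lim: "((\<lambda>h. norm ((f (a + h) - f a) / complex_of_real h - v)) \<longlongrightarrow> 0) (at 0)"
    using assms by (intro tendsto_norm_zero) (simp add: LIM_zero_iff)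
  show "(\<lambda>h. norm (f (a + h) - f a - h *\<^sub>R v) / norm h) \<midarrow>0\<rightarrow> 0"
  proof (rule Lim_transform_eventually[OF lim])
    show "\<forall>\<^sub>F h in at 0. norm ((f (a + h) - f a) / complex_of_real h - v)
        = norm (f (a + h) - f a - h *\<^sub>R v) / norm h"
      unfolding eventually_at_filter
    proof (intro always_eventually allI impI)
      fix h :: real assume "h \<noteq> 0"
      then have "(f (a + h) - f a) / complex_of_real h - v = (f (a + h) - f a - h *\<^sub>R v) / complex_of_real h"
        by (simp add: scaleR_conv_of_real field_simps)
      then show "norm ((f (a + h) - f a) / complex_of_real h - v)
        = norm (f (a + h) - f a - h *\<^sub>R v) / norm h"
        by (simp add: norm_divide)
    qed
  qed
qed

text \<open>For a test function, r \<mapsto> <weyl (r z) g, \<psi>> has derivative <u, weyl (-r z)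
  \<psi>>: the group law reduces r to 0, where \<open>weyl (-r z) \<psi>\<close> is again a test
  function. The derivative is bounded by |u| |\<psi>|, so the mean value inequality and duality give
  the claim.\<close>

lemma weak_weyl_derivative_increment:
  assumes wd: "weak_weyl_derivative z g u"
  shows "L2_norm (\<lambda>x. weyl (s *\<^sub>R z) g x - g x) \<le> \<bar>s\<bar> * L2_norm u"
proof (rule L2_norm_le_by_duality)
  have g: "g \<in> L2" and u: "u \<in> L2" using wd by (auto simp: weak_weyl_derivative_def)
  show "(\<lambda>x. weyl (s *\<^sub>R z) g x - g x) \<in> L2" by (intro L2_diff weyl_L2 g)
  show "0 \<le> \<bar>s\<bar> * L2_norm u" by (simp add: L2_norm_nonneg)
  fix \<psi> :: "real ^ 'a \<Rightarrow> complex" assume \<psi>: "\<psi> \<in> gaussian_fun"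
  have \<psi>L: "\<psi> \<in> L2" by (rule gaussian_fun_L2[OF \<psi>])
  define F where "F r = L2_inner (weyl (r *\<^sub>R z) g) \<psi>" for r
  have F: "(F has_vector_derivative L2_inner u (weyl (- (r *\<^sub>R z)) \<psi>)) (at r)" for r
  proof (rule has_vector_derivative_from_quotient)
    have "(F (r + h) - F r) / complex_of_real h = L2_inner (weyl_quotient z g h) (weyl (- (r *\<^sub>R z)) \<psi>)" for h
      unfolding F_def weyl_add_collinear weyl_quotient_def [abs_def] L2_inner_divide_left
      using g \<psi>L by (simp add: L2_inner_diff_left weyl_L2 weyl_adjoint[of _ \<psi> "r *\<^sub>R z"])
    then show "((\<lambda>h. (F (r + h) - F r) / complex_of_real h) \<longlongrightarrow> L2_inner u (weyl (- (r *\<^sub>R z)) \<psi>)) (at 0)"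
      using weak_weyl_derivative_quotient[OF wd gaussian_fun_weyl[OF \<psi>]] by simp
  qed
  have "norm (F s - F 0) \<le> (L2_norm u * L2_norm \<psi>) * norm (s - 0)"
  proof (rule differentiable_bound[where S = UNIV and f' = "\<lambda>r h. h *\<^sub>R L2_inner u (weyl (- (r *\<^sub>R z)) \<psi>)"])
    fix r
    show "(F has_derivative (\<lambda>h. h *\<^sub>R L2_inner u (weyl (- (r *\<^sub>R z)) \<psi>))) (at r within UNIV)"
      using F[of r] by (simp add: has_vector_derivative_def)
    have "cmod (L2_inner u (weyl (- (r *\<^sub>R z)) \<psi>)) \<le> L2_norm u * L2_norm \<psi>"
      using L2_Cauchy_Schwarz[OF u weyl_L2[OF \<psi>L]] by (simp add: weyl_norm[OF \<psi>L])
    then show "onorm (\<lambda>h. h *\<^sub>R L2_inner u (weyl (- (r *\<^sub>R z)) \<psi>)) \<le> L2_norm u * L2_norm \<psi>"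
      by (intro onorm_le) (auto simp: mult.commute intro!: mult_left_mono)
  qed auto
  then show "cmod (L2_inner (\<lambda>x. weyl (s *\<^sub>R z) g x - g x) \<psi>) \<le> \<bar>s\<bar> * L2_norm u * L2_norm \<psi>"
    using g \<psi>L by (simp add: F_def weyl_zero L2_inner_diff_left weyl_L2 mult_ac)
qed

text \<open>Weak convergence of the difference quotients together with the norm bound
  \<open>L2_norm u\<close> gives strong convergence.\<close>

lemma strong_weyl_derivativeI:
  assumes wd: "weak_weyl_derivative z g u"
  shows "strong_weyl_derivative z g u"
  unfolding strong_weyl_derivative_def
proof (intro conjI)
  show g: "g \<in> L2" and u: "u \<in> L2" using wd by (auto simp: weak_weyl_derivative_def)
  let ?q = "weyl_quotient z g"
  have q: "?q s \<in> L2" for s by (rule weyl_quotient_L2[OF g])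
  have norm_q: "L2_norm (?q s) \<le> L2_norm u" if "s \<noteq> 0" for s
    unfolding weyl_quotient_def [abs_def] L2_norm_divide
    using weak_weyl_derivative_increment[OF wd, of s] that by (simp add: field_simps)
  \<comment> \<open>Because |q| \<le> |u|, the square |q - u|^2 is at most -2 Re <q - u, u>, so weak
    convergence against u alone suffices. Weak convergence is known only against test functions;
    trading u for \<psi> costs |q - u| |u - \<psi>| \<le> 2 |u| |u - \<psi>|.\<close>
  have key: "(L2_norm (\<lambda>x. ?q s x - u x))\<^sup>2
      \<le> 2 * (cmod (L2_inner (?q s) \<psi> - L2_inner u \<psi>) + 2 * L2_norm u * L2_norm (\<lambda>x. u x - \<psi> x))"
    if "s \<noteq> 0" "\<psi> \<in> gaussian_fun" for s \<psi>
  proof -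
    have \<psi>: "\<psi> \<in> L2" by (rule gaussian_fun_L2[OF that(2)])
    let ?d = "\<lambda>x. ?q s x - u x" and ?e = "\<lambda>x. u x - \<psi> x"
    have d: "?d \<in> L2" and e: "?e \<in> L2" by (intro L2_diff q u \<psi>)+
    have "(L2_norm ?d)\<^sup>2 \<le> 2 * (L2_norm u)\<^sup>2 - 2 * Re (L2_inner (?q s) u)"
      using L2_norm_power2_diff[OF q u, of s] power_mono[OF norm_q[OF that(1)] L2_norm_nonneg, of 2] by linarith
    also have "\<dots> = - 2 * Re (L2_inner ?d u)"
      using q u by (simp add: L2_inner_diff_left L2_inner_self)
    also have "\<dots> \<le> 2 * cmod (L2_inner ?d u)"
      using abs_Re_le_cmod[of "L2_inner ?d u"] by linarith
    also have "L2_inner ?d u = (L2_inner (?q s) \<psi> - L2_inner u \<psi>) + L2_inner ?d ?e"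
      using q u \<psi> d by (simp add: L2_inner_diff_left L2_inner_diff_right)
    also have "2 * cmod \<dots> \<le> 2 * (cmod (L2_inner (?q s) \<psi> - L2_inner u \<psi>) + 2 * L2_norm u * L2_norm ?e)"
    proof -
      have "L2_norm ?d \<le> L2_norm (?q s) + L2_norm u"
        using L2_norm_triangle_diff[OF q L2_zero u, of s] L2_norm_scale[of "-1" u] by simp
      then have "L2_norm ?d \<le> 2 * L2_norm u" using norm_q[OF that(1)] by linarith
      then have "cmod (L2_inner ?d ?e) \<le> 2 * L2_norm u * L2_norm ?e"
        by (intro order_trans[OF L2_Cauchy_Schwarz[OF d e]] mult_right_mono) (auto simp: L2_norm_nonneg)
      then have "cmod ((L2_inner (?q s) \<psi> - L2_inner u \<psi>) + L2_inner ?d ?e)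
          \<le> cmod (L2_inner (?q s) \<psi> - L2_inner u \<psi>) + 2 * L2_norm u * L2_norm ?e"
        by (intro order_trans[OF norm_triangle_ineq] add_left_mono)
      then show ?thesis by (rule mult_left_mono) simp
    qed
    finally show ?thesis .
  qed
  show "((\<lambda>s. L2_norm (\<lambda>x. ?q s x - u x)) \<longlongrightarrow> 0) (at 0)"
  proof (rule tendstoI)
    fix e :: real assume "0 < e"
    define K where "K = L2_norm u + 1"
    \<comment> \<open>Chosen so that \<open>key\<close> yields 2 (e^2 / 4 + 2 e^2 / 8) =
      e^2.\<close>
    define c where "c = e\<^sup>2 / (8 * K)"
    have pos: "0 < K" using L2_norm_nonneg[of u] unfolding K_def by linarith
    then have "0 < c" using \<open>0 < e\<close> by (simp add: c_def)
    then obtain \<psi> where \<psi>: "\<psi> \<in> gaussian_fun" "L2_norm (\<lambda>x. u x - \<psi> x) < c"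
      using gaussian_fun_dense[OF u] by blast
    have "((\<lambda>s. cmod (L2_inner (?q s) \<psi> - L2_inner u \<psi>)) \<longlongrightarrow> 0) (at 0)"
      using weak_weyl_derivative_quotient[OF wd \<psi>(1)] by (intro tendsto_norm_zero) (simp add: LIM_zero_iff)
    then have "\<forall>\<^sub>F s in at 0. cmod (L2_inner (?q s) \<psi> - L2_inner u \<psi>) < e\<^sup>2 / 4"
      using \<open>0 < e\<close> by (intro order_tendstoD(2)) auto
    moreover have "\<forall>\<^sub>F s in at (0::real). s \<noteq> 0" by (simp add: eventually_at_filter)
    ultimately show "\<forall>\<^sub>F s in at 0. dist (L2_norm (\<lambda>x. ?q s x - u x)) 0 < e"
    proof eventually_elim
      case (elim s)
      have "L2_norm u * L2_norm (\<lambda>x. u x - \<psi> x) \<le> K * c"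
        using \<psi>(2) pos by (intro mult_mono) (auto simp: L2_norm_nonneg K_def)
      also have "\<dots> = e\<^sup>2 / 8" using pos by (simp add: c_def)
      finally have "(L2_norm (\<lambda>x. ?q s x - u x))\<^sup>2 < e\<^sup>2"
        using key[OF elim(2) \<psi>(1)] elim(1) by (simp add: distrib_left)
      then have "L2_norm (\<lambda>x. ?q s x - u x) < e"
        by (rule power2_less_imp_less) (use \<open>0 < e\<close> in simp)
      then show ?case by (simp add: L2_norm_nonneg)
    qed
  qed
qed

text \<open>Stands in for replacing a function by one that equals it almost everywhere.\<close>

lemma L2_inner_null:
  assumes "p \<in> L2" "p' \<in> L2" "q \<in> L2" "L2_norm (\<lambda>x. p x - p' x) = 0"
  shows "L2_inner p q = L2_inner p' q"
proof -
  have "cmod (L2_inner (\<lambda>x. p x - p' x) q) \<le> 0"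
    using L2_Cauchy_Schwarz[OF L2_diff[OF assms(1,2)] assms(3)] assms(4) by simp
  then show ?thesis using assms by (simp add: L2_inner_diff_left)
qed

text \<open>If \<open>g\<close> is invariant under \<open>weyl (s z)\<close>, then \<open>weyl z' g\<close> is an eigenvector of
  these operators with nontrivial eigenvalue, hence orthogonal to \<open>g\<close>; now let \<open>z'\<close> tend to 0.\<close>

lemma weak_weyl_derivative_zero:
  assumes wd: "weak_weyl_derivative z g (\<lambda>x. 0)" and \<Omega>: "symplectic_form z z' \<noteq> 0"
  shows "L2_norm g = 0"
proof -
  have g: "g \<in> L2" using wd by (simp add: weak_weyl_derivative_def)
  have inv: "L2_norm (\<lambda>x. weyl (s *\<^sub>R z) g x - g x) = 0" for s
    using weak_weyl_derivative_increment[OF wd, of s] L2_norm_nonneg[of "\<lambda>x. weyl (s *\<^sub>R z) g x - g x"]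
    by (simp add: L2_norm_zero)
  have orth: "L2_inner g (weyl (t *\<^sub>R z') g) = 0" if "t \<noteq> 0" for t
  proof -
    \<comment> \<open>For this s the phase in \<open>weyl_swap\<close> is cis pi = -1, the
      eigenvalue farthest from 1.\<close>
    define s where "s = 1 / (2 * t * symplectic_form z z')"
    let ?V = "weyl (t *\<^sub>R z')" and ?U = "weyl (s *\<^sub>R z)"
    have cis: "cis (2 * pi * symplectic_form (s *\<^sub>R z) (t *\<^sub>R z')) = - 1"
      using that \<Omega> by (simp add: symplectic_form_bilinear s_def)
    have L: "?U g \<in> L2" "?V g \<in> L2" "?V (?U g) \<in> L2" using g by (simp_all add: weyl_L2)
    have "L2_inner g (?V g) = L2_inner (?U g) (?U (?V g))"
      using g L by (simp add: weyl_isometry)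
    also have "?U (?V g) = (\<lambda>x. - 1 * ?V (?U g) x)"
      by (rule ext) (simp only: weyl_swap[of "s *\<^sub>R z" "t *\<^sub>R z'"] cis)
    also have "L2_inner (?U g) (\<lambda>x. - 1 * ?V (?U g) x) = - L2_inner (?U g) (?V (?U g))"
      by (simp only: L2_inner_scale_right) simp
    also have "L2_inner (?U g) (?V (?U g)) = L2_inner g (?V (?U g))"
      using L g inv by (intro L2_inner_null)
    also have "\<dots> = cnj (L2_inner (?V (?U g)) g)" by (simp add: L2_inner_cnj)
    also have "L2_inner (?V (?U g)) g = L2_inner (?U g) (weyl (- (t *\<^sub>R z')) g)"
      using L g by (simp add: weyl_adjoint)
    also have "\<dots> = L2_inner g (weyl (- (t *\<^sub>R z')) g)"
      using L g inv by (intro L2_inner_null weyl_L2)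
    also have "\<dots> = L2_inner (?V g) g" using L g by (simp add: weyl_adjoint)
    finally have "L2_inner g (?V g) = - L2_inner g (?V g)" by (simp add: L2_inner_cnj)
    then show ?thesis by (simp add: equation_minus_iff)
  qed
  have "L2_norm g \<le> 2 * e" if e: "0 < e" for e
  proof (rule square_le_of_le_self)
    obtain \<psi> where \<psi>: "\<psi> \<in> gaussian_fun" "L2_norm (\<lambda>x. g x - \<psi> x) < e"
      using gaussian_fun_dense[OF g e] by blast
    have \<psi>L: "\<psi> \<in> L2" by (rule gaussian_fun_L2[OF \<psi>(1)])
    have d: "(\<lambda>x. g x - \<psi> x) \<in> L2" using g \<psi>L by (rule L2_diff)
    \<comment> \<open>For s \<noteq> 0 the expression is <g, weyl (s z') \<psi>>. Continuity in s is
      at hand for \<psi> rather than for g; orthogonality then allows g to be subtracted from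
      \<psi>, so that each value is at most |g| e.\<close>
    have "((\<lambda>s. complex_of_real s * L2_inner g (weyl_quotient z' \<psi> s) + L2_inner g \<psi>)
        \<longlongrightarrow> complex_of_real 0 * L2_inner g (weyl_deriv z' \<psi>) + L2_inner g \<psi>) (at 0)"
      unfolding weyl_quotient_def [abs_def]
      by (intro tendsto_intros weyl_difference_quotient_tendsto g \<psi>)
    then have lim: "((\<lambda>s. cmod (complex_of_real s * L2_inner g (weyl_quotient z' \<psi> s) + L2_inner g \<psi>))
        \<longlongrightarrow> cmod (L2_inner g \<psi>)) (at 0)"
      by (intro tendsto_norm) simp
    have "cmod (L2_inner g \<psi>) \<le> L2_norm g * e"
    proof (rule tendsto_upperbound[OF lim])
      show "\<forall>\<^sub>F s in at 0. cmod (complex_of_real s * L2_inner g (weyl_quotient z' \<psi> s) + L2_inner g \<psi>) \<le> L2_norm g * e"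
        unfolding eventually_at_filter
      proof (intro always_eventually allI impI)
        fix s :: real assume s: "s \<noteq> 0"
        have w: "weyl (s *\<^sub>R z') \<psi> = (\<lambda>x. complex_of_real s * weyl_quotient z' \<psi> s x + \<psi> x)"
          using s by (simp add: fun_eq_iff weyl_quotient_def)
        have "complex_of_real s * L2_inner g (weyl_quotient z' \<psi> s) + L2_inner g \<psi> = L2_inner g (weyl (s *\<^sub>R z') \<psi>)"
          unfolding w using g \<psi>L by (simp add: L2_inner_add_right L2_inner_scale_right L2_scale weyl_quotient_L2)
        also have "\<dots> = L2_inner g (weyl (s *\<^sub>R z') g) - L2_inner g (weyl (s *\<^sub>R z') (\<lambda>x. g x - \<psi> x))"
        proof -
          have "weyl (s *\<^sub>R z') (\<lambda>x. g x - \<psi> x) = (\<lambda>x. weyl (s *\<^sub>R z') g x - weyl (s *\<^sub>R z') \<psi> x)"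
            by (simp add: fun_eq_iff weyl_diff)
          then show ?thesis using g \<psi>L by (simp add: L2_inner_diff_right weyl_L2)
        qed
        finally have eq: "complex_of_real s * L2_inner g (weyl_quotient z' \<psi> s) + L2_inner g \<psi>
            = - L2_inner g (weyl (s *\<^sub>R z') (\<lambda>x. g x - \<psi> x))" by (simp add: orth[OF s])
        show "cmod (complex_of_real s * L2_inner g (weyl_quotient z' \<psi> s) + L2_inner g \<psi>) \<le> L2_norm g * e"
          unfolding eq norm_minus_cancel
          using \<psi>(2) by (intro order_trans[OF L2_Cauchy_Schwarz[OF g weyl_L2[OF d]]] mult_left_mono)
            (auto simp: weyl_norm[OF d] L2_norm_nonneg)
      qed
    qed simp
    moreover have "cmod (L2_inner g (\<lambda>x. g x - \<psi> x)) \<le> L2_norm g * e"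
      using \<psi>(2) by (intro order_trans[OF L2_Cauchy_Schwarz[OF g d]] mult_left_mono) (auto simp: L2_norm_nonneg)
    moreover have "(L2_norm g)\<^sup>2 = cmod (L2_inner g \<psi> + L2_inner g (\<lambda>x. g x - \<psi> x))"
    proof -
      have "L2_inner g \<psi> + L2_inner g (\<lambda>x. g x - \<psi> x) = complex_of_real ((L2_norm g)\<^sup>2)"
        using g \<psi>L by (simp add: L2_inner_diff_right L2_inner_self)
      then show ?thesis by (simp only: norm_of_real abs_power2)
    qed
    ultimately show "(L2_norm g)\<^sup>2 \<le> 2 * e * L2_norm g"
      using norm_triangle_ineq[of "L2_inner g \<psi>" "L2_inner g (\<lambda>x. g x - \<psi> x)"] by (simp add: mult_ac)
  qed (use e in \<open>simp_all add: L2_norm_nonneg\<close>)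
  \<comment> \<open>With this e the bound reads |g| \<le> |g| / 2.\<close>
  from this[of "L2_norm g / 4"] show ?thesis using L2_norm_nonneg[of g] by (cases "L2_norm g = 0") auto
qed

section \<open>From distributions to generators\<close>

text \<open>Needed because distributions pair bilinearly while the inner product conjugates its
  second argument.\<close>

lemma partial_deriv_cnj:
  assumes "\<psi> \<in> gaussian_fun"
  shows "partial_deriv k (\<lambda>x. cnj (\<psi> x)) x = cnj (partial_deriv k \<psi> x)"
proof -
  let ?D = "\<lambda>h. \<Sum>j\<in>UNIV. complex_of_real (h $ j) * partial_deriv j \<psi> x"
  have D: "(\<psi> has_derivative ?D) (at x)" by (rule gaussian_fun_has_derivative[OF assms])
  have "((\<lambda>x. cnj (\<psi> x)) has_derivative (\<lambda>h. cnj (?D h))) (at x)"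
    using D by (rule has_derivative_cnj)
  note cD = frechet_derivative_at[OF this, symmetric]
  have "partial_deriv k (\<lambda>x. cnj (\<psi> x)) x = cnj (?D (axis k 1))"
    unfolding partial_deriv_def[of k "\<lambda>x. cnj (\<psi> x)"] by (subst cD) (rule refl)
  also have "?D (axis k 1) = partial_deriv k \<psi> x"
    unfolding partial_deriv_def[of k \<psi>] by (subst frechet_derivative_at[OF D, symmetric]) (rule refl)
  finally show ?thesis .
qed

lemma L2_inner_distr_of: "L2_inner u \<psi> = distr_of u (\<lambda>x. cnj (\<psi> x))"
  by (simp add: L2_inner_def distr_of_def)

text \<open>On test functions \<open>weyl_deriv (- snd v, fst v)\<close> is 2 pi i times Q_v; the
  scalar leaves the second slot conjugated, whence the minus sign. Derivatives fall on the test
  function on both sides, and the sign in \<open>distr_deriv\<close> matches the conjugation of i /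
  (2 pi).\<close>

lemma Q_op_weyl_deriv:
  assumes g: "g \<in> L2" and \<psi>: "\<psi> \<in> gaussian_fun"
  shows "L2_inner g (weyl_deriv (- snd v, fst v) \<psi>) = - (2 * complex_of_real pi * \<i>) * Q_op v g (\<lambda>x. cnj (\<psi> x))"
proof -
  let ?I = "\<lambda>k. L2_inner g (partial_deriv k \<psi>)"
  have pd: "partial_deriv k \<psi> \<in> L2" for k using \<psi> by (intro gaussian_fun_L2 gaussian_fun_partial_deriv)
  have m: "(\<lambda>x. complex_of_real (fst v \<bullet> x) * \<psi> x) \<in> L2" using \<psi> by (intro gaussian_fun_L2 gaussian_fun_inner)
  have "L2_inner g (weyl_deriv (- snd v, fst v) \<psi>) =
      cnj (2 * complex_of_real pi * \<i>) * L2_inner g (\<lambda>x. complex_of_real (fst v \<bullet> x) * \<psi> x)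
      + (\<Sum>k\<in>UNIV. complex_of_real (- snd v $ k) * ?I k)"
  proof -
    let ?S = "\<lambda>x. \<Sum>k\<in>UNIV. complex_of_real (- snd v $ k) * partial_deriv k \<psi> x"
    have "?S \<in> L2" using pd by (intro L2_sum L2_scale)
    moreover have "L2_inner g ?S = (\<Sum>k\<in>UNIV. complex_of_real (- snd v $ k) * ?I k)"
      using g pd by (subst L2_inner_sum_right) (auto simp only: L2_scale L2_inner_scale_right complex_cnj_complex_of_real)
    ultimately show ?thesis
      unfolding weyl_deriv_def [abs_def] fst_conv snd_conv
      using g m by (simp only: vector_uminus_component L2_inner_add_right L2_scale L2_inner_scale_right)
  qed
  then have 1: "L2_inner g (weyl_deriv (- snd v, fst v) \<psi>) =
      - (2 * complex_of_real pi * \<i>) * L2_inner g (\<lambda>x. complex_of_real (fst v \<bullet> x) * \<psi> x)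
      - (\<Sum>k\<in>UNIV. complex_of_real (snd v $ k) * ?I k)"
    by (simp add: sum_negf)
  have 2: "distr_mult (\<lambda>x. complex_of_real (\<Sum>k\<in>UNIV. fst v $ k * x $ k)) (distr_of g) (\<lambda>x. cnj (\<psi> x))
      = L2_inner g (\<lambda>x. complex_of_real (fst v \<bullet> x) * \<psi> x)"
    by (simp add: distr_mult_def distr_of_def L2_inner_def inner_vec_def)
  have 3: "distr_deriv k (distr_of g) (\<lambda>x. cnj (\<psi> x)) = - ?I k" for k
    unfolding distr_deriv_def L2_inner_distr_of by (simp add: partial_deriv_cnj[OF \<psi>, abs_def] fun_eq_iff)
  have *: "- (2 * p * \<i>) * M - S = - (2 * p * \<i>) * (- (\<i> / (2 * p) * S) + M)" if "p \<noteq> 0" for p M S :: complex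
    using that by (simp add: field_simps)
  show ?thesis
    unfolding Q_op_def 1 2 3 mult_minus_right sum_negf by (rule *) simp
qed

text \<open>A finite value excludes the infimum over the empty set, so a representing u exists; the
  generator then sends \<open>g\<close> to 2 pi i u.\<close>

lemma distr_L2_norm_finite_imp_derivative:
  assumes g: "g \<in> L2" and "distr_L2_norm (Q_op v g) \<noteq> \<infinity>"
  obtains u where "strong_weyl_derivative (- snd v, fst v) g u"
proof -
  obtain u where u: "u \<in> L2" "\<And>\<phi>. \<phi> \<in> schwartz \<Longrightarrow> Q_op v g \<phi> = distr_of u \<phi>"
  proof (rule ccontr)
    assume "\<not> thesis"
    then have "{u \<in> L2. \<forall>\<phi>\<in>schwartz. Q_op v g \<phi> = distr_of u \<phi>} = {}" using that by blast
    then have "distr_L2_norm (Q_op v g) = \<infinity>"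
      unfolding distr_L2_norm_def by (simp only: image_empty Inf_empty) simp
    then show False using assms(2) by simp
  qed
  have "weak_weyl_derivative (- snd v, fst v) g (\<lambda>x. 2 * complex_of_real pi * \<i> * u x)"
    unfolding weak_weyl_derivative_def
  proof (intro conjI ballI g L2_scale u(1))
    fix \<psi> assume \<psi>: "\<psi> \<in> (gaussian_fun :: (real ^ 'a \<Rightarrow> complex) set)"
    show "L2_inner g (weyl_deriv (- snd v, fst v) \<psi>) = - L2_inner (\<lambda>x. 2 * complex_of_real pi * \<i> * u x) \<psi>"
      unfolding Q_op_weyl_deriv[OF g \<psi>] L2_inner_scale_left
      using u(2)[OF gaussian_fun_schwartz[OF gaussian_fun_cnj[OF \<psi>]]] by (simp add: L2_inner_distr_of)
  qed
  then show ?thesis using strong_weyl_derivativeI that by blast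
qed

text \<open>An infimum equal to 0 is not assumed to be attained: representatives of arbitrarily
  small norm already force the distribution to vanish on every test function. Then 0 is a weak
  derivative of \<open>g\<close>, and the direction of w, on which the symplectic form does not
  vanish, refutes this.\<close>

lemma distr_L2_norm_nonzero:
  assumes g: "g \<in> L2" and nz: "L2_norm g \<noteq> 0" and \<Omega>: "symplectic_form v w \<noteq> 0"
  shows "distr_L2_norm (Q_op v g) \<noteq> 0"
proof
  assume zero: "distr_L2_norm (Q_op v g) = 0"
  let ?z = "(- snd v, fst v)"
  have "weak_weyl_derivative ?z g (\<lambda>x. 0)"
    unfolding weak_weyl_derivative_def
  proof (intro conjI ballI g L2_zero)
    fix \<psi> assume \<psi>: "\<psi> \<in> (gaussian_fun :: (real ^ 'a \<Rightarrow> complex) set)"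
    have \<psi>L: "\<psi> \<in> L2" by (rule gaussian_fun_L2[OF \<psi>])
    let ?T = "Q_op v g (\<lambda>x. cnj (\<psi> x))"
    have "cmod ?T \<le> 0 + e" if "0 < e" for e
    proof -
      define c where "c = e / (L2_norm \<psi> + 1)"
      have pos: "0 < L2_norm \<psi> + 1" using L2_norm_nonneg[of \<psi>] by linarith
      then have "0 < c" using that by (simp add: c_def)
      then have "distr_L2_norm (Q_op v g) < ennreal c" by (simp add: zero)
      then obtain u where u: "u \<in> L2" "\<forall>\<phi>\<in>schwartz. Q_op v g \<phi> = distr_of u \<phi>" "ennreal (L2_norm u) < ennreal c"
        unfolding distr_L2_norm_def by (auto simp: Inf_less_iff)
      have uc: "L2_norm u \<le> c" using u(3) by (simp add: ennreal_less_iff L2_norm_nonneg)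
      have "?T = L2_inner u \<psi>"
        using u(2) gaussian_fun_schwartz[OF gaussian_fun_cnj[OF \<psi>]] by (simp add: L2_inner_distr_of)
      then have "cmod ?T \<le> L2_norm u * L2_norm \<psi>" using L2_Cauchy_Schwarz[OF u(1) \<psi>L] by simp
      also have "\<dots> \<le> c * (L2_norm \<psi> + 1)" using uc \<open>0 < c\<close> by (intro mult_mono) (auto simp: L2_norm_nonneg)
      finally show ?thesis using pos by (simp add: c_def)
    qed
    then have "cmod ?T \<le> 0" by (rule field_le_epsilon)
    then show "L2_inner g (weyl_deriv ?z \<psi>) = - L2_inner (\<lambda>x. 0) \<psi>"
      by (simp add: Q_op_weyl_deriv[OF g \<psi>] L2_inner_zero_left)
  qed
  moreover have "symplectic_form ?z (- snd w, fst w) \<noteq> 0"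
    using \<Omega> by (simp add: symplectic_form_def case_prod_beta inner_commute algebra_simps)
  ultimately show False using weak_weyl_derivative_zero nz by blast
qed

section \<open>Commutation relations in weak form\<close>

lemma strong_weyl_derivative_continuous:
  assumes "strong_weyl_derivative z g u"
  shows "((\<lambda>t. L2_norm (\<lambda>x. weyl (t *\<^sub>R z) g x - g x)) \<longlongrightarrow> 0) (at 0)"
proof -
  have g: "g \<in> L2" and u: "u \<in> L2"
    and lim: "((\<lambda>s. L2_norm (\<lambda>x. weyl_quotient z g s x - u x)) \<longlongrightarrow> 0) (at 0)"
    using assms by (auto simp: strong_weyl_derivative_def)
  have "((\<lambda>t. \<bar>t\<bar> * (L2_norm (\<lambda>x. weyl_quotient z g t x - u x) + L2_norm u)) \<longlongrightarrow> \<bar>0\<bar> * (0 + L2_norm u)) (at 0)"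
    by (intro tendsto_intros lim)
  then have lim': "((\<lambda>t. \<bar>t\<bar> * (L2_norm (\<lambda>x. weyl_quotient z g t x - u x) + L2_norm u)) \<longlongrightarrow> 0) (at 0)"
    by simp
  show ?thesis
  proof (rule Lim_null_comparison[OF _ lim'])
    show "\<forall>\<^sub>F t in at 0. norm (L2_norm (\<lambda>x. weyl (t *\<^sub>R z) g x - g x))
        \<le> \<bar>t\<bar> * (L2_norm (\<lambda>x. weyl_quotient z g t x - u x) + L2_norm u)"
      unfolding eventually_at_filter
    proof (intro always_eventually allI impI)
      fix t :: real assume "t \<noteq> 0"
      then have "(\<lambda>x. weyl (t *\<^sub>R z) g x - g x) = (\<lambda>x. complex_of_real t * weyl_quotient z g t x)"
        by (simp add: fun_eq_iff weyl_quotient_def)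
      then have "L2_norm (\<lambda>x. weyl (t *\<^sub>R z) g x - g x) = \<bar>t\<bar> * L2_norm (weyl_quotient z g t)"
        by (simp add: L2_norm_scale)
      also have "\<dots> \<le> \<bar>t\<bar> * (L2_norm (\<lambda>x. weyl_quotient z g t x - u x) + L2_norm u)"
        using L2_norm_triangle_diff[OF weyl_quotient_L2[OF g] u L2_zero] by (intro mult_left_mono) simp_all
      finally show "norm (L2_norm (\<lambda>x. weyl (t *\<^sub>R z) g x - g x))
        \<le> \<bar>t\<bar> * (L2_norm (\<lambda>x. weyl_quotient z g t x - u x) + L2_norm u)"
        by (simp add: L2_norm_nonneg)
    qed
  qed
qed

lemma cis_quotient_tendsto: "((\<lambda>t. (cis (\<theta> * t) - 1) / complex_of_real t) \<longlongrightarrow> \<i> * complex_of_real \<theta>) (at 0)"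
proof -
  have "((\<lambda>w. exp (\<i> * (complex_of_real \<theta> * w))) has_field_derivative \<i> * complex_of_real \<theta>) (at (complex_of_real 0))"
    by (auto intro!: derivative_eq_intros)
  from has_vector_derivative_quotient[OF has_vector_derivative_real_field[OF this]]
  show ?thesis by (simp add: cis_conv_exp)
qed

lemma filterlim_square_at_0: "filterlim (\<lambda>t::real. t\<^sup>2) (at 0) (at 0)"
  unfolding filterlim_at by (auto simp: eventually_at_filter intro!: tendsto_eq_intros)

text \<open>The pairing places one generator on each argument, so that no product of generators
  occurs. Steps t for \<open>g\<close> and -t for \<open>h\<close> make the lower-order terms
  cancel; what remains are two pairings that differ by the factor cis (\<theta> t^2), and dividing
  by t^2 produces i \<theta> <g, h> in the limit.\<close>

lemma weyl_canonical_commutation: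
  assumes gu: "strong_weyl_derivative z g u" and gu': "strong_weyl_derivative z' g u'"
    and hp: "strong_weyl_derivative z h p" and hp': "strong_weyl_derivative z' h p'"
  shows "L2_inner u p' - L2_inner u' p = \<i> * complex_of_real (2 * pi * symplectic_form z z') * L2_inner g h"
proof -
  let ?\<theta> = "2 * pi * symplectic_form z z'"
  have L: "g \<in> L2" "h \<in> L2" "u \<in> L2" "u' \<in> L2" "p \<in> L2" "p' \<in> L2"
    using assms by (auto simp: strong_weyl_derivative_def)
  note q = weyl_quotient_L2[OF L(1)] weyl_quotient_L2[OF L(2)]
  have neg: "((\<lambda>t. L2_norm (\<lambda>x. weyl_quotient y f (- t) x - k x)) \<longlongrightarrow> 0) (at 0)"
    if "strong_weyl_derivative y f k" for y f k
    using that unfolding strong_weyl_derivative_def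
    by (intro filterlim_compose[OF _ filterlim_uminus_at_0, of "\<lambda>t. L2_norm (\<lambda>x. weyl_quotient y f t x - k x)"]) simp
  have pos: "((\<lambda>t. L2_norm (\<lambda>x. weyl_quotient y f t x - k x)) \<longlongrightarrow> 0) (at 0)"
    if "strong_weyl_derivative y f k" for y f k
    using that by (simp add: strong_weyl_derivative_def)
  have lim1: "((\<lambda>t. L2_inner (weyl_quotient z g t) (weyl_quotient z' h (- t))
        - L2_inner (weyl_quotient z' g t) (weyl_quotient z h (- t))) \<longlongrightarrow> L2_inner u p' - L2_inner u' p) (at 0)"
    by (intro tendsto_diff L2_inner_tendsto q L pos neg assms)
  have cont: "((\<lambda>t. L2_inner (weyl (t *\<^sub>R z) g) (weyl ((- t) *\<^sub>R z') h)) \<longlongrightarrow> L2_inner g h) (at 0)"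
    by (intro L2_inner_tendsto weyl_L2 L strong_weyl_derivative_continuous[OF gu]
      filterlim_compose[OF strong_weyl_derivative_continuous[OF hp'] filterlim_uminus_at_0])
  have "((\<lambda>t. (cis (?\<theta> * t\<^sup>2) - 1) / complex_of_real (t\<^sup>2) * L2_inner (weyl (t *\<^sub>R z) g) (weyl ((- t) *\<^sub>R z') h))
      \<longlongrightarrow> \<i> * complex_of_real ?\<theta> * L2_inner g h) (at 0)"
    by (intro tendsto_mult cont filterlim_compose[OF cis_quotient_tendsto filterlim_square_at_0])
  then have lim2: "((\<lambda>t. L2_inner (weyl_quotient z g t) (weyl_quotient z' h (- t))
        - L2_inner (weyl_quotient z' g t) (weyl_quotient z h (- t))) \<longlongrightarrow> \<i> * complex_of_real ?\<theta> * L2_inner g h) (at 0)"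
  proof (rule Lim_transform_eventually)
    show "\<forall>\<^sub>F t in at 0. (cis (?\<theta> * t\<^sup>2) - 1) / complex_of_real (t\<^sup>2) * L2_inner (weyl (t *\<^sub>R z) g) (weyl ((- t) *\<^sub>R z') h)
      = L2_inner (weyl_quotient z g t) (weyl_quotient z' h (- t)) - L2_inner (weyl_quotient z' g t) (weyl_quotient z h (- t))"
      unfolding eventually_at_filter
    proof (intro always_eventually allI impI)
      fix t :: real assume t: "t \<noteq> 0"
      define a where "a = weyl (t *\<^sub>R z) g"
      define a' where "a' = weyl (t *\<^sub>R z') g"
      define b where "b = weyl (- (t *\<^sub>R z)) h"
      define b' where "b' = weyl (- (t *\<^sub>R z')) h"
      have Lab: "a \<in> L2" "a' \<in> L2" "b \<in> L2" "b' \<in> L2"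
        unfolding a_def a'_def b_def b'_def by (intro weyl_L2 L)+
      \<comment> \<open>These two identities cancel all mixed terms when the two products of
        increments are expanded and subtracted.\<close>
      have adj: "L2_inner a h = L2_inner g b" "L2_inner a' h = L2_inner g b'"
        unfolding a_def a'_def b_def b'_def using L by (simp_all add: weyl_adjoint)
      have X: "L2_inner a b' = L2_inner (weyl (t *\<^sub>R z') a) h"
        unfolding b'_def using Lab L by (simp add: weyl_adjoint)
      have X': "L2_inner a' b = L2_inner (weyl (t *\<^sub>R z) a') h"
        unfolding b_def using Lab L by (simp add: weyl_adjoint)
      have "weyl (t *\<^sub>R z) a' = (\<lambda>x. cis (?\<theta> * t\<^sup>2) * weyl (t *\<^sub>R z') a x)"
        unfolding a_def a'_def
        by (rule ext, subst weyl_swap) (simp add: symplectic_form_bilinear power2_eq_square mult_ac)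
      then have XX: "L2_inner a' b = cis (?\<theta> * t\<^sup>2) * L2_inner a b'"
        unfolding X X' by (simp only: L2_inner_scale_left)
      have quot: "L2_inner (weyl_quotient y g t) (weyl_quotient y' h (- t)) =
          - L2_inner (\<lambda>x. weyl (t *\<^sub>R y) g x - g x) (\<lambda>x. weyl (- (t *\<^sub>R y')) h x - h x) / complex_of_real (t\<^sup>2)" for y y'
      proof -
        have "weyl_quotient y' h (- t) = (\<lambda>x. (- 1 / complex_of_real t) * (weyl (- (t *\<^sub>R y')) h x - h x))"
          by (simp add: fun_eq_iff weyl_quotient_def)
        then have "L2_inner (weyl_quotient y g t) (weyl_quotient y' h (- t)) = cnj (- 1 / complex_of_real t) *
          (L2_inner (\<lambda>x. weyl (t *\<^sub>R y) g x - g x) (\<lambda>x. weyl (- (t *\<^sub>R y')) h x - h x) / complex_of_real t)"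
          by (simp only: L2_inner_scale_right weyl_quotient_def [of y g, abs_def] L2_inner_divide_left)
        then show ?thesis by (simp add: power2_eq_square)
      qed
      have "L2_inner (weyl_quotient z g t) (weyl_quotient z' h (- t)) - L2_inner (weyl_quotient z' g t) (weyl_quotient z h (- t))
        = - (L2_inner (\<lambda>x. a x - g x) (\<lambda>x. b' x - h x) - L2_inner (\<lambda>x. a' x - g x) (\<lambda>x. b x - h x)) / complex_of_real (t\<^sup>2)"
        unfolding quot a_def a'_def b_def b'_def by (simp add: diff_divide_distrib)
      also have "L2_inner (\<lambda>x. a x - g x) (\<lambda>x. b' x - h x) - L2_inner (\<lambda>x. a' x - g x) (\<lambda>x. b x - h x) = L2_inner a b' - L2_inner a' b"
        using Lab L adj by (simp add: L2_inner_diff_left L2_inner_diff_right L2_diff)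
      also have "- (L2_inner a b' - L2_inner a' b) / complex_of_real (t\<^sup>2) = (cis (?\<theta> * t\<^sup>2) - 1) / complex_of_real (t\<^sup>2) * L2_inner a b'"
        unfolding XX by (simp add: left_diff_distrib diff_divide_distrib)
      finally show "(cis (?\<theta> * t\<^sup>2) - 1) / complex_of_real (t\<^sup>2) * L2_inner (weyl (t *\<^sub>R z) g) (weyl ((- t) *\<^sub>R z') h)
      = L2_inner (weyl_quotient z g t) (weyl_quotient z' h (- t)) - L2_inner (weyl_quotient z' g t) (weyl_quotient z h (- t))"
        by (simp add: a_def b'_def)
    qed
  qed
  show ?thesis by (rule tendsto_unique[OF _ lim1 lim2]) simp
qed

text \<open>Carrying \<open>weyl (t z)\<close> past \<open>weyl l\<close> costs the phase cis
  (\<theta> t). Hence the quotient of \<open>g\<close> splits exactly into the transported quotient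
  of \<open>h\<close> and a multiple (cis (\<theta> t) - 1) / t of <weyl (-l) g, h>. The latter
  tends to i \<theta> <weyl (-l) g, h>, the commutator term, one factor of which is 0.\<close>

lemma weyl_derivative_intertwine:
  assumes gu: "strong_weyl_derivative z g u" and hp: "strong_weyl_derivative z h p"
    and zero: "symplectic_form z l = 0 \<or> L2_inner (weyl (- l) g) h = 0"
  shows "L2_inner u (weyl l h) = - L2_inner (weyl (- l) g) p"
proof -
  let ?\<theta> = "2 * pi * symplectic_form z l"
  let ?G = "weyl (- l) g"
  have L: "g \<in> L2" "h \<in> L2" "u \<in> L2" "p \<in> L2"
    using assms by (auto simp: strong_weyl_derivative_def)
  have G: "?G \<in> L2" by (rule weyl_L2[OF L(1)])
  have null: "((\<lambda>t::real. L2_norm (\<lambda>x. k x - k x)) \<longlongrightarrow> 0) (at 0)" for k :: "real ^ 'a \<Rightarrow> complex"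
    by (simp add: L2_norm_zero)
  have lim1: "((\<lambda>t. L2_inner (weyl_quotient z g t) (weyl l h)) \<longlongrightarrow> L2_inner u (weyl l h)) (at 0)"
    using gu by (intro L2_inner_tendsto weyl_quotient_L2 weyl_L2 L null) (simp add: strong_weyl_derivative_def)
  have "((\<lambda>t. L2_inner ?G (weyl_quotient z h (- t))) \<longlongrightarrow> L2_inner ?G p) (at 0)"
    using hp unfolding strong_weyl_derivative_def
    by (intro L2_inner_tendsto weyl_quotient_L2 G L null
        filterlim_compose[OF _ filterlim_uminus_at_0, of "\<lambda>t. L2_norm (\<lambda>x. weyl_quotient z h t x - p x)"]) simp
  moreover have "((\<lambda>t. cis (?\<theta> * t)) \<longlongrightarrow> cis (?\<theta> * 0)) (at 0)"
    by (intro isCont_tendsto_compose[OF continuous_on_interior[of UNIV cis]] tendsto_intros) (auto intro: continuous_intros)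
  ultimately have "((\<lambda>t. - (cis (?\<theta> * t) * L2_inner ?G (weyl_quotient z h (- t))) +
      (cis (?\<theta> * t) - 1) / complex_of_real t * L2_inner ?G h) \<longlongrightarrow>
      - (cis (?\<theta> * 0) * L2_inner ?G p) + \<i> * complex_of_real ?\<theta> * L2_inner ?G h) (at 0)"
    by (intro tendsto_add tendsto_minus tendsto_mult cis_quotient_tendsto tendsto_const)
  also have "- (cis (?\<theta> * 0) * L2_inner ?G p) + \<i> * complex_of_real ?\<theta> * L2_inner ?G h = - L2_inner ?G p"
    using zero by auto
  finally have "((\<lambda>t. - (cis (?\<theta> * t) * L2_inner ?G (weyl_quotient z h (- t))) +
      (cis (?\<theta> * t) - 1) / complex_of_real t * L2_inner ?G h) \<longlongrightarrow> - L2_inner ?G p) (at 0)" .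
  then have lim2: "((\<lambda>t. L2_inner (weyl_quotient z g t) (weyl l h)) \<longlongrightarrow> - L2_inner ?G p) (at 0)"
  proof (rule Lim_transform_eventually)
    show "\<forall>\<^sub>F t in at 0. - (cis (?\<theta> * t) * L2_inner ?G (weyl_quotient z h (- t))) +
      (cis (?\<theta> * t) - 1) / complex_of_real t * L2_inner ?G h = L2_inner (weyl_quotient z g t) (weyl l h)"
      unfolding eventually_at_filter
    proof (intro always_eventually allI impI)
      fix t :: real assume t: "t \<noteq> 0"
      define b where "b = weyl (- (t *\<^sub>R z)) h"
      have b: "b \<in> L2" unfolding b_def by (rule weyl_L2[OF L(2)])
      have "weyl (- (t *\<^sub>R z)) (weyl l h) = (\<lambda>x. cis (- (?\<theta> * t)) * weyl l b x)"
        unfolding b_def by (rule ext, subst weyl_swap) (simp add: symplectic_form_bilinear mult_ac)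
      then have 1: "L2_inner (weyl (t *\<^sub>R z) g) (weyl l h) = cis (?\<theta> * t) * L2_inner ?G b"
        using L b by (simp add: weyl_adjoint weyl_L2 L2_inner_scale_right cis_cnj)
      have "weyl_quotient z h (- t) = (\<lambda>x. (- 1 / complex_of_real t) * (b x - h x))"
        by (simp add: fun_eq_iff weyl_quotient_def b_def)
      then have "L2_inner ?G (weyl_quotient z h (- t)) = cnj (- 1 / complex_of_real t) * L2_inner ?G (\<lambda>x. b x - h x)"
        by (simp only: L2_inner_scale_right)
      then have 2: "L2_inner ?G (weyl_quotient z h (- t)) = (L2_inner ?G h - L2_inner ?G b) / complex_of_real t"
        using G b L by (simp add: L2_inner_diff_right diff_divide_distrib)
      have 3: "L2_inner (weyl_quotient z g t) (weyl l h) = (L2_inner (weyl (t *\<^sub>R z) g) (weyl l h) - L2_inner ?G h) / complex_of_real t"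
        unfolding weyl_quotient_def [abs_def] L2_inner_divide_left
        using L by (simp add: L2_inner_diff_left weyl_L2 weyl_adjoint)
      show "- (cis (?\<theta> * t) * L2_inner ?G (weyl_quotient z h (- t))) +
      (cis (?\<theta> * t) - 1) / complex_of_real t * L2_inner ?G h = L2_inner (weyl_quotient z g t) (weyl l h)"
        unfolding 1 2 3 using t by (simp add: field_simps)
    qed
  qed
  show ?thesis by (rule tendsto_unique[OF _ lim1 lim2]) simp
qed

section \<open>Frames\<close>

lemma cmod_sum_Cauchy_Schwarz:
  fixes a b :: "'i \<Rightarrow> complex"
  shows "(cmod (\<Sum>k\<in>J. a k * b k))\<^sup>2 \<le> (\<Sum>k\<in>J. (cmod (a k))\<^sup>2) * (\<Sum>k\<in>J. (cmod (b k))\<^sup>2)"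
proof -
  have "cmod (\<Sum>k\<in>J. a k * b k) \<le> (\<Sum>k\<in>J. cmod (a k) * cmod (b k))"
    by (rule order_trans[OF norm_sum]) (simp add: norm_mult)
  then have "(cmod (\<Sum>k\<in>J. a k * b k))\<^sup>2 \<le> (\<Sum>k\<in>J. cmod (a k) * cmod (b k))\<^sup>2"
    by (simp add: power_mono)
  also have "\<dots> \<le> (\<Sum>k\<in>J. (cmod (a k))\<^sup>2) * (\<Sum>k\<in>J. (cmod (b k))\<^sup>2)"
    by (rule Cauchy_Schwarz_ineq_sum)
  finally show ?thesis .
qed

lemma has_sum_Cauchy_Schwarz:
  fixes a b :: "'i \<Rightarrow> complex"
  assumes "((\<lambda>k. a k * b k) has_sum s) I"
    and a: "(\<lambda>k. (cmod (a k))\<^sup>2) summable_on I" and b: "(\<lambda>k. (cmod (b k))\<^sup>2) summable_on I"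
  shows "(cmod s)\<^sup>2 \<le> (\<Sum>\<^sub>\<infinity>k\<in>I. (cmod (a k))\<^sup>2) * (\<Sum>\<^sub>\<infinity>k\<in>I. (cmod (b k))\<^sup>2)"
proof (rule tendsto_upperbound)
  show "((\<lambda>J. (cmod (\<Sum>k\<in>J. a k * b k))\<^sup>2) \<longlongrightarrow> (cmod s)\<^sup>2) (finite_subsets_at_top I)"
    using assms(1) unfolding has_sum_def by (intro tendsto_intros)
  show "\<forall>\<^sub>F J in finite_subsets_at_top I. (cmod (\<Sum>k\<in>J. a k * b k))\<^sup>2
      \<le> (\<Sum>\<^sub>\<infinity>k\<in>I. (cmod (a k))\<^sup>2) * (\<Sum>\<^sub>\<infinity>k\<in>I. (cmod (b k))\<^sup>2)"
  proof (rule eventually_finite_subsets_at_top_weakI)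
    fix J assume J: "finite J" "J \<subseteq> I"
    have "(\<Sum>k\<in>J. (cmod (a k))\<^sup>2) \<le> (\<Sum>\<^sub>\<infinity>k\<in>I. (cmod (a k))\<^sup>2)"
      "(\<Sum>k\<in>J. (cmod (b k))\<^sup>2) \<le> (\<Sum>\<^sub>\<infinity>k\<in>I. (cmod (b k))\<^sup>2)"
      using J a b by (auto intro: finite_sum_le_infsum)
    then show "(cmod (\<Sum>k\<in>J. a k * b k))\<^sup>2
      \<le> (\<Sum>\<^sub>\<infinity>k\<in>I. (cmod (a k))\<^sup>2) * (\<Sum>\<^sub>\<infinity>k\<in>I. (cmod (b k))\<^sup>2)"
      by (intro order_trans[OF cmod_sum_Cauchy_Schwarz] mult_mono) (auto intro: sum_nonneg infsum_nonneg)
  qed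
qed simp

text \<open>Synthesis is adjoint to analysis and inherits its bound: pair the combination y with
  itself, apply Cauchy-Schwarz to the coefficients, and cancel |y|^2.\<close>

lemma Bessel_synthesis:
  fixes f :: "'i \<Rightarrow> real ^ 'd::finite \<Rightarrow> complex"
  assumes f: "\<And>k. k \<in> J \<Longrightarrow> f k \<in> L2" and "0 \<le> B"
    and B: "\<And>h. h \<in> L2 \<Longrightarrow> (\<Sum>k\<in>J. (cmod (L2_inner h (f k)))\<^sup>2) \<le> B * (L2_norm h)\<^sup>2"
  shows "(L2_norm (\<lambda>x. \<Sum>k\<in>J. c k * f k x))\<^sup>2 \<le> B * (\<Sum>k\<in>J. (cmod (c k))\<^sup>2)"
proof -
  define y where "y = (\<lambda>x. \<Sum>k\<in>J. c k * f k x)"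
  have y: "y \<in> L2" unfolding y_def using f by (intro L2_sum L2_scale)
  have "complex_of_real ((L2_norm y)\<^sup>2) = (\<Sum>k\<in>J. c k * L2_inner (f k) y)"
    unfolding L2_inner_self[symmetric] using f y
    by (subst y_def, subst L2_inner_sum_left) (simp_all add: L2_scale L2_inner_scale_left)
  then have "((L2_norm y)\<^sup>2)\<^sup>2 = (cmod (\<Sum>k\<in>J. c k * L2_inner (f k) y))\<^sup>2"
    by (metis norm_of_real power2_abs)
  also have "\<dots> \<le> (\<Sum>k\<in>J. (cmod (c k))\<^sup>2) * (\<Sum>k\<in>J. (cmod (L2_inner (f k) y))\<^sup>2)"
    by (rule cmod_sum_Cauchy_Schwarz)
  also have "(\<Sum>k\<in>J. (cmod (L2_inner (f k) y))\<^sup>2) = (\<Sum>k\<in>J. (cmod (L2_inner y (f k)))\<^sup>2)"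
    by (subst L2_inner_cnj[symmetric]) simp
  also have "(\<Sum>k\<in>J. (cmod (c k))\<^sup>2) * \<dots> \<le> (\<Sum>k\<in>J. (cmod (c k))\<^sup>2) * (B * (L2_norm y)\<^sup>2)"
    by (intro mult_left_mono B y sum_nonneg) simp
  finally have "((L2_norm y)\<^sup>2)\<^sup>2 \<le> (B * (\<Sum>k\<in>J. (cmod (c k))\<^sup>2)) * (L2_norm y)\<^sup>2"
    by (simp add: mult_ac)
  then show ?thesis
    unfolding y_def[symmetric]
    by (rule square_le_of_le_self) (simp_all add: \<open>0 \<le> B\<close> sum_nonneg)
qed

text \<open>The converse transposition, obtained by choosing the coefficients <h, f_k>.\<close>

lemma Bessel_analysis:
  fixes f :: "'i \<Rightarrow> real ^ 'd::finite \<Rightarrow> complex"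
  assumes f: "\<And>k. k \<in> J \<Longrightarrow> f k \<in> L2" and "0 \<le> B"
    and B: "\<And>c. (L2_norm (\<lambda>x. \<Sum>k\<in>J. c k * f k x))\<^sup>2 \<le> B * (\<Sum>k\<in>J. (cmod (c k))\<^sup>2)"
    and h: "h \<in> L2"
  shows "(\<Sum>k\<in>J. (cmod (L2_inner h (f k)))\<^sup>2) \<le> B * (L2_norm h)\<^sup>2"
proof -
  define s where "s = (\<Sum>k\<in>J. (cmod (L2_inner h (f k)))\<^sup>2)"
  define y where "y = (\<lambda>x. \<Sum>k\<in>J. L2_inner h (f k) * f k x)"
  have y: "y \<in> L2" unfolding y_def using f by (intro L2_sum L2_scale)
  have s: "0 \<le> s" by (simp add: s_def sum_nonneg)
  have "L2_inner h y = (\<Sum>k\<in>J. L2_inner h (f k) * cnj (L2_inner h (f k)))"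
    using f h by (subst y_def, subst L2_inner_sum_right) (simp_all add: L2_scale L2_inner_scale_right mult.commute[of "cnj _"])
  then have "L2_inner h y = complex_of_real s"
    by (simp add: s_def complex_norm_square del: of_real_power)
  then have "s = cmod (L2_inner h y)" using s by simp
  then have "s\<^sup>2 \<le> (L2_norm h * L2_norm y)\<^sup>2"
    using L2_Cauchy_Schwarz[OF h y] by (simp add: power_mono)
  also have "\<dots> \<le> (L2_norm h)\<^sup>2 * (B * s)"
    unfolding power_mult_distrib y_def s_def by (intro mult_left_mono B) simp
  finally have "s\<^sup>2 \<le> (B * (L2_norm h)\<^sup>2) * s" by (simp add: mult_ac)
  then show ?thesis
    unfolding s_def[symmetric] by (rule square_le_of_le_self) (simp_all add: \<open>0 \<le> B\<close> s)
qed

lemma is_frameE: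
  assumes "is_frame I f"
  obtains A B where "0 < A" "A \<le> B"
    "\<And>k. k \<in> I \<Longrightarrow> f k \<in> L2"
    "\<And>h. h \<in> L2 \<Longrightarrow> (\<lambda>k. (cmod (L2_inner h (f k)))\<^sup>2) summable_on I"
    "\<And>h. h \<in> L2 \<Longrightarrow> A * (L2_norm h)\<^sup>2 \<le> (\<Sum>\<^sub>\<infinity>k\<in>I. (cmod (L2_inner h (f k)))\<^sup>2)"
    "\<And>h J. h \<in> L2 \<Longrightarrow> J \<subseteq> I \<Longrightarrow> finite J \<Longrightarrow> (\<Sum>k\<in>J. (cmod (L2_inner h (f k)))\<^sup>2) \<le> B * (L2_norm h)\<^sup>2"
proof -
  obtain A B where AB: "0 < A" "A \<le> B"
      "\<And>h. h \<in> L2 \<Longrightarrow> (\<lambda>k. (cmod (L2_inner h (f k)))\<^sup>2) summable_on I \<and>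
          A * (L2_norm h)\<^sup>2 \<le> (\<Sum>\<^sub>\<infinity>k\<in>I. (cmod (L2_inner h (f k)))\<^sup>2) \<and>
          (\<Sum>\<^sub>\<infinity>k\<in>I. (cmod (L2_inner h (f k)))\<^sup>2) \<le> B * (L2_norm h)\<^sup>2"
    and f: "\<And>k. k \<in> I \<Longrightarrow> f k \<in> L2"
    using assms unfolding is_frame_def by blast
  have "(\<Sum>k\<in>J. (cmod (L2_inner h (f k)))\<^sup>2) \<le> B * (L2_norm h)\<^sup>2"
    if "h \<in> L2" "J \<subseteq> I" "finite J" for h J
    using finite_sum_le_infsum[of "\<lambda>k. (cmod (L2_inner h (f k)))\<^sup>2" I J] AB(3)[OF that(1)] that
    by force
  then show ?thesis using that AB f by blast
qed

text \<open>One step of the frame algorithm with relaxation 1 / B, cut down to finitely many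
  indices. If s is the partial sum of squared coefficients, then Re <p, y> = s / B and |y|^2 \<le> s
  / B, so |p - y|^2 \<le> |p|^2 - s / B.\<close>

lemma frame_span_step:
  fixes f :: "'i \<Rightarrow> real ^ 'd::finite \<Rightarrow> complex"
  assumes "is_frame I f"
  obtains q where "0 \<le> q" "q < 1"
    "\<forall>p\<in>L2. \<exists>J c. finite J \<and> J \<subseteq> I \<and>
      (L2_norm (\<lambda>x. p x - (\<Sum>k\<in>J. c k * f k x)))\<^sup>2 \<le> q * (L2_norm p)\<^sup>2"
proof -
  obtain A B where AB: "0 < A" "A \<le> B" and f: "\<And>k. k \<in> I \<Longrightarrow> f k \<in> L2"
    and summ: "\<And>h. h \<in> L2 \<Longrightarrow> (\<lambda>k. (cmod (L2_inner h (f k)))\<^sup>2) summable_on I"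
    and A: "\<And>h. h \<in> L2 \<Longrightarrow> A * (L2_norm h)\<^sup>2 \<le> (\<Sum>\<^sub>\<infinity>k\<in>I. (cmod (L2_inner h (f k)))\<^sup>2)"
    and B: "\<And>h J. h \<in> L2 \<Longrightarrow> J \<subseteq> I \<Longrightarrow> finite J \<Longrightarrow>
        (\<Sum>k\<in>J. (cmod (L2_inner h (f k)))\<^sup>2) \<le> B * (L2_norm h)\<^sup>2"
    using is_frameE[OF assms] by metis
  show ?thesis
  proof (rule that[of "1 - A / (2 * B)"], goal_cases)
    case 1 show ?case using AB by (auto simp: field_simps)
  next
    case 2 show ?case using AB by (auto simp: field_simps)
  next
    case 3
    show ?case
    proof
      fix p :: "real ^ 'd \<Rightarrow> complex" assume p: "p \<in> L2"
      show "\<exists>J c. finite J \<and> J \<subseteq> I \<and>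
        (L2_norm (\<lambda>x. p x - (\<Sum>k\<in>J. c k * f k x)))\<^sup>2 \<le> (1 - A / (2 * B)) * (L2_norm p)\<^sup>2"
      proof (cases "L2_norm p = 0")
        case True
        then show ?thesis by (intro exI[of _ "{}"]) simp
      next
        case False
        let ?s = "\<lambda>k. (cmod (L2_inner p (f k)))\<^sup>2"
        \<comment> \<open>Half of the lower bound is given away: a strict inequality for the
          infinite sum survives on some finite J. Strictness is why |p| = 0 was treated
          separately.\<close>
        have "A / 2 * (L2_norm p)\<^sup>2 < A * (L2_norm p)\<^sup>2" using AB False by simp
        also have "\<dots> \<le> infsum ?s I" by (rule A[OF p])
        finally have "A / 2 * (L2_norm p)\<^sup>2 < infsum ?s I" .
        moreover have "(sum ?s \<longlongrightarrow> infsum ?s I) (finite_subsets_at_top I)"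
          using has_sum_infsum[OF summ[OF p]] by (simp add: has_sum_def)
        ultimately have "\<forall>\<^sub>F J in finite_subsets_at_top I. A / 2 * (L2_norm p)\<^sup>2 < sum ?s J"
          by (rule order_tendstoD(1)[rotated])
        then obtain J where J: "finite J" "J \<subseteq> I" and lower: "A / 2 * (L2_norm p)\<^sup>2 < sum ?s J"
          unfolding eventually_finite_subsets_at_top by blast
        define c where "c k = L2_inner p (f k) / B" for k
        define y where "y = (\<lambda>x. \<Sum>k\<in>J. c k * f k x)"
        have fJ: "\<And>k. k \<in> J \<Longrightarrow> f k \<in> L2" using f J by blast
        have y: "y \<in> L2" unfolding y_def using fJ by (intro L2_sum L2_scale)
        have "(L2_norm y)\<^sup>2 \<le> B * (\<Sum>k\<in>J. (cmod (c k))\<^sup>2)"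
          unfolding y_def using AB fJ J by (intro Bessel_synthesis B) auto
        also have "\<dots> = sum ?s J / B"
        proof -
          have "(\<Sum>k\<in>J. (cmod (c k))\<^sup>2) = sum ?s J / B\<^sup>2"
            by (simp add: c_def norm_divide power_divide sum_divide_distrib)
          then show ?thesis by (simp add: power2_eq_square)
        qed
        finally have 1: "(L2_norm y)\<^sup>2 \<le> sum ?s J / B" .
        have "L2_inner p y = (\<Sum>k\<in>J. cnj (c k) * L2_inner p (f k))"
          using fJ p by (subst y_def, subst L2_inner_sum_right) (simp_all add: L2_scale L2_inner_scale_right)
        also have "\<dots> = complex_of_real (sum ?s J / B)"
          by (simp add: c_def complex_norm_square sum_divide_distrib mult.commute del: of_real_power)
        finally have 2: "Re (L2_inner p y) = sum ?s J / B" by simp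
        have "(L2_norm (\<lambda>x. p x - y x))\<^sup>2 \<le> (L2_norm p)\<^sup>2 - sum ?s J / B"
          using L2_norm_power2_diff[OF p y] 1 2 by simp
        also have "\<dots> \<le> (L2_norm p)\<^sup>2 - (A / 2 * (L2_norm p)\<^sup>2) / B"
          using lower AB by (intro diff_left_mono divide_right_mono) auto
        also have "\<dots> = (1 - A / (2 * B)) * (L2_norm p)\<^sup>2" by (simp add: field_simps)
        finally show ?thesis using J unfolding y_def by blast
      qed
    qed
  qed
qed

text \<open>Apply the contraction repeatedly to the residual; n rounds reduce the squared norm by
  q^n and still use only finitely many vectors.\<close>

lemma frame_span_dense:
  fixes f :: "'i \<Rightarrow> real ^ 'd::finite \<Rightarrow> complex"
  assumes fr: "is_frame I f" and p: "p \<in> L2" and "0 < e"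
  obtains J c where "finite J" "J \<subseteq> I" "L2_norm (\<lambda>x. p x - (\<Sum>k\<in>J. c k * f k x)) < e"
proof -
  obtain q where q: "0 \<le> q" "q < 1" and
    step: "\<forall>p\<in>L2. \<exists>J c. finite J \<and> J \<subseteq> I \<and>
      (L2_norm (\<lambda>x. p x - (\<Sum>k\<in>J. c k * f k x)))\<^sup>2 \<le> q * (L2_norm p)\<^sup>2"
    by (rule frame_span_step[OF fr])
  have f: "\<And>k. k \<in> I \<Longrightarrow> f k \<in> L2" using fr by (auto simp: is_frame_def)
  have "\<exists>J c. finite J \<and> J \<subseteq> I \<and>
      (L2_norm (\<lambda>x. p x - (\<Sum>k\<in>J. c k * f k x)))\<^sup>2 \<le> q ^ n * (L2_norm p)\<^sup>2" for n
  proof (induction n)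
    case 0
    show ?case by (intro exI[of _ "{}"]) simp
  next
    case (Suc n)
    then obtain J c where J: "finite J" "J \<subseteq> I" and
      le: "(L2_norm (\<lambda>x. p x - (\<Sum>k\<in>J. c k * f k x)))\<^sup>2 \<le> q ^ n * (L2_norm p)\<^sup>2" by blast
    define r where "r = (\<lambda>x. p x - (\<Sum>k\<in>J. c k * f k x))"
    have "r \<in> L2" unfolding r_def using f J p by (intro L2_diff L2_sum L2_scale) auto
    then obtain J' c' where J': "finite J'" "J' \<subseteq> I" and
      le': "(L2_norm (\<lambda>x. r x - (\<Sum>k\<in>J'. c' k * f k x)))\<^sup>2 \<le> q * (L2_norm r)\<^sup>2"
      using step by blast
    define d where "d k = (if k \<in> J then c k else 0) + (if k \<in> J' then c' k else 0)" for k
    have "(\<Sum>k\<in>J \<union> J'. d k * f k x) = (\<Sum>k\<in>J. c k * f k x) + (\<Sum>k\<in>J'. c' k * f k x)" for x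
    proof -
      have "(\<Sum>k\<in>J. c k * f k x) = (\<Sum>k\<in>J \<union> J'. (if k \<in> J then c k else 0) * f k x)"
        "(\<Sum>k\<in>J'. c' k * f k x) = (\<Sum>k\<in>J \<union> J'. (if k \<in> J' then c' k else 0) * f k x)"
        using J J' by (auto intro!: sum.mono_neutral_cong_left)
      then show ?thesis by (simp add: d_def distrib_right sum.distrib)
    qed
    then have "(\<lambda>x. p x - (\<Sum>k\<in>J \<union> J'. d k * f k x)) = (\<lambda>x. r x - (\<Sum>k\<in>J'. c' k * f k x))"
      by (simp add: r_def algebra_simps)
    moreover have "q * (L2_norm r)\<^sup>2 \<le> q * (q ^ n * (L2_norm p)\<^sup>2)"
      unfolding r_def using le q(1) by (rule mult_left_mono)
    ultimately have "(L2_norm (\<lambda>x. p x - (\<Sum>k\<in>J \<union> J'. d k * f k x)))\<^sup>2 \<le> q ^ Suc n * (L2_norm p)\<^sup>2"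
      using le' by (simp add: mult_ac)
    then show ?case using J J' by (intro exI[of _ "J \<union> J'"] exI[of _ d]) simp
  qed
  note approx = this
  have "(\<lambda>n. q ^ n * (L2_norm p)\<^sup>2) \<longlonglongrightarrow> 0 * (L2_norm p)\<^sup>2"
    using q by (intro tendsto_intros LIMSEQ_power_zero) simp
  then have "\<forall>\<^sub>F n in sequentially. q ^ n * (L2_norm p)\<^sup>2 < e\<^sup>2"
    using \<open>0 < e\<close> by (intro order_tendstoD(2)) auto
  then obtain n where n: "q ^ n * (L2_norm p)\<^sup>2 < e\<^sup>2"
    by (auto simp: eventually_sequentially)
  obtain J c where J: "finite J" "J \<subseteq> I" and
    "(L2_norm (\<lambda>x. p x - (\<Sum>k\<in>J. c k * f k x)))\<^sup>2 \<le> q ^ n * (L2_norm p)\<^sup>2"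
    using approx[of n] by blast
  then have "(L2_norm (\<lambda>x. p x - (\<Sum>k\<in>J. c k * f k x)))\<^sup>2 < e\<^sup>2"
    using n by linarith
  then have "L2_norm (\<lambda>x. p x - (\<Sum>k\<in>J. c k * f k x)) < e"
    by (rule power2_less_imp_less) (use \<open>0 < e\<close> in simp)
  then show ?thesis by (rule that[OF J])
qed

text \<open>The partial sums P J are bounded by sqrt (B / A) uniformly in J and reproduce every
  finite combination of the f_k with indices in J. Density of such combinations then gives
  convergence.\<close>

lemma frame_biorthogonal_expansion:
  fixes f h :: "'i \<Rightarrow> real ^ 'd::finite \<Rightarrow> complex"
  assumes fr: "is_frame I f" and h: "\<And>k. k \<in> I \<Longrightarrow> h k \<in> L2"
    and bi: "\<And>j k. j \<in> I \<Longrightarrow> k \<in> I \<Longrightarrow> L2_inner (f k) (h j) = (if j = k then 1 else 0)"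
    and p: "p \<in> L2" and q: "q \<in> L2"
  shows "((\<lambda>k. L2_inner p (h k) * L2_inner (f k) q) has_sum L2_inner p q) I"
proof -
  obtain A B where AB: "0 < A" "A \<le> B" and f: "\<And>k. k \<in> I \<Longrightarrow> f k \<in> L2"
    and "\<And>h. h \<in> L2 \<Longrightarrow> (\<lambda>k. (cmod (L2_inner h (f k)))\<^sup>2) summable_on I"
    and A: "\<And>h. h \<in> L2 \<Longrightarrow> A * (L2_norm h)\<^sup>2 \<le> (\<Sum>\<^sub>\<infinity>k\<in>I. (cmod (L2_inner h (f k)))\<^sup>2)"
    and B: "\<And>h J. h \<in> L2 \<Longrightarrow> J \<subseteq> I \<Longrightarrow> finite J \<Longrightarrow>
        (\<Sum>k\<in>J. (cmod (L2_inner h (f k)))\<^sup>2) \<le> B * (L2_norm h)\<^sup>2"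
    using is_frameE[OF fr] by metis
  have bi': "L2_inner (h j) (f k) = (if j = k then 1 else 0)" if "j \<in> I" "k \<in> I" for j k
    using bi[OF that] L2_inner_cnj[of "f k" "h j"] by (auto split: if_splits)
  define P where "P J u = (\<lambda>x. \<Sum>k\<in>J. L2_inner u (h k) * f k x)" for J u
  have P: "P J u \<in> L2" if "J \<subseteq> I" for J u
    unfolding P_def using f that by (intro L2_sum L2_scale) auto
  \<comment> \<open>By biorthogonality the combination has frame coefficients c_k, so the lower
    frame bound is a synthesis bound 1 / A for h. \<open>Bessel_analysis\<close> then turns it into
    a Bessel bound for h.\<close>
  have dual: "(L2_norm (\<lambda>x. \<Sum>k\<in>J. c k * h k x))\<^sup>2 \<le> 1 / A * (\<Sum>k\<in>J. (cmod (c k))\<^sup>2)"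
    if J: "finite J" "J \<subseteq> I" for J c
  proof -
    let ?y = "\<lambda>x. \<Sum>k\<in>J. c k * h k x"
    have hJ: "\<And>k. k \<in> J \<Longrightarrow> h k \<in> L2" using h J by blast
    have y: "?y \<in> L2" using hJ by (intro L2_sum L2_scale)
    have coeff: "L2_inner ?y (f k) = (if k \<in> J then c k else 0)" if "k \<in> I" for k
    proof -
      have "L2_inner ?y (f k) = (\<Sum>j\<in>J. c j * L2_inner (h j) (f k))"
        using hJ f[OF that] by (subst L2_inner_sum_left) (simp_all add: L2_scale L2_inner_scale_left)
      also have "\<dots> = (\<Sum>j\<in>J. if j = k then c j else 0)"
        using J that by (intro sum.cong) (auto simp: bi')
      finally show ?thesis using J by simp
    qed
    have "A * (L2_norm ?y)\<^sup>2 \<le> (\<Sum>\<^sub>\<infinity>k\<in>I. (cmod (L2_inner ?y (f k)))\<^sup>2)" by (rule A[OF y])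
    also have "\<dots> = (\<Sum>\<^sub>\<infinity>k\<in>J. (cmod (c k))\<^sup>2)"
      using J by (intro infsum_cong_neutral) (auto simp: coeff)
    finally show ?thesis using J AB by (simp add: field_simps)
  qed
  have bound: "L2_norm (P J u) \<le> sqrt (B / A) * L2_norm u" if J: "finite J" "J \<subseteq> I" and u: "u \<in> L2" for J u
  proof (rule power2_le_imp_le)
    have "(L2_norm (P J u))\<^sup>2 \<le> B * (\<Sum>k\<in>J. (cmod (L2_inner u (h k)))\<^sup>2)"
      unfolding P_def using AB f J by (intro Bessel_synthesis B) auto
    also have "\<dots> \<le> B * (1 / A * (L2_norm u)\<^sup>2)"
      using AB h J u by (intro mult_left_mono Bessel_analysis dual) auto
    finally show "(L2_norm (P J u))\<^sup>2 \<le> (sqrt (B / A) * L2_norm u)\<^sup>2"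
      using AB by (simp add: power_mult_distrib)
  qed (use AB in \<open>simp add: L2_norm_nonneg\<close>)
  have "((\<lambda>J. \<Sum>k\<in>J. L2_inner p (h k) * L2_inner (f k) q) \<longlongrightarrow> L2_inner p q) (finite_subsets_at_top I)"
  proof (rule tendstoI)
    fix e :: real assume "0 < e"
    \<comment> \<open>The error for the remainder r is at most |r| (1 + sqrt (B / A)) |q|; the added
      1 makes K positive.\<close>
    define K where "K = (1 + sqrt (B / A)) * L2_norm q + 1"
    have K: "0 < K" using AB by (auto simp: K_def L2_norm_nonneg intro!: add_nonneg_pos mult_nonneg_nonneg add_nonneg_nonneg)
    obtain J0 c where J0: "finite J0" "J0 \<subseteq> I"
      and less: "L2_norm (\<lambda>x. p x - (\<Sum>k\<in>J0. c k * f k x)) < e / K"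
      using frame_span_dense[OF fr p, of "e / K"] K \<open>0 < e\<close> by auto
    define p0 where "p0 = (\<lambda>x. \<Sum>k\<in>J0. c k * f k x)"
    have p0: "p0 \<in> L2" unfolding p0_def using f J0 by (intro L2_sum L2_scale) auto
    have coeff: "L2_inner p0 (h k) = (if k \<in> J0 then c k else 0)" if "k \<in> I" for k
    proof -
      have "L2_inner p0 (h k) = (\<Sum>j\<in>J0. c j * L2_inner (f j) (h k))"
        unfolding p0_def using f J0 h[OF that] by (subst L2_inner_sum_left) (auto simp: L2_scale L2_inner_scale_left)
      also have "\<dots> = (\<Sum>j\<in>J0. if j = k then c j else 0)"
        using J0 that by (intro sum.cong) (auto simp: bi)
      finally show ?thesis using J0 by simp
    qed
    have "dist (\<Sum>k\<in>J. L2_inner p (h k) * L2_inner (f k) q) (L2_inner p q) < e"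
      if J: "finite J" "J \<subseteq> I" "J0 \<subseteq> J" for J
    proof -
      let ?r = "\<lambda>x. p x - p0 x"
      have r: "?r \<in> L2" using p p0 by (rule L2_diff)
      \<comment> \<open>Since P J fixes p0, the error of the partial sum depends only on the
        remainder.\<close>
      have "P J p0 = p0"
      proof
        fix x
        have "P J p0 x = (\<Sum>k\<in>J. (if k \<in> J0 then c k else 0) * f k x)"
          unfolding P_def using J by (intro sum.cong) (auto simp: coeff)
        also have "\<dots> = p0 x"
          unfolding p0_def using J by (intro sum.mono_neutral_cong_right) auto
        finally show "P J p0 x = p0 x" .
      qed
      moreover have "P J ?r x = P J p x - P J p0 x" for x
        unfolding P_def using J h p p0
        by (simp add: subsetD L2_inner_diff_left left_diff_distrib sum_subtractf cong: sum.cong)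
      ultimately have "(\<lambda>x. P J p x - p x) = (\<lambda>x. P J ?r x - ?r x)" by auto
      moreover have "(\<Sum>k\<in>J. L2_inner p (h k) * L2_inner (f k) q) = L2_inner (P J p) q"
        unfolding P_def using J f q by (subst L2_inner_sum_left) (auto simp: L2_scale L2_inner_scale_left)
      ultimately have eq: "(\<Sum>k\<in>J. L2_inner p (h k) * L2_inner (f k) q) - L2_inner p q
          = L2_inner (P J ?r) q - L2_inner ?r q"
        using L2_inner_diff_left[OF P[OF J(2)] p q, of p] L2_inner_diff_left[OF P[OF J(2)] r q, of ?r]
        by simp
      have "dist (\<Sum>k\<in>J. L2_inner p (h k) * L2_inner (f k) q) (L2_inner p q)
          \<le> cmod (L2_inner (P J ?r) q) + cmod (L2_inner ?r q)"
        unfolding dist_norm eq by (rule norm_triangle_ineq4)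
      also have "\<dots> \<le> sqrt (B / A) * L2_norm ?r * L2_norm q + L2_norm ?r * L2_norm q"
        using bound[OF J(1,2) r]
        by (intro add_mono order_trans[OF L2_Cauchy_Schwarz] mult_right_mono P J r q L2_norm_nonneg order_refl)
      also have "\<dots> = L2_norm ?r * (K - 1)" by (simp add: K_def algebra_simps)
      also have "\<dots> \<le> L2_norm ?r * K" by (simp add: mult_left_mono L2_norm_nonneg)
      also have "\<dots> < e / K * K"
        using less K unfolding p0_def by (intro mult_strict_right_mono)
      finally show ?thesis using K by simp
    qed
    then show "\<forall>\<^sub>F J in finite_subsets_at_top I. dist (\<Sum>k\<in>J. L2_inner p (h k) * L2_inner (f k) q) (L2_inner p q) < e"
      using J0 unfolding eventually_finite_subsets_at_top by blast
  qed
  then show ?thesis by (simp add: has_sum_def)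
qed

section \<open>Coefficients in an exact frame\<close>

lemma L2_has_sum_inner:
  assumes "L2_has_sum F I s" "\<And>k. k \<in> I \<Longrightarrow> F k \<in> L2" "q \<in> L2"
  shows "((\<lambda>k. L2_inner (F k) q) has_sum L2_inner s q) I"
proof -
  have s: "s \<in> L2" and lim: "((\<lambda>J. L2_norm (\<lambda>x. (\<Sum>k\<in>J. F k x) - s x)) \<longlongrightarrow> 0) (finite_subsets_at_top I)"
    using assms(1) by (auto simp: L2_has_sum_def)
  have lim': "((\<lambda>J. L2_norm (\<lambda>x. (\<Sum>k\<in>J. F k x) - s x) * L2_norm q) \<longlongrightarrow> 0) (finite_subsets_at_top I)"
    using tendsto_mult_left_zero[OF lim] .
  have "((\<lambda>J. (\<Sum>k\<in>J. L2_inner (F k) q) - L2_inner s q) \<longlongrightarrow> 0) (finite_subsets_at_top I)"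
  proof (rule Lim_null_comparison[OF _ lim'], rule eventually_finite_subsets_at_top_weakI)
    fix J assume J: "finite J" "J \<subseteq> I"
    then have F: "\<And>k. k \<in> J \<Longrightarrow> F k \<in> L2" using assms(2) by blast
    then have "(\<Sum>k\<in>J. L2_inner (F k) q) - L2_inner s q = L2_inner (\<lambda>x. (\<Sum>k\<in>J. F k x) - s x) q"
      using s assms(3) by (subst L2_inner_diff_left) (auto simp: L2_inner_sum_left intro!: L2_sum)
    then show "norm ((\<Sum>k\<in>J. L2_inner (F k) q) - L2_inner s q)
        \<le> L2_norm (\<lambda>x. (\<Sum>k\<in>J. F k x) - s x) * L2_norm q"
      using L2_Cauchy_Schwarz[OF L2_diff[OF L2_sum[OF F] s] assms(3)] by simp
  qed
  then show ?thesis unfolding has_sum_def by (simp add: LIM_zero_iff)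
qed

text \<open>Duffin and Schaeffer: if the coefficient at \<open>k0\<close> were not 1, then \<open>f k0\<close> would be a
  square-summable combination of the other vectors and could be removed.\<close>

lemma exact_frame_coefficient:
  fixes f :: "'i \<Rightarrow> real ^ 'd::finite \<Rightarrow> complex"
  assumes ex: "is_exact_frame I f" and k0: "k0 \<in> I" and op: "frame_operator I f d (f k0)" and "k \<in> I"
  shows "L2_inner d (f k) = (if k = k0 then 1 else 0)"
proof -
  define b where "b k = L2_inner d (f k)" for k
  have d: "d \<in> L2" and sum: "L2_has_sum (\<lambda>k x. b k * f k x) I (f k0)"
    using op by (auto simp: frame_operator_def b_def)
  obtain A B where AB: "0 < A" "A \<le> B" and f: "\<And>k. k \<in> I \<Longrightarrow> f k \<in> L2"
    and summ: "\<And>h. h \<in> L2 \<Longrightarrow> (\<lambda>k. (cmod (L2_inner h (f k)))\<^sup>2) summable_on I"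
    and A: "\<And>h. h \<in> L2 \<Longrightarrow> A * (L2_norm h)\<^sup>2 \<le> (\<Sum>\<^sub>\<infinity>k\<in>I. (cmod (L2_inner h (f k)))\<^sup>2)"
    and B: "\<And>h J. h \<in> L2 \<Longrightarrow> J \<subseteq> I \<Longrightarrow> finite J \<Longrightarrow>
        (\<Sum>k\<in>J. (cmod (L2_inner h (f k)))\<^sup>2) \<le> B * (L2_norm h)\<^sup>2"
    using is_frameE[of I f] ex unfolding is_exact_frame_def by metis
  have exp: "((\<lambda>k. b k * L2_inner (f k) q) has_sum L2_inner (f k0) q) I" if "q \<in> L2" for q
    using L2_has_sum_inner[OF sum _ that] f by (simp add: L2_scale L2_inner_scale_left)
  have bsum: "(\<lambda>k. (cmod (b k))\<^sup>2) summable_on I" unfolding b_def by (rule summ[OF d])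
  have cm: "cmod (L2_inner (f k) h) = cmod (L2_inner h (f k))" for h k
    by (subst L2_inner_cnj[symmetric]) simp
  have b0: "b k0 = 1"
  proof (rule ccontr)
    assume ne: "b k0 \<noteq> 1"
    let ?I = "I - {k0}"
    \<comment> \<open>Solving the expansion for f k0 and applying Cauchy-Schwarz bounds the removed
      term |<h, f k0>|^2 by D times the remaining sum; hence the lower bound A / (1 + D).\<close>
    define D where "D = (\<Sum>\<^sub>\<infinity>k\<in>?I. (cmod (b k))\<^sup>2) / (cmod (1 - b k0))\<^sup>2"
    have D: "0 \<le> D" unfolding D_def by (intro divide_nonneg_nonneg infsum_nonneg) auto
    have "is_frame ?I f"
      unfolding is_frame_def
    proof (rule conjI[OF _ exI[of _ "A / (1 + D)", OF exI[of _ B]]], safe)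
      show "0 < A / (1 + D)" using AB D by simp
      have "A / (1 + D) \<le> A / 1" using AB D by (intro divide_left_mono) auto
      then show "A / (1 + D) \<le> B" using AB by simp
      fix h :: "real ^ 'd \<Rightarrow> complex" assume h: "h \<in> L2"
      let ?s = "\<lambda>k. (cmod (L2_inner h (f k)))\<^sup>2"
      show sI: "?s summable_on ?I"
        by (rule summable_on_subset_banach[OF summ[OF h]]) auto
      show "infsum ?s ?I \<le> B * (L2_norm h)\<^sup>2"
        by (rule infsum_le_finite_sums[OF sI]) (auto intro!: B[OF h])
      have "((\<lambda>k. b k * L2_inner (f k) h) has_sum (L2_inner (f k0) h - b k0 * L2_inner (f k0) h)) ?I"
        using has_sum_Diff[OF exp[OF h] has_sum_finite[of "{k0}"]] k0 by simp
      then have "(cmod (L2_inner (f k0) h - b k0 * L2_inner (f k0) h))\<^sup>2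
          \<le> (\<Sum>\<^sub>\<infinity>k\<in>?I. (cmod (b k))\<^sup>2) * (\<Sum>\<^sub>\<infinity>k\<in>?I. (cmod (L2_inner (f k) h))\<^sup>2)"
        using sI by (intro has_sum_Cauchy_Schwarz summable_on_subset_banach[OF bsum]) (auto simp: cm)
      moreover have "L2_inner (f k0) h - b k0 * L2_inner (f k0) h = (1 - b k0) * L2_inner (f k0) h"
        by (simp add: algebra_simps)
      ultimately have "?s k0 * (cmod (1 - b k0))\<^sup>2 \<le> (\<Sum>\<^sub>\<infinity>k\<in>?I. (cmod (b k))\<^sup>2) * infsum ?s ?I"
        by (simp only: cm norm_mult power_mult_distrib mult.commute)
      moreover have "0 < (cmod (1 - b k0))\<^sup>2" using ne by simp
      ultimately have le: "?s k0 \<le> D * infsum ?s ?I"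
        by (simp only: D_def times_divide_eq_left pos_le_divide_eq)
      have "A * (L2_norm h)\<^sup>2 \<le> infsum ?s I" by (rule A[OF h])
      also have "\<dots> = ?s k0 + infsum ?s ?I"
        using infsum_insert[OF sI, of k0] k0 by (simp add: insert_absorb)
      also have "\<dots> \<le> (1 + D) * infsum ?s ?I" using le by (simp add: algebra_simps)
      finally show "A / (1 + D) * (L2_norm h)\<^sup>2 \<le> infsum ?s ?I"
        using D by (simp add: field_simps)
    qed (use f in auto)
    then show False using ex k0 by (simp add: is_exact_frame_def)
  qed
  \<comment> \<open>Testing the expansion with d makes the squares of all coefficients sum to 1. The
    coefficient at k0 alone already accounts for 1, so the others vanish.\<close>
  have "L2_inner (f k0) d = 1"
    using b0 L2_inner_cnj[of d "f k0"] by (simp add: b_def)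
  moreover have "b k * L2_inner (f k) d = complex_of_real ((cmod (b k))\<^sup>2)" for k
    by (subst L2_inner_cnj[symmetric]) (simp add: complex_norm_square b_def del: of_real_power)
  ultimately have "((\<lambda>k. complex_of_real ((cmod (b k))\<^sup>2)) has_sum 1) I"
    using exp[OF d] by simp
  then have one: "((\<lambda>k. (cmod (b k))\<^sup>2) has_sum 1) I"
    using has_sum_Re by fastforce
  show ?thesis
  proof (cases "k = k0")
    case True
    then show ?thesis using b0 by (simp add: b_def)
  next
    case False
    have "(\<Sum>j\<in>{k0, k}. (cmod (b j))\<^sup>2) \<le> 1"
      using k0 \<open>k \<in> I\<close> by (intro finite_sum_le_has_sum[OF one]) auto
    then have "b k = 0" using False b0 by simp
    then show ?thesis using False by (simp add: b_def)
  qed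
qed

lemma is_frame_unimodular:
  assumes f: "\<And>k. k \<in> I \<Longrightarrow> f k \<in> L2" and c: "\<And>k. cmod (c k) = 1"
  shows "is_frame I (\<lambda>k x. c k * f k x) \<longleftrightarrow> is_frame I f"
  using f by (simp add: is_frame_def L2_scale L2_inner_scale_right norm_mult c)

text \<open>Each phase occurs once as a factor and once conjugated inside the inner product, leaving
  |c k|^2 = 1.\<close>

lemma frame_operator_unimodular:
  assumes c: "\<And>k. cmod (c k) = 1"
  shows "frame_operator I (\<lambda>k x. c k * f k x) = frame_operator I f"
proof -
  have *: "L2_inner h (\<lambda>x. c k * f k x) * (c k * f k x) = L2_inner h (f k) * f k x" for h k x
  proof -
    have "c k * cnj (c k) = 1" using complex_norm_square[of "c k"] c[of k] by simp
    then show ?thesis by (simp add: L2_inner_scale_right mult_ac)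
  qed
  show ?thesis by (intro ext) (simp only: frame_operator_def *)
qed

lemma lattice_closed:
  assumes "is_lattice \<Lambda>"
  shows "0 \<in> \<Lambda>" "k \<in> \<Lambda> \<Longrightarrow> j \<in> \<Lambda> \<Longrightarrow> k - j \<in> \<Lambda>"
proof -
  obtain L :: "'a phase_space \<Rightarrow> 'a phase_space" where L: "linear L" "\<Lambda> = L ` integer_points"
    using assms by (auto simp: is_lattice_def)
  have "0 \<in> integer_points" by (simp add: integer_points_def zero_prod_def)
  then show "0 \<in> \<Lambda>" using L linear_0[OF L(1)] by force
  assume "k \<in> \<Lambda>" "j \<in> \<Lambda>"
  then obtain p q where pq: "p \<in> integer_points" "q \<in> integer_points" "k = L p" "j = L q" using L by auto
  then have "p - q \<in> integer_points" by (auto simp: integer_points_def)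
  then have "L (p - q) \<in> \<Lambda>" unfolding L(2) by (rule imageI)
  then show "k - j \<in> \<Lambda>" using pq linear_diff[OF L(1), of p q] by simp
qed

section \<open>The uncertainty principle\<close>

theorem theorem3p7:
  fixes \<Lambda> :: "((real ^ 'd::finite) \<times> (real ^ 'd)) set"
    and g gd :: "real ^ 'd \<Rightarrow> complex"
    and v w :: "(real ^ 'd) \<times> (real ^ 'd)"
  assumes "is_lattice \<Lambda>"
    and "g \<in> L2"
    and "is_exact_frame \<Lambda> (\<lambda>p. time_freq_shift p g)"
    and "canonical_dual \<Lambda> g gd"
    and "symplectic_form v w \<noteq> 0"
  shows "distr_L2_norm (Q_op v g) * distr_L2_norm (Q_op w g) *
         distr_L2_norm (Q_op v gd) * distr_L2_norm (Q_op w gd) = \<infinity>"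
proof -
  note g = assms(2)
  define c where "c p = cis (- (pi * (fst p \<bullet> snd p)))" for p :: "'d phase_space"
  have c: "cmod (c p) = 1" for p by (simp add: c_def)
  have tf: "(\<lambda>p. time_freq_shift p g) = (\<lambda>p x. c p * weyl p g x)"
    by (simp add: fun_eq_iff time_freq_shift_weyl c_def)
  have ex: "is_exact_frame \<Lambda> (\<lambda>p. weyl p g)"
    using assms(3) weyl_L2[OF g] unfolding tf by (simp add: is_exact_frame_def is_frame_unimodular c)
  \<comment> \<open>Writing \<open>g\<close> as the member of the family at 0 lets the coefficient
    lemma apply with k0 = 0.\<close>
  have op: "frame_operator \<Lambda> (\<lambda>p. weyl p g) gd (weyl 0 g)"
    using assms(4) unfolding canonical_dual_def tf by (simp add: frame_operator_unimodular c weyl_zero)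
  have gd: "gd \<in> L2" using op by (simp add: frame_operator_def)
  have coeff: "L2_inner (weyl k g) gd = (if k = 0 then 1 else 0)" if "k \<in> \<Lambda>" for k
    using exact_frame_coefficient[OF ex lattice_closed(1)[OF assms(1)] op that] L2_inner_cnj[of gd "weyl k g"]
    by (auto split: if_splits)
  have uminus: "- k \<in> \<Lambda>" if "k \<in> \<Lambda>" for k
    using lattice_closed(2)[OF assms(1) lattice_closed(1)[OF assms(1)] that] by simp
  \<comment> \<open>The coefficients of the single vector \<open>gd\<close> determine all pairings,
    because differences stay in the lattice. The cocycle phase is 1 for j = k, and for j \<noteq> k
    it multiplies 0.\<close>
  have biorth: "L2_inner (weyl k g) (weyl j gd) = (if j = k then 1 else 0)" if "j \<in> \<Lambda>" "k \<in> \<Lambda>" for j k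
  proof -
    have "L2_inner (weyl k g) (weyl j gd) = L2_inner (weyl (- j) (weyl k g)) gd"
      using g gd by (simp add: weyl_adjoint weyl_L2)
    also have "\<dots> = cis (pi * symplectic_form (- j) k) * L2_inner (weyl (k - j) g) gd"
    proof -
      have "weyl (- j) (weyl k g) = (\<lambda>x. cis (pi * symplectic_form (- j) k) * weyl (k - j) g x)"
        by (rule ext) (simp add: weyl_comp)
      then show ?thesis by (simp only: L2_inner_scale_left)
    qed
    also have "\<dots> = (if j = k then 1 else 0)"
      using coeff[OF lattice_closed(2)[OF assms(1) that(2,1)]]
      by (simp add: symplectic_form_bilinear symplectic_form_self)
    finally show ?thesis .
  qed
  have one: "L2_inner g gd = 1" using coeff[OF lattice_closed(1)[OF assms(1)]] by (simp add: weyl_zero)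
  have nz: "L2_norm g \<noteq> 0" "L2_norm gd \<noteq> 0"
    using L2_Cauchy_Schwarz[OF g gd] one by auto
  have \<Omega>': "symplectic_form w v \<noteq> 0" using assms(5) symplectic_form_skew[of w v] by simp
  note nonzero = distr_L2_norm_nonzero[OF g nz(1) assms(5)] distr_L2_norm_nonzero[OF g nz(1) \<Omega>']
    distr_L2_norm_nonzero[OF gd nz(2) assms(5)] distr_L2_norm_nonzero[OF gd nz(2) \<Omega>']
  show ?thesis
  proof (rule ccontr)
    assume "\<not> ?thesis"
    then have fin: "distr_L2_norm (Q_op v g) \<noteq> \<infinity>" "distr_L2_norm (Q_op w g) \<noteq> \<infinity>"
      "distr_L2_norm (Q_op v gd) \<noteq> \<infinity>" "distr_L2_norm (Q_op w gd) \<noteq> \<infinity>"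
      using nonzero by (auto simp: ennreal_mult_eq_top_iff)
    \<comment> \<open>The turn preserves the symplectic form, so the form at z and z' equals the
      form at v and w.\<close>
    define z where "z = (- snd v, fst v)"
    define z' where "z' = (- snd w, fst w)"
    obtain u where u: "strong_weyl_derivative z g u"
      using distr_L2_norm_finite_imp_derivative[OF g fin(1)] unfolding z_def .
    obtain u' where u': "strong_weyl_derivative z' g u'"
      using distr_L2_norm_finite_imp_derivative[OF g fin(2)] unfolding z'_def .
    obtain p where p: "strong_weyl_derivative z gd p"
      using distr_L2_norm_finite_imp_derivative[OF gd fin(3)] unfolding z_def .
    obtain p' where p': "strong_weyl_derivative z' gd p'"
      using distr_L2_norm_finite_imp_derivative[OF gd fin(4)] unfolding z'_def .
    have L: "u \<in> L2" "u' \<in> L2" "p \<in> L2" "p' \<in> L2"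
      using u u' p p' by (auto simp: strong_weyl_derivative_def)
    have fr: "is_frame \<Lambda> (\<lambda>p. weyl p g)" using ex by (simp add: is_exact_frame_def)
    note expansion = frame_biorthogonal_expansion[OF fr, of "\<lambda>p. weyl p gd", OF weyl_L2[OF gd] biorth]
    have inter: "L2_inner k (weyl l gd) = - L2_inner (weyl (- l) g) r"
      if "strong_weyl_derivative y g k" "strong_weyl_derivative y gd r" "l \<in> \<Lambda>" for y k r l
    proof (rule weyl_derivative_intertwine[OF that(1,2)])
      show "symplectic_form y l = 0 \<or> L2_inner (weyl (- l) g) gd = 0"
        using coeff[OF uminus[OF that(3)]] by (cases "l = 0") (auto simp: symplectic_form_def case_prod_beta)
    qed
    have "((\<lambda>l. L2_inner u (weyl l gd) * L2_inner (weyl l g) p') has_sum L2_inner u p') \<Lambda>"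
      using expansion L by blast
    \<comment> \<open>The series for <u', p> is reindexed by negation. Applying \<open>inter\<close>
      to both factors exchanges the roles of the two directions, and the two minus signs cancel, so
      its terms become those of the series for <u, p'>.\<close>
    moreover have "((\<lambda>l. L2_inner u (weyl l gd) * L2_inner (weyl l g) p') has_sum L2_inner u' p) \<Lambda>"
    proof -
      have bij: "bij_betw uminus \<Lambda> \<Lambda>"
        by (rule bij_betw_byWitness[where f' = uminus]) (use uminus in auto)
      let ?a = "\<lambda>l. L2_inner u' (weyl l gd) * L2_inner (weyl l g) p"
      have "(?a has_sum L2_inner u' p) \<Lambda>"
        using expansion L by blast
      then have "((\<lambda>l. ?a (- l)) has_sum L2_inner u' p) \<Lambda>"
        unfolding has_sum_reindex_bij_betw[OF bij, of ?a] .
      moreover have "L2_inner u' (weyl (- l) gd) * L2_inner (weyl (- l) g) p = L2_inner u (weyl l gd) * L2_inner (weyl l g) p'"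
        if "l \<in> \<Lambda>" for l
        using inter[OF u p that] inter[OF u' p' uminus[OF that]] by simp
      ultimately show ?thesis by (subst has_sum_cong[of \<Lambda> _ "\<lambda>l. ?a (- l)"]) auto
    qed
    ultimately have "L2_inner u p' = L2_inner u' p" by (rule has_sum_unique)
    then have "symplectic_form z z' = 0"
      using weyl_canonical_commutation[OF u u' p p'] one by simp
    then show False
      using assms(5) by (simp add: z_def z'_def symplectic_form_def case_prod_beta inner_commute algebra_simps)
  qed
qed

end
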